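(* Let $d\ge 1$, $T>0$, and let $\beta:\mathbb{R}\to\mathbb{R}$, $b:\mathbb{R}\to\mathbb{R}$, $D:\mathbb{R}^d\to\mathbb{R}^d$ satisfy Hypotheses (j)--(jv) listed in the context. Let $\rho_0$ be a nonnegative element of $\mathcal{M}(\mathbb{R}^d)$, and let $y_1,y_2\in L^\infty((0,T)\times\mathbb{R}^d)\cap L^1((0,T)\times\mathbb{R}^d)$ be two nonnegative solutions $\rho=y_1$, $\rho=y_2$ of $$\int_0^T\!\!\int_{\mathbb{R}^d}\big(\rho\varphi_t+\beta(\rho)\Delta\varphi+b(\rho)\rho\,(D\cdot\nabla\varphi)\big)\,dx\,dt+\int_{\mathbb{R}^d}\varphi(0,x)\,\rho_0(dx)=0\quad\text{for all }\varphi\in C_0^\infty([0,T)\times\mathbb{R}^d).$$ Then $y_1\equiv y_2$ (a.e. on $(0,T)\times\mathbb{R}^d$).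
   Context: Hypotheses: (j) $\beta\in C^1(\mathbb{R})$, $\beta'(r)\ge0$ for all $r\in\mathbb{R}$, $\beta(0)=0$. (jj) $D\in L^\infty(\mathbb{R}^d;\mathbb{R}^d)$. (jjj) $b\in C^1(\mathbb{R})$. (jv) For each compact $K\subset\mathbb{R}$ there exists $\alpha_K\in(0,\infty)$ such that $|b'(r)r+b(r)|\le\alpha_K|\beta'(r)|$ for all $r\in K$ (or, equivalently, $|b(r)r-b(\bar r)\bar r|\le\alpha_K|\beta(r)-\beta(\bar r)|$ for all $r,\bar r\in K$). $\mathcal{M}(\mathbb{R}^d)$ is the space of signed Radon measures on $\mathbb{R}^d$ of bounded variation. $C_0^\infty([0,T)\times\mathbb{R}^d)$ denotes smooth functions with compact support in $[0,T)\times\mathbb{R}^d$. *)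

theory Defs
  imports "HOL-Analysis.Analysis"
begin

text \<open>
  Continuous differentiability of order \<open>k\<close> on a set, with derivatives taken within the set.
  At a boundary point belonging to the set this is one-sided differentiability, so the notion is
  meant for sets on which such derivatives are unique, such as \<open>[0,T) \<times> \<real>\<^sup>d\<close>.
  In finite dimension, continuity of \<open>f'\<close> is the same as continuity of \<open>x \<mapsto> f' x v\<close> for every \<open>v\<close>.
\<close>

primrec Ck_on :: "nat \<Rightarrow> ('a::euclidean_space \<Rightarrow> 'b::euclidean_space) \<Rightarrow> 'a set \<Rightarrow> bool" where
  "Ck_on 0 f S \<longleftrightarrow> continuous_on S f"
| "Ck_on (Suc k) f S \<longleftrightarrow>
     (\<exists>f'. (\<forall>x\<in>S. (f has_derivative f' x) (at x within S)) \<and> (\<forall>v. Ck_on k (\<lambda>x. f' x v) S))"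

definition smooth_on :: "('a::euclidean_space \<Rightarrow> 'b::euclidean_space) \<Rightarrow> 'a set \<Rightarrow> bool" where
  "smooth_on f S \<longleftrightarrow> (\<forall>k. Ck_on k f S)"

text \<open>
  The space \<open>C\<^sub>0\<^sup>\<infinity>([0,T) \<times> \<real>\<^sup>d)\<close>. Its members need not vanish at \<open>t = 0\<close>; the values of the
  total function \<open>\<phi>\<close> outside \<open>[0,T) \<times> \<real>\<^sup>d\<close> are irrelevant. The closure is taken in
  \<open>\<real> \<times> \<real>\<^sup>d\<close>, and the inclusion keeps the support away from \<open>t = T\<close>.
\<close>

definition test_functions :: "real \<Rightarrow> (real \<times> (real ^ 'd) \<Rightarrow> real) set" where
  "test_functions T = {\<phi>.
     smooth_on \<phi> ({0..<T} \<times> UNIV) \<and>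
     compact (closure {z \<in> {0..<T} \<times> UNIV. \<phi> z \<noteq> 0}) \<and>
     closure {z \<in> {0..<T} \<times> UNIV. \<phi> z \<noteq> 0} \<subseteq> {0..<T} \<times> UNIV}"

definition partial_deriv :: "'d \<Rightarrow> (real ^ 'd \<Rightarrow> real) \<Rightarrow> real ^ 'd \<Rightarrow> real" where
  "partial_deriv i f x = deriv (\<lambda>h. f (x + h *\<^sub>R axis i 1)) 0"

definition grad :: "(real ^ 'd \<Rightarrow> real) \<Rightarrow> real ^ 'd \<Rightarrow> real ^ 'd" where
  "grad f x = (\<chi> i. partial_deriv i f x)"

definition laplacian :: "(real ^ 'd \<Rightarrow> real) \<Rightarrow> real ^ 'd \<Rightarrow> real" where
  "laplacian f x = (\<Sum>i\<in>UNIV. partial_deriv i (partial_deriv i f) x)"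

text \<open>Representatives of classes in \<open>L\<^sup>\<infinity>\<close>.\<close>

definition L_infinity :: "'a measure \<Rightarrow> ('a \<Rightarrow> 'b::euclidean_space) set" where
  "L_infinity M = {f. f \<in> borel_measurable M \<and> (\<exists>C. AE x in M. norm (f x) \<le> C)}"

text \<open>
  Distributional solutions of
  \<open>\<rho>\<^sub>t - \<Delta> \<beta>(\<rho>) + div (D b(\<rho>) \<rho>) = 0\<close> on \<open>(0,T) \<times> \<real>\<^sup>d\<close> with \<open>\<rho>(0) = \<rho>\<^sub>0\<close>.
  Only \<open>t \<in> (0,T)\<close> enters the first integral, so the derivatives of \<open>\<phi>\<close> are ordinary ones there.
\<close>

definition distributional_solution ::
  "real \<Rightarrow> (real \<Rightarrow> real) \<Rightarrow> (real \<Rightarrow> real) \<Rightarrow> (real ^ 'd \<Rightarrow> real ^ 'd) \<Rightarrow> (real ^ 'd) measure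
     \<Rightarrow> (real \<times> (real ^ 'd) \<Rightarrow> real) \<Rightarrow> bool" where
  "distributional_solution T \<beta> b D \<rho>\<^sub>0 \<rho> \<longleftrightarrow>
     (\<forall>\<phi> \<in> test_functions T.
        (LINT t:{0<..<T}|lebesgue. LINT x|lebesgue.
            \<rho> (t, x) * deriv (\<lambda>s. \<phi> (s, x)) t
          + \<beta> (\<rho> (t, x)) * laplacian (\<lambda>\<xi>. \<phi> (t, \<xi>)) x
          + b (\<rho> (t, x)) * \<rho> (t, x) * (D x \<bullet> grad (\<lambda>\<xi>. \<phi> (t, \<xi>)) x))
        + (LINT x|\<rho>\<^sub>0. \<phi> (0, x)) = 0)"

end

theory Submission
  imports Defs "HOL-Probability.Probability"
begin

text \<open>
  Put \<open>z = y\<^sub>1 - y\<^sub>2\<close>, \<open>w = \<beta>(y\<^sub>1) - \<beta>(y\<^sub>2)\<close> and \<open>G = (b(y\<^sub>1) y\<^sub>1 - b(y\<^sub>2) y\<^sub>2) D\<close>, so that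
  \<open>z\<^sub>t = \<Delta>w - div G\<close> with zero initial value. On the bounded range of the solutions the
  hypotheses give \<open>w\<^sup>2 \<le> L z w\<close> and \<open>\<bar>G\<bar> \<le> \<kappa> \<bar>w\<bar>\<close>. Pairing the equation with \<open>(1 - \<Delta>)\<^sup>-\<^sup>1 z\<close>
  produces the good term \<open>- \<integral> z w \<le> - \<parallel>w\<parallel>\<^sup>2 / L\<close>, which absorbs all other occurrences of \<open>w\<close> and
  \<open>G\<close> up to a multiple of the energy \<open>E = \<integral> z (1 - \<Delta>)\<^sup>-\<^sup>1 z\<close>; Gronwall's inequality then forces
  \<open>E = 0\<close>. Since \<open>z\<close>, \<open>w\<close> and \<open>G\<close> are integrable and bounded, the pairing can be carried out on
  Fourier transforms in \<open>x\<close>: testing with truncated plane waves shows that at every frequency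
  the transform of \<open>z\<close> is absolutely continuous in time, and Plancherel's theorem converts the
  pairings into integrals over the frequencies.
\<close>

section \<open>Fourier transform and Plancherel's theorem\<close>

text \<open>The diffusion may degenerate: where the derivative of \<beta> vanishes, w carries no
  information on z, so z is measured in a norm of negative order. The operator is 1 - Laplacian and
  not the Laplacian alone because 1/|xi|^2 is not integrable near frequency 0 in low dimension; the
  price is the splitting |xi|^2/(1+|xi|^2) = 1 - 1/(1+|xi|^2), whose second term leaves a lower
  order pairing of z with w. This pairing and the drift are treated by Young's inequality with
  weights under which each uses at most half of the good term. No continuity in time is known
  beforehand: identities hold for almost every t only, so the energy identity and Gronwall's
  inequality appear in integrated form. Both solutions have the same initial measure, whose
  contribution cancels in the difference; test functions that do not vanish at t = 0 then encode the
  zero initial value. Bounded Borel representatives make all bounds pointwise, and for bounded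
  integrable functions the transform is a plain integral, so Plancherel's theorem needs no extension
  by density.\<close>

lemma norm_sum_Basis_square: "(\<Sum>b\<in>Basis. (x \<bullet> b)\<^sup>2) = (norm x)\<^sup>2" for x :: "'a::euclidean_space"
  using euclidean_inner[of x x] unfolding power2_norm_eq_inner by (simp add: power2_eq_square)

lemma integrable_mult_bounded:
  fixes h k :: "'a \<Rightarrow> real"
  assumes h: "integrable M h" and [measurable]: "k \<in> borel_measurable M" and k: "\<And>x. \<bar>k x\<bar> \<le> C"
  shows "integrable M (\<lambda>x. h x * k x)"
proof (rule Bochner_Integration.integrable_bound[OF integrable_mult_left[OF h, of C]])
  show "AE x in M. norm (h x * k x) \<le> norm (h x * C)"
    using order_trans[OF k abs_ge_self] by (auto simp: abs_mult intro!: mult_left_mono)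
qed (use h in auto)

section \<open>Continuity of translations in L^1\<close>

lemma integral_translate_lborel:
  fixes f :: "'a::euclidean_space \<Rightarrow> 'b::{banach, second_countable_topology}"
  assumes [measurable]: "f \<in> borel_measurable borel"
  shows "(LINT x|lborel. f (x + h)) = (LINT x|lborel. f x)"
proof -
  have "(LINT x|lborel. f x) = (LINT x|distr lborel borel (\<lambda>x. h + x). f x)"
    by (simp add: lborel_distr_plus)
  also have "\<dots> = (LINT x|lborel. f (h + x))"
    by (rule integral_distr) auto
  finally show ?thesis by (simp add: add.commute)
qed

lemma integrable_translate_lborel:
  fixes f :: "'a::euclidean_space \<Rightarrow> 'b::{banach, second_countable_topology}"
  assumes "integrable lborel f"
  shows "integrable lborel (\<lambda>x. f (x + h))"
proof -
  have [measurable]: "f \<in> borel_measurable borel" using assms by auto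
  have "integrable (distr lborel borel (\<lambda>x. h + x)) f"
    using assms by (simp add: lborel_distr_plus)
  then have "integrable lborel (\<lambda>x. f (h + x))"
    by (subst (asm) integrable_distr_eq) auto
  then show ?thesis by (simp add: add.commute)
qed

text \<open>The absolute difference of two indicators is their sum minus twice their product, so
  only the product has to converge. Openness gives this pointwise: a point of \<open>U\<close> stays
  in \<open>U\<close> under small translations, and points outside contribute nothing.\<close>

lemma integral_translate_open_tendsto_0:
  fixes U :: "'a::euclidean_space set"
  assumes "open U" "emeasure lborel U < \<infinity>" "h \<longlonglongrightarrow> 0"
  shows "(\<lambda>n. LINT x|lborel. \<bar>indicat_real U (x + h n) - indicat_real U x\<bar>) \<longlonglongrightarrow> 0"
proof -
  have [measurable]: "U \<in> sets borel" using assms by auto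
  have i: "integrable lborel (indicat_real U)" using assms by auto
  note i' = integrable_translate_lborel[OF i]
  have ii: "integrable lborel (\<lambda>x. indicat_real U x * indicat_real U (x + k))" for k
    by (rule Bochner_Integration.integrable_bound[OF i]) (auto simp: indicator_def)
  have "(LINT x|lborel. \<bar>indicat_real U (x + k) - indicat_real U x\<bar>)
     = 2 * (LINT x|lborel. indicat_real U x) - 2 * (LINT x|lborel. indicat_real U x * indicat_real U (x + k))" for k
  proof -
    have "(LINT x|lborel. \<bar>indicat_real U (x + k) - indicat_real U x\<bar>) =
       (LINT x|lborel. (indicat_real U (x + k) + indicat_real U x) - 2 * (indicat_real U x * indicat_real U (x + k)))"
      by (intro Bochner_Integration.integral_cong refl) (auto simp: indicator_def)
    also have "\<dots> = (LINT x|lborel. indicat_real U (x + k)) + (LINT x|lborel. indicat_real U x)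
       - 2 * (LINT x|lborel. indicat_real U x * indicat_real U (x + k))"
      using i i'[of k] ii[of k] by (subst Bochner_Integration.integral_diff) auto
    also have "(LINT x|lborel. indicat_real U (x + k)) = (LINT x|lborel. indicat_real U x)"
      by (rule integral_translate_lborel) auto
    finally show ?thesis by simp
  qed
  moreover have "(\<lambda>n. LINT x|lborel. indicat_real U x * indicat_real U (x + h n)) \<longlonglongrightarrow> (LINT x|lborel. indicat_real U x)"
  proof (rule integral_dominated_convergence[where w="indicat_real U"])
    show "AE x in lborel. (\<lambda>n. indicat_real U x * indicat_real U (x + h n)) \<longlonglongrightarrow> indicat_real U x"
    proof (rule AE_I2)
      fix x :: 'a
      show "(\<lambda>n. indicat_real U x * indicat_real U (x + h n)) \<longlonglongrightarrow> indicat_real U x"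
      proof (cases "x \<in> U")
        case True
        have "(\<lambda>n. x + h n) \<longlonglongrightarrow> x + 0" by (intro tendsto_intros assms)
        then have "\<forall>\<^sub>F n in sequentially. x + h n \<in> U"
          using topological_tendstoD[of "\<lambda>n. x + h n" x sequentially U] True assms(1) by simp
        then have "\<forall>\<^sub>F n in sequentially. indicat_real U x * indicat_real U (x + h n) = indicat_real U x"
          by eventually_elim (simp add: True)
        then show ?thesis by (rule tendsto_eventually)
      qed simp
    qed
  qed (use i in \<open>auto simp: indicator_def\<close>)
  ultimately show ?thesis
    by (auto intro!: tendsto_eq_intros)
qed

text \<open>Outer regularity supplies an open \<open>U\<close> around \<open>A\<close> with small
  remainder. The remainder is counted twice, once translated and once not, hence the split of
  \<open>e\<close> into a half and two quarters.\<close>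

lemma integral_translate_indicator_tendsto_0:
  fixes A :: "'a::euclidean_space set"
  assumes A: "A \<in> sets lborel" "emeasure lborel A < \<infinity>" and h: "h \<longlonglongrightarrow> 0"
  shows "(\<lambda>n. LINT x|lborel. \<bar>indicat_real A (x + h n) - indicat_real A x\<bar>) \<longlonglongrightarrow> 0"
proof (rule LIMSEQ_I, goal_cases)
  case (1 e)
  from A have [measurable]: "A \<in> sets borel" by simp
  from outer_regular_lborel[of A "e/4"] 1
  obtain U where U: "open U" "A \<subseteq> U" "emeasure lborel (U - A) < ennreal (e/4)" by auto
  have [measurable]: "U \<in> sets borel" using U by auto
  have "emeasure lborel U = emeasure lborel A + emeasure lborel (U - A)"
    using U by (subst plus_emeasure) (auto intro!: arg_cong[where f="emeasure lborel"])
  with A U have fin: "emeasure lborel U < \<infinity>"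
    by (metis ennreal_add_less_top ennreal_less_top infinity_ennreal_def order.strict_trans)
  have fin': "emeasure lborel (U - A) < \<infinity>"
    using U(3) ennreal_less_top order.strict_trans by fastforce
  have iD: "integrable lborel (indicat_real (U - A))" using fin' by auto
  have iU: "integrable lborel (indicat_real U)" using fin by auto
  have iA: "integrable lborel (indicat_real A)" using A by auto
  note t = integrable_translate_lborel
  have D: "(LINT x|lborel. indicat_real (U - A) x) < e/4"
  proof -
    have "ennreal (measure lborel (U - A)) < ennreal (e/4)"
      using U(3) fin' by (metis emeasure_eq_ennreal_measure infinity_ennreal_def less_irrefl)
    then show ?thesis using 1 by (simp add: ennreal_less_iff)
  qed
  from integral_translate_open_tendsto_0[OF U(1) fin h]
  have "\<forall>\<^sub>F n in sequentially. (LINT x|lborel. \<bar>indicat_real U (x + h n) - indicat_real U x\<bar>) < e/2"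
    using 1 by (intro order_tendstoD) auto
  then obtain N where N: "\<And>n. n \<ge> N \<Longrightarrow> (LINT x|lborel. \<bar>indicat_real U (x + h n) - indicat_real U x\<bar>) < e/2"
    unfolding eventually_sequentially by auto
  have "norm ((LINT x|lborel. \<bar>indicat_real A (x + h n) - indicat_real A x\<bar>) - 0) < e" if "n \<ge> N" for n
  proof -
    have "(LINT x|lborel. \<bar>indicat_real A (x + h n) - indicat_real A x\<bar>) \<le>
      (LINT x|lborel. \<bar>indicat_real U (x + h n) - indicat_real U x\<bar> + (indicat_real (U - A) (x + h n) + indicat_real (U - A) x))"
    proof (rule integral_mono)
      show "\<bar>indicat_real A (x + h n) - indicat_real A x\<bar> \<le> \<bar>indicat_real U (x + h n) - indicat_real U x\<bar>
          + (indicat_real (U - A) (x + h n) + indicat_real (U - A) x)" for x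
        using U(2) by (auto simp: indicator_def)
    qed (intro integrable_abs Bochner_Integration.integrable_diff Bochner_Integration.integrable_add iD iU iA t)+
    also have "\<dots> = (LINT x|lborel. \<bar>indicat_real U (x + h n) - indicat_real U x\<bar>)
       + ((LINT x|lborel. indicat_real (U - A) (x + h n)) + (LINT x|lborel. indicat_real (U - A) x))"
      using iD iU t[OF iD, of "h n"] t[OF iU, of "h n"]
      by (subst Bochner_Integration.integral_add) auto
    also have "(LINT x|lborel. indicat_real (U - A) (x + h n)) = (LINT x|lborel. indicat_real (U - A) x)"
      by (rule integral_translate_lborel) auto
    also have "(LINT x|lborel. \<bar>indicat_real U (x + h n) - indicat_real U x\<bar>) + ((LINT x|lborel. indicat_real (U - A) x) + (LINT x|lborel. indicat_real (U - A) x)) < e/2 + (e/4 + e/4)"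
      using N[OF that] D by linarith
    finally have "(LINT x|lborel. \<bar>indicat_real A (x + h n) - indicat_real A x\<bar>) < e" by simp
    moreover have "0 \<le> (LINT x|lborel. \<bar>indicat_real A (x + h n) - indicat_real A x\<bar>)" by simp
    ultimately show ?thesis by simp
  qed
  then show ?case by blast
qed

text \<open>Density argument along \<open>integrable_induct\<close>: indicators, sums, then
  dominated pointwise limits, where translation invariance makes the approximation error the same at
  the shifted argument.\<close>

proposition translation_continuous_L1:
  fixes f :: "'a::euclidean_space \<Rightarrow> real"
  assumes f: "integrable lborel f" and h: "h \<longlonglongrightarrow> 0"
  shows "(\<lambda>n. LINT x|lborel. \<bar>f (x + h n) - f x\<bar>) \<longlonglongrightarrow> 0"
  using f
proof (induction rule: integrable_induct)
  case (base A c)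
  have "(\<lambda>n. (LINT x|lborel. \<bar>indicat_real A (x + h n) - indicat_real A x\<bar>) * \<bar>c\<bar>) \<longlonglongrightarrow> 0"
    by (rule tendsto_eq_intros integral_translate_indicator_tendsto_0[OF base h])+ auto
  moreover have "(LINT x|lborel. \<bar>indicat_real A (x + h n) *\<^sub>R c - indicat_real A x *\<^sub>R c\<bar>)
     = (LINT x|lborel. \<bar>indicat_real A (x + h n) - indicat_real A x\<bar>) * \<bar>c\<bar>" for n
    by (simp add: abs_mult flip: left_diff_distrib)
  ultimately show ?case by simp
next
  case (add f g)
  note t = integrable_translate_lborel[OF add(1)] integrable_translate_lborel[OF add(2)]
  show ?case
  proof (rule tendsto_sandwich[OF _ _ tendsto_const tendsto_add_zero[OF add(3,4)]])
    show "\<forall>\<^sub>F n in sequentially. (LINT x|lborel. \<bar>f (x + h n) + g (x + h n) - (f x + g x)\<bar>)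
       \<le> (LINT x|lborel. \<bar>f (x + h n) - f x\<bar>) + (LINT x|lborel. \<bar>g (x + h n) - g x\<bar>)"
    proof (rule always_eventually, rule allI)
      fix n
      have "(LINT x|lborel. \<bar>f (x + h n) + g (x + h n) - (f x + g x)\<bar>) \<le>
        (LINT x|lborel. \<bar>f (x + h n) - f x\<bar> + \<bar>g (x + h n) - g x\<bar>)"
        by (intro integral_mono integrable_abs Bochner_Integration.integrable_diff Bochner_Integration.integrable_add t add) auto
      also have "\<dots> = (LINT x|lborel. \<bar>f (x + h n) - f x\<bar>) + (LINT x|lborel. \<bar>g (x + h n) - g x\<bar>)"
        by (intro Bochner_Integration.integral_add integrable_abs Bochner_Integration.integrable_diff t add)
      finally show "(LINT x|lborel. \<bar>f (x + h n) + g (x + h n) - (f x + g x)\<bar>) \<le> \<dots>" .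
    qed
  qed simp
next
  case (lim f s)
  have [measurable]: "f \<in> borel_measurable borel" "\<And>i. s i \<in> borel_measurable borel"
    using lim by auto
  have "(\<lambda>i. LINT x|lborel. \<bar>s i x - f x\<bar>) \<longlonglongrightarrow> (LINT x|(lborel :: 'a measure). 0)"
  \<comment> \<open>\<open>integrable_induct\<close> bounds the approximations by twice |f|, hence
    the factor 3.\<close>
  proof (rule integral_dominated_convergence[where w="\<lambda>x. 3 * \<bar>f x\<bar>"])
    show "AE x in lborel. (\<lambda>i. \<bar>s i x - f x\<bar>) \<longlonglongrightarrow> 0"
      using lim(2) by (auto intro!: AE_I2 tendsto_rabs_zero LIM_zero)
    show "AE x in lborel. norm \<bar>s i x - f x\<bar> \<le> 3 * \<bar>f x\<bar>" for i
    proof (rule AE_I2)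
      fix x show "norm \<bar>s i x - f x\<bar> \<le> 3 * \<bar>f x\<bar>"
        using lim(3)[of x i] by simp
    qed
  qed (use lim in auto)
  then have sf: "(\<lambda>i. LINT x|lborel. \<bar>s i x - f x\<bar>) \<longlonglongrightarrow> 0" by simp
  show ?case
  proof (rule LIMSEQ_I, goal_cases)
    case (1 e)
    from order_tendstoD(2)[OF sf, of "e/3"] 1 obtain i where i: "(LINT x|lborel. \<bar>s i x - f x\<bar>) < e/3"
      unfolding eventually_sequentially by auto
    from order_tendstoD(2)[OF lim(5)[of i], of "e/3"] 1 obtain N where
      N: "\<And>n. n \<ge> N \<Longrightarrow> (LINT x|lborel. \<bar>s i (x + h n) - s i x\<bar>) < e/3"
      unfolding eventually_sequentially by auto
    have "norm ((LINT x|lborel. \<bar>f (x + h n) - f x\<bar>) - 0) < e" if "n \<ge> N" for n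
    proof -
      note t = integrable_translate_lborel[OF lim(4)] integrable_translate_lborel[OF lim(1)]
      have "(LINT x|lborel. \<bar>f (x + h n) - f x\<bar>) \<le> (LINT x|lborel. \<bar>s i (x + h n) - s i x\<bar> + (\<bar>s i (x + h n) - f (x + h n)\<bar> + \<bar>s i x - f x\<bar>))"
        by (intro integral_mono integrable_abs Bochner_Integration.integrable_diff Bochner_Integration.integrable_add t lim) auto
      also have "\<dots> = (LINT x|lborel. \<bar>s i (x + h n) - s i x\<bar>) +
         ((LINT x|lborel. \<bar>s i (x + h n) - f (x + h n)\<bar>) + (LINT x|lborel. \<bar>s i x - f x\<bar>))"
      proof -
        have "integrable lborel (\<lambda>x. \<bar>s i (x + h n) - s i x\<bar>)" "integrable lborel (\<lambda>x. \<bar>s i (x + h n) - f (x + h n)\<bar>)"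
          "integrable lborel (\<lambda>x. \<bar>s i x - f x\<bar>)"
          by (intro integrable_abs Bochner_Integration.integrable_diff t lim)+
        then show ?thesis by simp
      qed
      also have "(LINT x|lborel. \<bar>s i (x + h n) - f (x + h n)\<bar>) = (LINT x|lborel. \<bar>s i x - f x\<bar>)"
        by (rule integral_translate_lborel[of "\<lambda>x. \<bar>s i x - f x\<bar>"]) auto
      finally have "(LINT x|lborel. \<bar>f (x + h n) - f x\<bar>) < e"
        using i N[OF that] by linarith
      moreover have "0 \<le> (LINT x|lborel. \<bar>f (x + h n) - f x\<bar>)" by simp
      ultimately show ?thesis by simp
    qed
    then show ?case by blast
  qed
qed

text \<open>Bounding one factor by \<open>M\<close> leaves the L^1 modulus of continuity of f. The
  limit identifies the L^2 norm once the Gaussian weights in Plancherel's theorem are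
  removed.\<close>

lemma autocorrelation_tendsto:
  fixes f :: "'a::euclidean_space \<Rightarrow> real"
  assumes f: "integrable lborel f" and M: "\<And>x. \<bar>f x\<bar> \<le> M" and h: "h \<longlonglongrightarrow> 0"
  shows "(\<lambda>n. LINT x|lborel. f x * f (x + h n)) \<longlonglongrightarrow> (LINT x|lborel. (f x)\<^sup>2)"
proof -
  have [measurable]: "f \<in> borel_measurable borel" using f by auto
  note t = integrable_translate_lborel[OF f]
  have ii: "integrable lborel (\<lambda>x. f x * g x)" if "g \<in> borel_measurable borel" "\<And>x. \<bar>g x\<bar> \<le> M" for g
    using that by (intro integrable_mult_bounded[OF f]) auto
  have "(\<lambda>n. (LINT x|lborel. f x * f (x + h n)) - (LINT x|lborel. f x * f x)) \<longlonglongrightarrow> 0"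
  proof (rule Lim_null_comparison)
    show "(\<lambda>n. M * (LINT x|lborel. \<bar>f (x + h n) - f x\<bar>)) \<longlonglongrightarrow> 0"
      using tendsto_mult_right_zero[OF translation_continuous_L1[OF f h]] .
    show "\<forall>\<^sub>F n in sequentially. norm ((LINT x|lborel. f x * f (x + h n)) - (LINT x|lborel. f x * f x)) \<le> M * (LINT x|lborel. \<bar>f (x + h n) - f x\<bar>)"
    proof (rule always_eventually, rule allI)
      fix n
      have "(LINT x|lborel. f x * f (x + h n)) - (LINT x|lborel. f x * f x) = (LINT x|lborel. f x * (f (x + h n) - f x))"
        using ii M by (simp add: right_diff_distrib)
      also have "norm \<dots> \<le> (LINT x|lborel. norm (f x * (f (x + h n) - f x)))"
        by (rule integral_norm_bound)
      also have "\<dots> \<le> (LINT x|lborel. M * \<bar>f (x + h n) - f x\<bar>)"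
      proof (rule integral_mono)
        show "integrable lborel (\<lambda>x. norm (f x * (f (x + h n) - f x)))"
          using ii M by (simp add: right_diff_distrib)
      qed (use t f M in \<open>auto simp: abs_mult intro!: mult_right_mono\<close>)
      finally show "norm ((LINT x|lborel. f x * f (x + h n)) - (LINT x|lborel. f x * f x)) \<le> M * (LINT x|lborel. \<bar>f (x + h n) - f x\<bar>)"
        by simp
    qed
  qed
  then show ?thesis by (simp add: LIM_zero_iff power2_eq_square)
qed

section \<open>The Fourier transform and Gaussian integrals\<close>

lemma borel_measurable_cis [measurable (raw)]:
  "f \<in> borel_measurable M \<Longrightarrow> (\<lambda>x. cis (f x)) \<in> borel_measurable M"
  unfolding cis_conv_exp by measurable

text \<open>Convention without normalising factor; this is the origin of (2 pi)^d in Plancherel's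
  theorem.\<close>

definition fourier :: "('a::euclidean_space \<Rightarrow> real) \<Rightarrow> 'a \<Rightarrow> complex" where
  "fourier f \<xi> = (LINT x|lborel. complex_of_real (f x) * cis (- (\<xi> \<bullet> x)))"

text \<open>Product form, so that the transform factors into one-dimensional characteristic
  functions of the normal law.\<close>

definition gauss_density :: "'a::euclidean_space \<Rightarrow> real" where
  "gauss_density v = (\<Prod>b\<in>Basis. std_normal_density (v \<bullet> b))"

lemma gauss_density_eq:
  "gauss_density (v::'a::euclidean_space) = exp (- (norm v)\<^sup>2 / 2) / sqrt (2 * pi) ^ DIM('a)"
proof -
  have "exp (- (norm v)\<^sup>2 / 2) = (\<Prod>b\<in>Basis. exp (- (v \<bullet> b)\<^sup>2 / 2))"
    by (simp add: exp_sum[symmetric] sum_negf sum_divide_distrib flip: norm_sum_Basis_square)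
  then show ?thesis
    by (simp add: gauss_density_def std_normal_density_def prod_dividef)
qed

lemma gauss_density_measurable [measurable]: "gauss_density \<in> borel_measurable borel"
  unfolding gauss_density_eq[abs_def] by measurable

lemma gauss_density_nonneg: "0 \<le> gauss_density v"
  by (simp add: gauss_density_def prod_nonneg)

text \<open>Lebesgue measure on the space is the image of the product of one-dimensional Lebesgue
  measures under the map from coordinates to vectors.\<close>

lemma
  fixes g :: "'a::euclidean_space \<Rightarrow> real \<Rightarrow> complex"
  assumes g: "\<And>b. b \<in> Basis \<Longrightarrow> integrable lborel (g b)"
  shows integrable_prod_Basis: "integrable lborel (\<lambda>x. \<Prod>b\<in>Basis. g b (x \<bullet> b))" (is ?A)
    and integral_prod_Basis: "(LINT x|lborel. (\<Prod>b\<in>Basis. g b (x \<bullet> b))) = (\<Prod>b\<in>Basis. LINT x|lborel. g b x)" (is ?B)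
proof -
  interpret product_sigma_finite "\<lambda>_::'a. lborel :: real measure"
    by standard
  let ?P = "\<Pi>\<^sub>M b\<in>(Basis :: 'a set). (lborel :: real measure)"
  let ?T = "\<lambda>f. \<Sum>b\<in>(Basis :: 'a set). f b *\<^sub>R b"
  have [measurable]: "g b \<in> borel_measurable borel" if "b \<in> Basis" for b
    using g[OF that] by auto
  have m: "(\<lambda>x. \<Prod>b\<in>Basis. g b (x \<bullet> b)) \<in> borel_measurable borel"
    by (intro borel_measurable_prod) auto
  have e: "(\<Prod>b\<in>Basis. g b (?T f \<bullet> b)) = (\<Prod>b\<in>Basis. g b (f b))" for f
    by (intro prod.cong refl) (simp add: inner_sum_left inner_Basis if_distrib cong: if_cong)
  have T: "?T \<in> ?P \<rightarrow>\<^sub>M borel" by measurable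
  have i: "integrable ?P (\<lambda>f. \<Prod>b\<in>Basis. g b (f b))"
    by (rule product_integrable_prod) (use g in auto)
  have "integrable (distr ?P borel ?T) (\<lambda>x. \<Prod>b\<in>Basis. g b (x \<bullet> b))"
    by (subst integrable_distr_eq[OF T m]) (simp only: e i)
  then show ?A by (subst lborel_eq)
  have "(LINT x|distr ?P borel ?T. (\<Prod>b\<in>Basis. g b (x \<bullet> b))) = (\<Prod>b\<in>Basis. LINT x|lborel. g b x)"
    by (subst integral_distr[OF T m]) (simp only: e product_integral_prod[OF finite_Basis g])
  then show ?B by (subst lborel_eq)
qed

lemma
  fixes u :: "'a::euclidean_space"
  shows gauss_density_cis_integrable: "integrable lborel (\<lambda>v::'a. complex_of_real (gauss_density v) * cis (u \<bullet> v))" (is ?A)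
    and gauss_density_fourier: "(LINT v|lborel. complex_of_real (gauss_density v) * cis (u \<bullet> v)) =
      complex_of_real (exp (- (norm u)\<^sup>2 / 2))" (is ?B)
proof -
  define g :: "'a \<Rightarrow> real \<Rightarrow> complex" where "g b x = complex_of_real (std_normal_density x) * cis ((u \<bullet> b) * x)" for b x
  have [measurable]: "g b \<in> borel_measurable borel" for b
    unfolding g_def by measurable
  have gi: "integrable lborel (g b)" for b
    by (rule Bochner_Integration.integrable_bound[OF integrable_normal_density[where \<mu>=0 and \<sigma>=1]])
      (auto simp: g_def norm_mult)
  have gv: "(LINT x|lborel. g b x) = complex_of_real (exp (- (u \<bullet> b)\<^sup>2 / 2))" for b
  proof -
    have "char std_normal_distribution (u \<bullet> b) = (LINT x|lborel. g b x)"
      unfolding char_def g_def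
      by (subst integral_density) (auto simp: scaleR_conv_of_real cis_conv_exp mult.commute)
    then show ?thesis by (simp add: char_std_normal_distribution)
  qed
  have cis_prod: "cis (\<Sum>b\<in>A. h b) = (\<Prod>b\<in>A. cis (h b))" if "finite A" for A and h :: "'a \<Rightarrow> real"
    using that by (induction A) (auto simp flip: cis_mult)
  have eq: "complex_of_real (gauss_density v) * cis (u \<bullet> v) = (\<Prod>b\<in>Basis. g b (v \<bullet> b))" for v :: 'a
    unfolding gauss_density_def g_def prod.distrib
    by (subst euclidean_inner[of u v]) (simp add: cis_prod)
  show ?A unfolding eq by (rule integrable_prod_Basis[OF gi])
  have "exp (- (norm u)\<^sup>2 / 2) = (\<Prod>b\<in>Basis. exp (- (u \<bullet> b)\<^sup>2 / 2))"
    by (simp add: exp_sum[symmetric] sum_negf sum_divide_distrib flip: norm_sum_Basis_square)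
  then show ?B unfolding eq integral_prod_Basis[OF gi] gv by simp
qed

lemma
  shows gauss_density_integrable: "integrable lborel (gauss_density :: 'a::euclidean_space \<Rightarrow> real)"
    and gauss_density_integral: "(LINT v|(lborel :: 'a measure). gauss_density v) = 1"
proof -
  have "integrable lborel (\<lambda>v::'a. Re (complex_of_real (gauss_density v) * cis (0 \<bullet> v)))"
    by (intro integrable_Re gauss_density_cis_integrable)
  then show "integrable lborel (gauss_density :: 'a \<Rightarrow> real)" by simp
  have "complex_of_real (LINT v|(lborel :: 'a measure). gauss_density v) = 1"
    using gauss_density_fourier[of "0::'a"] by simp
  then show "(LINT v|(lborel :: 'a measure). gauss_density v) = 1" by simp
qed

lemma
  fixes f :: "'a::euclidean_space \<Rightarrow> 'b::{banach, second_countable_topology}" and c :: real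
  assumes [measurable]: "f \<in> borel_measurable borel" and c: "c \<noteq> 0"
  shows integral_affine_lborel: "(LINT x|lborel. f x) = \<bar>c\<bar> ^ DIM('a) *\<^sub>R (LINT x|lborel. f (t + c *\<^sub>R x))" (is ?A)
    and integrable_affine_lborel: "integrable lborel (\<lambda>x. f (t + c *\<^sub>R x)) \<longleftrightarrow> integrable lborel f" (is ?B)
proof -
  note eq = lborel_affine[OF c, of t]
  show ?A
    by (subst eq) (simp add: integral_density integral_distr)
  show ?B
  proof -
    have "integrable lborel f \<longleftrightarrow> integrable lborel (\<lambda>x. \<bar>c\<bar> ^ DIM('a) *\<^sub>R f (t + c *\<^sub>R x))"
      using arg_cong[OF eq, of "\<lambda>M. integrable M f"] by (simp add: integrable_density integrable_distr_eq)
    moreover have "integrable lborel (\<lambda>x. f (t + c *\<^sub>R x))"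
      if "integrable lborel (\<lambda>x. \<bar>c\<bar> ^ DIM('a) *\<^sub>R f (t + c *\<^sub>R x))"
      using integrable_scaleR_right[OF that, of "inverse (\<bar>c\<bar> ^ DIM('a))"] c by simp
    ultimately show ?thesis by auto
  qed
qed

lemma
  fixes f :: "'a::euclidean_space \<Rightarrow> 'c::{banach, second_countable_topology, real_normed_field}"
    and g :: "'b::euclidean_space \<Rightarrow> 'c"
  assumes f: "integrable lborel f" and g: "integrable lborel g"
  shows integrable_lborel_pair_mult: "integrable lborel (\<lambda>p. f (fst p) * g (snd p))" (is ?A)
    and integral_lborel_pair_mult: "(LINT p|lborel. f (fst p) * g (snd p)) = (LINT x|lborel. f x) * (LINT y|lborel. g y)" (is ?B)
proof -
  have [measurable]: "f \<in> borel_measurable borel" "g \<in> borel_measurable borel"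
    using f g by auto
  have i: "integrable (lborel \<Otimes>\<^sub>M lborel) (\<lambda>p. f (fst p) * g (snd p))"
  proof (rule lborel_pair.Fubini_integrable)
    show "integrable lborel (\<lambda>x. LINT y|lborel. norm (f (fst (x, y)) * g (snd (x, y))))"
      using f by (simp add: norm_mult)
  qed (use g in auto)
  then show ?A by (simp add: lborel_prod)
  have "(LINT p|(lborel \<Otimes>\<^sub>M lborel). f (fst p) * g (snd p)) = (LINT x|lborel. LINT y|lborel. f x * g y)"
    using lborel_pair.integral_fst'[OF i] by simp
  also have "\<dots> = (LINT x|lborel. f x) * (LINT y|lborel. g y)" by simp
  finally show ?B by (simp add: lborel_prod)
qed

lemma fourier_integrable:
  "integrable lborel f \<Longrightarrow> integrable lborel (\<lambda>x. complex_of_real (f x) * cis (c * (\<xi> \<bullet> x)))"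
  for f :: "'a::euclidean_space \<Rightarrow> real"
  by (rule Bochner_Integration.integrable_bound[of _ f]) (auto simp: norm_mult)

text \<open>The weight is a dilated Gaussian, \<open>?s * gauss_density (e *\<^sub>R \<xi>)\<close>,
  so scaling the frequency by \<open>e\<close> reduces the claim to
  \<open>gauss_density_fourier\<close> at \<open>u /\<^sub>R e\<close>.\<close>

lemma
  fixes u :: "'a::euclidean_space"
  assumes e: "e > 0"
  shows gauss_weight_integrable: "integrable lborel (\<lambda>\<xi>::'a. exp (- (e * norm \<xi>)\<^sup>2 / 2))" (is ?A)
    and gauss_weight_integral: "(LINT \<xi>|lborel. complex_of_real (exp (- (e * norm \<xi>)\<^sup>2 / 2)) * cis (\<xi> \<bullet> u)) =
      complex_of_real ((2 * pi) ^ DIM('a) * (gauss_density (u /\<^sub>R e) / e ^ DIM('a)))" (is ?B)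
proof -
  let ?s = "sqrt (2 * pi) ^ DIM('a)"
  have s: "?s > 0" by simp
  have ss: "?s * ?s = (2 * pi) ^ DIM('a)" by (subst power_mult_distrib[symmetric]) simp
  have W: "exp (- (e * norm \<xi>)\<^sup>2 / 2) = ?s * gauss_density (e *\<^sub>R \<xi>)" for \<xi> :: 'a
  proof -
    have "norm (e *\<^sub>R \<xi>) = e * norm \<xi>" using e by simp
    with s show ?thesis unfolding gauss_density_eq by (simp only: times_divide_eq_right) simp
  qed
  have "integrable lborel (\<lambda>\<xi>::'a. gauss_density (0 + e *\<^sub>R \<xi>))"
    using e by (subst integrable_affine_lborel) (auto simp: gauss_density_integrable)
  then show ?A unfolding W by simp
  define h where "h \<eta> = complex_of_real (gauss_density \<eta>) * cis ((u /\<^sub>R e) \<bullet> \<eta>)" for \<eta> :: 'a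
  have [measurable]: "h \<in> borel_measurable borel"
    using gauss_density_cis_integrable[of "u /\<^sub>R e"] unfolding h_def by auto
  have "(LINT \<eta>|lborel. h \<eta>) = e ^ DIM('a) *\<^sub>R (LINT \<xi>|lborel. h (0 + e *\<^sub>R \<xi>))"
    using e by (subst integral_affine_lborel[where c=e and t=0]) auto
  moreover have "(LINT \<eta>|lborel. h \<eta>) = complex_of_real (?s * gauss_density (u /\<^sub>R e))"
    unfolding h_def gauss_density_fourier using s by (simp add: gauss_density_eq)
  moreover have "(LINT \<xi>|lborel. complex_of_real (exp (- (e * norm \<xi>)\<^sup>2 / 2)) * cis (\<xi> \<bullet> u)) = ?s * (LINT \<xi>|lborel. h (0 + e *\<^sub>R \<xi>))"
  proof -
    have "h (0 + e *\<^sub>R \<xi>) = complex_of_real (gauss_density (e *\<^sub>R \<xi>)) * cis (\<xi> \<bullet> u)" for \<xi>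
      using e by (simp add: h_def inner_commute field_simps)
    then show ?thesis unfolding W by (simp add: mult.assoc del: of_real_power)
  qed
  moreover from calculation have "(LINT \<xi>|lborel. h (0 + e *\<^sub>R \<xi>)) = complex_of_real (?s * gauss_density (u /\<^sub>R e) / e ^ DIM('a))"
    using e by (simp add: scaleR_conv_of_real field_simps)
  ultimately show ?B
    by (simp only: ss[symmetric] flip: of_real_mult) (simp add: mult.assoc)
qed

section \<open>Plancherel's theorem by Gaussian regularisation\<close>

lemma fourier_borel_measurable [measurable]:
  fixes f :: "'a::euclidean_space \<Rightarrow> real"
  assumes [measurable]: "f \<in> borel_measurable borel"
  shows "fourier f \<in> borel_measurable borel"
  unfolding fourier_def[abs_def] by measurable

lemma norm_fourier_le: "cmod (fourier f \<xi>) \<le> (LINT x|lborel. \<bar>f x\<bar>)"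
proof -
  have "cmod (fourier f \<xi>) \<le> (LINT x|lborel. cmod (complex_of_real (f x) * cis (- (\<xi> \<bullet> x))))"
    unfolding fourier_def by (rule integral_norm_bound)
  then show ?thesis by (simp add: norm_mult)
qed

text \<open>The squared modulus is a double integral in x and y. The Gaussian weight makes the
  triple integral absolutely convergent, so the frequency integral may be done first; it yields a
  Gaussian of width \<open>e\<close> in y - x, and the substitution y = x + e v turns the result
  into an average of autocorrelations.\<close>

lemma fourier_gauss_weight_integral:
  fixes f :: "'a::euclidean_space \<Rightarrow> real"
  assumes f: "integrable lborel f" and M: "\<And>x. \<bar>f x\<bar> \<le> M" and e: "e > 0"
  shows "(LINT \<xi>|lborel. exp (- (e * norm \<xi>)\<^sup>2 / 2) * (cmod (fourier f \<xi>))\<^sup>2) =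
    (2 * pi) ^ DIM('a) * (LINT v|lborel. gauss_density v * (LINT x|lborel. f x * f (x + e *\<^sub>R v)))"
proof -
  have [measurable]: "f \<in> borel_measurable borel" using f by auto
  define W where "W \<xi> = exp (- (e * norm \<xi>)\<^sup>2 / 2)" for \<xi> :: 'a
  have [measurable]: "W \<in> borel_measurable borel" unfolding W_def by measurable
  have W: "integrable lborel W" unfolding W_def by (rule gauss_weight_integrable[OF e])
  define c where "c = (2 * pi) ^ DIM('a)"
  define K where "K \<xi> p = complex_of_real (W \<xi>) * (complex_of_real (f (fst p) * f (snd p)) * cis (\<xi> \<bullet> (snd p - fst p)))"
    for \<xi> :: 'a and p :: "'a \<times> 'a"
  have ff: "integrable lborel (\<lambda>p::'a\<times>'a. f (fst p) * f (snd p))"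
    by (rule integrable_lborel_pair_mult[OF f f])
  have "integrable lborel (\<lambda>q::'a\<times>'a\<times>'a. W (fst q) * (f (fst (snd q)) * f (snd (snd q))))"
    using integrable_lborel_pair_mult[OF W ff] .
  then have "integrable lborel (case_prod K)"
  proof (rule Bochner_Integration.integrable_bound)
    show "case_prod K \<in> borel_measurable lborel"
      unfolding K_def case_prod_beta lborel_prod[symmetric] by measurable
  qed (auto simp: K_def norm_mult)
  then have K: "integrable (lborel \<Otimes>\<^sub>M lborel) (case_prod K)" by (simp add: lborel_prod)
  have inner1: "(LINT p|lborel. K \<xi> p) = W \<xi> * (fourier f \<xi> * cnj (fourier f \<xi>))" for \<xi>
  proof -
    have "K \<xi> p = W \<xi> * ((complex_of_real (f (fst p)) * cis (-1 * (\<xi> \<bullet> fst p))) *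
        (complex_of_real (f (snd p)) * cis (1 * (\<xi> \<bullet> snd p))))" for p
    proof -
      have "cis (\<xi> \<bullet> (snd p - fst p)) = cis (-1 * (\<xi> \<bullet> fst p)) * cis (1 * (\<xi> \<bullet> snd p))"
        by (simp add: cis_mult inner_diff_right)
      then show ?thesis unfolding K_def by (simp only: of_real_mult mult_ac)
    qed
    then have "(LINT p|lborel. K \<xi> p) = W \<xi> * (LINT p|lborel. (complex_of_real (f (fst p)) * cis (-1 * (\<xi> \<bullet> fst p))) *
        (complex_of_real (f (snd p)) * cis (1 * (\<xi> \<bullet> snd p))))"
      by (simp only: integral_mult_right_zero)
    also have "\<dots> = W \<xi> * ((LINT x|lborel. complex_of_real (f x) * cis (-1 * (\<xi> \<bullet> x))) * (LINT x|lborel. complex_of_real (f x) * cis (1 * (\<xi> \<bullet> x))))"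
      by (subst integral_lborel_pair_mult[OF fourier_integrable[OF f] fourier_integrable[OF f]]) simp
    also have "(LINT x|lborel. complex_of_real (f x) * cis (1 * (\<xi> \<bullet> x))) = cnj (fourier f \<xi>)"
      unfolding fourier_def Bochner_Integration.integral_cnj[symmetric] by (simp add: cis_cnj)
    finally show ?thesis by (simp add: fourier_def)
  qed
  have inner2: "(LINT \<xi>|lborel. K \<xi> p) = complex_of_real (c * (f (fst p) * f (snd p) * (gauss_density ((snd p - fst p) /\<^sub>R e) / e ^ DIM('a))))" for p
  proof -
    have "(LINT \<xi>|lborel. K \<xi> p) = (f (fst p) * f (snd p)) * (LINT \<xi>|lborel. complex_of_real (exp (- (e * norm \<xi>)\<^sup>2 / 2)) * cis (\<xi> \<bullet> (snd p - fst p)))"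
      unfolding K_def W_def integral_mult_right_zero[symmetric] by (simp only: of_real_mult mult_ac)
    then show ?thesis unfolding gauss_weight_integral[OF e] c_def by simp
  qed
  define H where "H p = f (fst p) * f (snd p) * (gauss_density ((snd p - fst p) /\<^sub>R e) / e ^ DIM('a))" for p
  have H: "integrable (lborel \<Otimes>\<^sub>M lborel) H"
  proof -
    have g1: "gauss_density (v::'a) \<le> 1 / sqrt (2 * pi) ^ DIM('a)" for v
      unfolding gauss_density_eq by (intro divide_right_mono) auto
    have "integrable lborel H"
    proof (rule Bochner_Integration.integrable_bound[OF integrable_mult_left[OF ff, of "1 / sqrt (2 * pi) ^ DIM('a) / e ^ DIM('a)"]])
      show "AE p in lborel. norm (H p) \<le> norm (f (fst p) * f (snd p) * (1 / sqrt (2 * pi) ^ DIM('a) / e ^ DIM('a)))"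
      proof (rule AE_I2)
        fix p
        have "norm (H p) = \<bar>f (fst p) * f (snd p)\<bar> * (gauss_density ((snd p - fst p) /\<^sub>R e) / e ^ DIM('a))"
          using e by (simp add: H_def abs_mult gauss_density_nonneg)
        also have "\<dots> \<le> \<bar>f (fst p) * f (snd p)\<bar> * (1 / sqrt (2 * pi) ^ DIM('a) / e ^ DIM('a))"
          using e by (intro mult_left_mono divide_right_mono g1) auto
        finally show "norm (H p) \<le> norm (f (fst p) * f (snd p) * (1 / sqrt (2 * pi) ^ DIM('a) / e ^ DIM('a)))"
          using e by (simp add: abs_mult)
      qed
      show "H \<in> borel_measurable lborel"
        unfolding H_def[abs_def] lborel_prod[symmetric] by measurable
    qed
    then show ?thesis by (simp add: lborel_prod)
  qed
  have "complex_of_real (LINT \<xi>|lborel. W \<xi> * (cmod (fourier f \<xi>))\<^sup>2) = (LINT \<xi>|lborel. LINT p|lborel. K \<xi> p)"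
    unfolding inner1 complex_norm_square[symmetric] by (simp flip: of_real_mult of_real_power)
  also have "\<dots> = (LINT p|lborel. LINT \<xi>|lborel. K \<xi> p)"
    by (rule lborel_pair.Fubini_integral[OF K, symmetric])
  also have "\<dots> = complex_of_real (c * (LINT p|lborel. H p))"
    unfolding inner2 H_def[symmetric] integral_complex_of_real by simp
  finally have *: "(LINT \<xi>|lborel. W \<xi> * (cmod (fourier f \<xi>))\<^sup>2) = c * (LINT p|lborel. H p)"
    by (simp only: of_real_eq_iff)
  have "(LINT p|lborel. H p) = (LINT x|lborel. LINT y|lborel. H (x, y))"
    using lborel_pair.integral_fst'[OF H] by (simp add: lborel_prod)
  also have "\<dots> = (LINT x|lborel. LINT v|lborel. f x * f (x + e *\<^sub>R v) * gauss_density v)"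
  proof (rule Bochner_Integration.integral_cong[OF refl])
    fix x
    have "(LINT y|lborel. H (x, y)) = \<bar>e\<bar> ^ DIM('a) *\<^sub>R (LINT v|lborel. H (x, x + e *\<^sub>R v))"
      by (rule integral_affine_lborel) (use e in \<open>auto simp: H_def\<close>)
    also have "\<dots> = (LINT v|lborel. f x * f (x + e *\<^sub>R v) * gauss_density v)"
      using e by (simp add: H_def)
    finally show "(LINT y|lborel. H (x, y)) = (LINT v|lborel. f x * f (x + e *\<^sub>R v) * gauss_density v)" .
  qed
  also have "\<dots> = (LINT v|lborel. LINT x|lborel. f x * f (x + e *\<^sub>R v) * gauss_density v)"
  proof (rule lborel_pair.Fubini_integral[symmetric])
    have "integrable lborel (\<lambda>p::'a\<times>'a. f (fst p) * gauss_density (snd p) * M)"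
      by (intro integrable_mult_left integrable_lborel_pair_mult f gauss_density_integrable)
    then have "integrable lborel (\<lambda>(x, v). f x * f (x + e *\<^sub>R v) * gauss_density v)"
    proof (rule Bochner_Integration.integrable_bound)
      show "AE p in lborel. norm (case p of (x, v) \<Rightarrow> f x * f (x + e *\<^sub>R v) * gauss_density v) \<le> norm (f (fst p) * gauss_density (snd p) * M)"
      proof (rule AE_I2, clarsimp simp: abs_mult gauss_density_nonneg)
        fix x v
        have "\<bar>f (x + e *\<^sub>R v)\<bar> \<le> \<bar>M\<bar>" using M order_trans abs_ge_self by blast
        then show "\<bar>f x\<bar> * \<bar>f (x + e *\<^sub>R v)\<bar> * gauss_density v \<le> \<bar>f x\<bar> * gauss_density v * \<bar>M\<bar>"
          using mult_left_mono[of "\<bar>f (x + e *\<^sub>R v)\<bar>" "\<bar>M\<bar>" "\<bar>f x\<bar> * gauss_density v"]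
          by (simp add: gauss_density_nonneg mult_ac)
      qed
      show "(\<lambda>(x, v). f x * f (x + e *\<^sub>R v) * gauss_density v) \<in> borel_measurable lborel"
        unfolding lborel_prod[symmetric] by measurable
    qed
    then show "integrable (lborel \<Otimes>\<^sub>M lborel) (\<lambda>(x, v). f x * f (x + e *\<^sub>R v) * gauss_density v)"
      by (simp add: lborel_prod)
  qed
  also have "\<dots> = (LINT v|lborel. gauss_density v * (LINT x|lborel. f x * f (x + e *\<^sub>R v)))"
    by (simp add: mult.commute)
  finally show ?thesis using * unfolding c_def W_def by simp
qed

text \<open>Letting the regularisation \<open>e n\<close> tend to 0 is monotone on the frequency
  side and dominated on the space side. Monotone convergence delivers integrability of the squared
  transform together with its integral.\<close>

theorem
  fixes f :: "'a::euclidean_space \<Rightarrow> real"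
  assumes f: "integrable lborel f" and M: "\<And>x. \<bar>f x\<bar> \<le> M"
  shows fourier_square_integrable: "integrable lborel (\<lambda>\<xi>. (cmod (fourier f \<xi>))\<^sup>2)" (is ?A)
    and plancherel: "(LINT \<xi>|lborel. (cmod (fourier f \<xi>))\<^sup>2) = (2 * pi) ^ DIM('a) * (LINT x|lborel. (f x)\<^sup>2)" (is ?B)
proof -
  have [measurable]: "f \<in> borel_measurable borel" using f by auto
  define e where "e n = inverse (real (Suc n))" for n
  have e: "e n > 0" "e (Suc n) \<le> e n" for n by (auto simp: e_def field_simps)
  have e0: "e \<longlonglongrightarrow> 0" unfolding e_def by (rule LIMSEQ_inverse_real_of_nat)
  let ?F = "\<lambda>n \<xi>. exp (- (e n * norm \<xi>)\<^sup>2 / 2) * (cmod (fourier f \<xi>))\<^sup>2"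
  have "has_bochner_integral lborel (\<lambda>\<xi>. (cmod (fourier f \<xi>))\<^sup>2) ((2 * pi) ^ DIM('a) * (LINT x|lborel. (f x)\<^sup>2))"
  proof (rule has_bochner_integral_monotone_convergence)
    show "integrable lborel (?F n)" for n
    proof (rule Bochner_Integration.integrable_bound[OF integrable_mult_left[OF gauss_weight_integrable[OF e(1)]]])
      show "AE \<xi> in lborel. norm (?F n \<xi>) \<le> norm (exp (- (e n * norm \<xi>)\<^sup>2 / 2) * (LINT x|lborel. \<bar>f x\<bar>)\<^sup>2)"
        by (auto simp: abs_mult intro!: AE_I2 mult_left_mono power_mono norm_fourier_le)
    qed measurable
    show "AE \<xi> in lborel. mono (\<lambda>n. ?F n \<xi>)"
      using e by (intro AE_I2 incseq_SucI) (auto intro!: mult_right_mono power_mono simp: less_imp_le)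
    show "AE \<xi> in lborel. (\<lambda>n. ?F n \<xi>) \<longlonglongrightarrow> (cmod (fourier f \<xi>))\<^sup>2"
      by (rule AE_I2) (rule tendsto_eq_intros e0 refl | simp)+
    have "(\<lambda>n. LINT v|lborel. gauss_density v * (LINT x|lborel. f x * f (x + e n *\<^sub>R v)))
      \<longlonglongrightarrow> (LINT v|(lborel::'a measure). gauss_density v * (LINT x|lborel. (f x)\<^sup>2))"
    proof (rule integral_dominated_convergence[where w="\<lambda>v. gauss_density v * (M * (LINT x|lborel. \<bar>f x\<bar>))"])
      show "AE v in lborel. (\<lambda>n. gauss_density v * (LINT x|lborel. f x * f (x + e n *\<^sub>R v))) \<longlonglongrightarrow> gauss_density v * (LINT x|lborel. (f x)\<^sup>2)"
      proof (intro AE_I2 tendsto_mult_left autocorrelation_tendsto[OF f M])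
        show "(\<lambda>n. e n *\<^sub>R v) \<longlonglongrightarrow> 0" for v :: 'a
          by (rule tendsto_eq_intros e0 refl | simp)+
      qed
      show "AE v in lborel. norm (gauss_density v * (LINT x|lborel. f x * f (x + e n *\<^sub>R v))) \<le> gauss_density v * (M * (LINT x|lborel. \<bar>f x\<bar>))" for n
      proof (rule AE_I2)
        fix v :: 'a
        have "norm (LINT x|lborel. f x * f (x + e n *\<^sub>R v)) \<le> (LINT x|lborel. norm (f x * f (x + e n *\<^sub>R v)))"
          by (rule integral_norm_bound)
        also have "\<dots> \<le> (LINT x|lborel. M * \<bar>f x\<bar>)"
        proof (rule integral_mono_AE')
          show "AE x in lborel. norm (f x * f (x + e n *\<^sub>R v)) \<le> M * \<bar>f x\<bar>"
            using M by (auto simp: abs_mult mult.commute[of M] intro!: mult_left_mono)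
        qed (use f order_trans[OF abs_ge_zero M] in auto)
        finally show "norm (gauss_density v * (LINT x|lborel. f x * f (x + e n *\<^sub>R v))) \<le> gauss_density v * (M * (LINT x|lborel. \<bar>f x\<bar>))"
          by (simp add: abs_mult gauss_density_nonneg mult_left_mono)
      qed
    qed (use gauss_density_integrable in auto)
    then have "(\<lambda>n. LINT v|lborel. gauss_density v * (LINT x|lborel. f x * f (x + e n *\<^sub>R v)))
      \<longlonglongrightarrow> (LINT x|lborel. (f x)\<^sup>2)"
      by (simp add: gauss_density_integral)
    then show "(\<lambda>n. LINT \<xi>|lborel. ?F n \<xi>) \<longlonglongrightarrow> (2 * pi) ^ DIM('a) * (LINT x|lborel. (f x)\<^sup>2)"
      unfolding fourier_gauss_weight_integral[OF f M e(1)] by (intro tendsto_mult_left)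
  qed measurable
  then show ?A ?B by (auto simp: has_bochner_integral_iff)
qed

lemma fourier_add:
  "integrable lborel f \<Longrightarrow> integrable lborel g \<Longrightarrow>
    fourier (\<lambda>x. f x + g x) \<xi> = fourier f \<xi> + fourier g \<xi>"
  using fourier_integrable[of f "-1" \<xi>] fourier_integrable[of g "-1" \<xi>]
  unfolding fourier_def by (simp add: distrib_right)

text \<open>Polarisation: Plancherel's theorem for f, g and f + g, the last being integrable and
  bounded by \<open>M + N\<close>.\<close>

lemma
  fixes f g :: "'a::euclidean_space \<Rightarrow> real"
  assumes f: "integrable lborel f" "\<And>x. \<bar>f x\<bar> \<le> M" and g: "integrable lborel g" "\<And>x. \<bar>g x\<bar> \<le> N"
  shows parseval_integrable: "integrable lborel (\<lambda>\<xi>. Re (fourier f \<xi> * cnj (fourier g \<xi>)))" (is ?A)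
    and parseval: "(LINT \<xi>|lborel. Re (fourier f \<xi> * cnj (fourier g \<xi>))) =
      (2 * pi) ^ DIM('a) * (LINT x|lborel. f x * g x)" (is ?B)
proof -
  have fg: "integrable lborel (\<lambda>x. f x + g x)" "\<bar>f x + g x\<bar> \<le> M + N" for x
    using f g order_trans[OF abs_triangle_ineq add_mono[OF f(2) g(2)]] by auto
  have polar: "Re (w * cnj z) = ((cmod (w + z))\<^sup>2 - (cmod w)\<^sup>2 - (cmod z)\<^sup>2) / 2" for w z
    unfolding cmod_power2 by (simp add: power2_eq_square algebra_simps)
  note i = fourier_square_integrable[OF f] fourier_square_integrable[OF g]
    fourier_square_integrable[OF fg, unfolded fourier_add[OF f(1) g(1)]]
  show ?A unfolding polar using i by simp
  have sq: "integrable lborel (\<lambda>x. f x * f x)" "integrable lborel (\<lambda>x. f x * g x)" "integrable lborel (\<lambda>x. g x * g x)"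
    using f g by (auto intro: integrable_mult_bounded)
  have "(LINT x|lborel. (f x + g x)\<^sup>2) = (LINT x|lborel. f x * f x + (2 * (f x * g x) + g x * g x))"
    by (simp add: power2_eq_square algebra_simps)
  also have "\<dots> = (LINT x|lborel. f x * f x) + (2 * (LINT x|lborel. f x * g x) + (LINT x|lborel. g x * g x))"
    using sq by simp
  finally have eq: "(LINT x|lborel. (f x + g x)\<^sup>2) = \<dots>" .
  show ?B
    using i plancherel[OF f] plancherel[OF g] plancherel[OF fg, unfolded fourier_add[OF f(1) g(1)]]
    unfolding polar by (simp add: eq power2_eq_square[of "f _"] power2_eq_square[of "g _"] algebra_simps)
qed

section \<open>Smooth functions\<close>

lemma Ck_on_Suc_imp:
  fixes f :: "'a::euclidean_space \<Rightarrow> 'b::euclidean_space"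
  shows "Ck_on (Suc k) f S \<Longrightarrow> Ck_on k f S"
proof (induction k arbitrary: f)
  case 0
  then show ?case
    by (auto simp: continuous_on_eq_continuous_within intro: has_derivative_continuous)
next
  case (Suc k)
  from Suc.prems obtain f' where "\<forall>x\<in>S. (f has_derivative f' x) (at x within S)"
    "\<forall>v. Ck_on (Suc k) (\<lambda>x. f' x v) S"
    unfolding Ck_on.simps(2)[of "Suc k"] by blast
  with Suc.IH show ?case
    unfolding Ck_on.simps(2)[of k] by blast
qed

lemma Ck_on_const: "Ck_on k (\<lambda>x::'a::euclidean_space. c::'b::euclidean_space) S"
proof (induction k arbitrary: c)
  case (Suc k)
  show ?case unfolding Ck_on.simps
    by (intro exI[of _ "\<lambda>x v. 0"]) (auto intro: Suc.IH)
qed auto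

lemma Ck_on_linear:
  assumes "bounded_linear L"
  shows "Ck_on k (L :: 'a::euclidean_space \<Rightarrow> 'b::euclidean_space) S"
proof (cases k)
  case 0
  then show ?thesis using assms by (auto intro: linear_continuous_on)
next
  case (Suc k)
  show ?thesis unfolding Suc Ck_on.simps
    by (intro exI[of _ "\<lambda>x. L"])
      (auto intro: Ck_on_const bounded_linear_imp_has_derivative[OF assms])
qed

lemma Ck_on_add:
  fixes f g :: "'a::euclidean_space \<Rightarrow> 'b::euclidean_space"
  shows "Ck_on k f S \<Longrightarrow> Ck_on k g S \<Longrightarrow> Ck_on k (\<lambda>x. f x + g x) S"
proof (induction k arbitrary: f g)
  case 0
  then show ?case by (auto intro: continuous_on_add)
next
  case (Suc k)
  from Suc.prems obtain f' g' where f: "\<forall>x\<in>S. (f has_derivative f' x) (at x within S)"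
    "\<forall>v. Ck_on k (\<lambda>x. f' x v) S" and g: "\<forall>x\<in>S. (g has_derivative g' x) (at x within S)"
    "\<forall>v. Ck_on k (\<lambda>x. g' x v) S"
    unfolding Ck_on.simps by blast
  show ?case unfolding Ck_on.simps
    by (intro exI[of _ "\<lambda>x v. f' x v + g' x v"])
      (use f g Suc.IH in \<open>auto intro!: has_derivative_add\<close>)
qed

lemma Ck_on_mult:
  fixes f g :: "'a::euclidean_space \<Rightarrow> real"
  shows "Ck_on k f S \<Longrightarrow> Ck_on k g S \<Longrightarrow> Ck_on k (\<lambda>x. f x * g x) S"
proof (induction k arbitrary: f g)
  case 0
  then show ?case by (auto intro: continuous_on_mult)
next
  case (Suc k)
  from Suc.prems obtain f' g' where f: "\<forall>x\<in>S. (f has_derivative f' x) (at x within S)"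
    "\<And>v. Ck_on k (\<lambda>x. f' x v) S" and g: "\<forall>x\<in>S. (g has_derivative g' x) (at x within S)"
    "\<And>v. Ck_on k (\<lambda>x. g' x v) S"
    unfolding Ck_on.simps by blast
  \<comment> \<open>Each term of the product rule keeps one factor undifferentiated, so both
    functions are also needed at the lower order \<open>k\<close>.\<close>
  note fg = Suc.prems[THEN Ck_on_Suc_imp]
  show ?case unfolding Ck_on.simps
    by (intro exI[of _ "\<lambda>x v. f x * g' x v + f' x v * g x"])
      (use f g Suc.IH fg in \<open>auto intro!: has_derivative_mult Ck_on_add\<close>)
qed

text \<open>The derivative in direction v is \<open>g' (L x) (L v)\<close>, for fixed v again a
  composition with \<open>L\<close>; this closes the induction.\<close>

lemma Ck_on_compose_linear:
  fixes g :: "'a::euclidean_space \<Rightarrow> real" and L :: "'c::euclidean_space \<Rightarrow> 'a"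
  assumes L: "bounded_linear L"
  shows "Ck_on k g UNIV \<Longrightarrow> Ck_on k (\<lambda>x. g (L x)) S"
proof (induction k arbitrary: g)
  case 0
  then show ?case
    using continuous_on_compose2[of UNIV g S L] linear_continuous_on[OF L] by simp
next
  case (Suc k)
  from Suc.prems obtain g' where g: "\<And>x. (g has_derivative g' x) (at x)"
    "\<And>v. Ck_on k (\<lambda>x. g' x v) UNIV"
    unfolding Ck_on.simps by auto
  show ?case unfolding Ck_on.simps
    by (intro exI[of _ "\<lambda>x v. g' (L x) (L v)"])
      (auto intro!: Suc.IH g has_derivative_compose[OF bounded_linear_imp_has_derivative[OF L] g(1)])
qed

text \<open>Having the outer derivatives as a sequence avoids a chain rule of order
  \<open>k\<close>: differentiating raises the index \<open>n\<close> and multiplies by a derivative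
  of f, which \<open>Ck_on_mult\<close> handles.\<close>

lemma Ck_on_compose_derivative_sequence:
  fixes g :: "nat \<Rightarrow> real \<Rightarrow> real" and f :: "'a::euclidean_space \<Rightarrow> real"
  assumes g: "\<And>n x. (g n has_real_derivative g (Suc n) x) (at x)"
  shows "Ck_on k f S \<Longrightarrow> Ck_on k (\<lambda>x. g n (f x)) S"
proof (induction k arbitrary: f n)
  case 0
  have "continuous_on UNIV (g n)"
    using g by (meson DERIV_continuous_on has_field_derivative_at_within)
  with 0 show ?case
    by (auto intro: continuous_on_compose2)
next
  case (Suc k)
  from Suc.prems obtain f' where f: "\<And>x. x \<in> S \<Longrightarrow> (f has_derivative f' x) (at x within S)"
    "\<And>v. Ck_on k (\<lambda>x. f' x v) S"
    unfolding Ck_on.simps by auto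
  have "((\<lambda>x. g n (f x)) has_derivative (\<lambda>v. g (Suc n) (f x) * f' x v)) (at x within S)"
    if "x \<in> S" for x
    using has_derivative_compose[OF f(1)[OF that] g[unfolded has_field_derivative_def]] .
  then show ?case unfolding Ck_on.simps
    by (intro exI[of _ "\<lambda>x v. g (Suc n) (f x) * f' x v"])
      (auto intro!: Ck_on_mult Suc.IH Ck_on_Suc_imp[OF Suc.prems] f)
qed

lemma Ck_on_antiderivative:
  fixes f g :: "real \<Rightarrow> real"
  assumes "\<And>x. (f has_real_derivative g x) (at x)" and "\<And>k. Ck_on k g UNIV"
  shows "Ck_on k f UNIV"
proof (cases k)
  case 0
  then show ?thesis using assms(1)
    by (auto intro: DERIV_continuous_on has_field_derivative_at_within)
next
  case (Suc k)
  show ?thesis unfolding Suc Ck_on.simps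
    by (intro exI[of _ "\<lambda>x v. g x * v"])
      (use assms in \<open>auto simp: has_field_derivative_def intro!: Ck_on_mult Ck_on_const\<close>)
qed

lemma Ck_on_cos: "Ck_on k f S \<Longrightarrow> Ck_on k (\<lambda>x. cos (f x)) S"
  for f :: "'a::euclidean_space \<Rightarrow> real"
proof -
  \<comment> \<open>Differentiating the cosine shifts its argument by pi/2, so one formula covers
    all derivatives.\<close>
  define g :: "nat \<Rightarrow> real \<Rightarrow> real" where "g n x = cos (x + real n * (pi/2))" for n x
  have "(g n has_real_derivative g (Suc n) x) (at x)" for n x
  proof -
    have *: "x + real (Suc n) * (pi/2) = (x + real n * (pi/2)) + pi/2"
      by (simp add: algebra_simps)
    have "g (Suc n) x = - sin (x + real n * (pi/2))"
      unfolding g_def * by (subst cos_add) simp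
    then show ?thesis unfolding g_def
      by (auto intro!: derivative_eq_intros)
  qed
  from Ck_on_compose_derivative_sequence[of g, OF this, of k f S 0] show "Ck_on k f S \<Longrightarrow> ?thesis"
    by (simp add: g_def)
qed

text \<open>The functions \<open>p(1/x) e\<^sup>-\<^sup>1\<^sup>/\<^sup>x\<close> are closed under differentiation, also at \<open>0\<close>.\<close>

definition bump_poly :: "real poly \<Rightarrow> real \<Rightarrow> real" where
  "bump_poly p x = (if x > 0 then poly p (1/x) * exp (- (1/x)) else 0)"

text \<open>The power \<open>y ^ k\<close> is there for the induction: peeling one coefficient off
  the polynomial leaves a further factor y.\<close>

lemma poly_times_exp_tendsto_0:
  "((\<lambda>y::real. y ^ k * poly p y * exp (- y)) \<longlongrightarrow> 0) at_top"
proof (induction p arbitrary: k)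
  case (pCons a p)
  have "((\<lambda>y. a * (y ^ k / exp y) + y ^ Suc k * poly p y * exp (- y)) \<longlongrightarrow> a * 0 + 0) at_top"
    by (intro tendsto_intros pCons.IH tendsto_power_div_exp_0)
  then show ?case by (simp add: algebra_simps exp_minus divide_inverse)
qed simp

text \<open>This is the difference quotient at 0, where \<open>bump_poly p\<close> vanishes. On the
  right the substitution y = 1/x applies; on the left the quotient is identically 0.\<close>

lemma bump_poly_over_tendsto_0: "((\<lambda>x. bump_poly p x / x) \<longlongrightarrow> 0) (at 0)"
proof -
  have "((\<lambda>x. (1/x) ^ 1 * poly p (1/x) * exp (- (1/x))) \<longlongrightarrow> 0) (at_right (0::real))"
    by (rule filterlim_compose[OF poly_times_exp_tendsto_0])
       (simp add: filterlim_inverse_at_top_right flip: inverse_eq_divide)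
  then have "((\<lambda>x. bump_poly p x / x) \<longlongrightarrow> 0) (at_right 0)"
    by (rule Lim_transform_eventually)
       (auto simp: bump_poly_def eventually_at_filter)
  moreover have "((\<lambda>x. bump_poly p x / x) \<longlongrightarrow> 0) (at_left 0)"
    by (rule Lim_transform_eventually[OF tendsto_const])
       (auto simp: bump_poly_def eventually_at_filter)
  ultimately show ?thesis
    by (simp add: filterlim_at_split)
qed

text \<open>With y = 1/x the derivative of p(y) exp(-y) in x is (p - p')(y) y^2 exp(-y), and
  \<open>[:0, 0, 1:]\<close> is y^2.\<close>

lemma has_real_derivative_bump_poly:
  "(bump_poly p has_real_derivative bump_poly ((p - pderiv p) * [:0, 0, 1:]) x) (at x)"
proof -
  consider "x < 0" | "x = 0" | "x > 0" by linarith
  then show ?thesis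
  proof cases
    case 1
    have "((\<lambda>_. 0) has_real_derivative 0) (at x)" by simp
    then have "(bump_poly p has_real_derivative 0) (at x)"
      by (rule has_field_derivative_transform_within_open[of _ _ _ "{..<0}"])
         (use 1 in \<open>auto simp: bump_poly_def\<close>)
    with 1 show ?thesis by (simp add: bump_poly_def)
  next
    case 2
    then show ?thesis
      using bump_poly_over_tendsto_0[of p]
      by (simp add: DERIV_def bump_poly_def)
  next
    case 3
    have "((\<lambda>x. poly p (1/x) * exp (- (1/x))) has_real_derivative
        (poly (pderiv p) (1/x) * (-1/x^2)) * exp (- (1/x)) + poly p (1/x) * (exp (-(1/x)) * (1/x^2))) (at x)"
      using 3 by (auto intro!: derivative_eq_intros DERIV_chain2[OF poly_DERIV] simp: power2_eq_square)
    then have "(bump_poly p has_real_derivative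
        (poly (pderiv p) (1/x) * (-1/x^2)) * exp (- (1/x)) + poly p (1/x) * (exp (-(1/x)) * (1/x^2))) (at x)"
      by (rule has_field_derivative_transform_within_open[of _ _ _ "{0<..}"])
         (use 3 in \<open>auto simp: bump_poly_def\<close>)
    with 3 show ?thesis
      by (simp add: bump_poly_def field_simps power2_eq_square)
  qed
qed

text \<open>The n-th derivative of exp(-1/x), extended by 0 to x \<le> 0, obtained by iterating the
  polynomial recursion from the constant 1.\<close>

definition bump_deriv :: "nat \<Rightarrow> real \<Rightarrow> real" where
  "bump_deriv n = bump_poly (((\<lambda>p. (p - pderiv p) * [:0, 0, 1:]) ^^ n) 1)"

lemma has_real_derivative_bump_deriv:
  "(bump_deriv n has_real_derivative bump_deriv (Suc n) x) (at x)"
  unfolding bump_deriv_def using has_real_derivative_bump_poly by simp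

lemma bump_deriv_nonpos: "x \<le> 0 \<Longrightarrow> bump_deriv n x = 0"
  by (simp add: bump_deriv_def bump_poly_def)

lemma bump_deriv_0: "x > 0 \<Longrightarrow> bump_deriv 0 x = exp (- (1/x))"
  by (simp add: bump_deriv_def bump_poly_def)

lemma continuous_on_bump_deriv: "continuous_on S (bump_deriv n)"
  by (meson DERIV_continuous_on has_field_derivative_at_within has_real_derivative_bump_deriv)

text \<open>Arguments up to 1 suffice for the spatial cutoff, which evaluates the bump at 1 - c
  |x|^2 with c \<ge> 0. Negative arguments cost nothing because the function vanishes there.\<close>

lemma bump_deriv_bounded: "\<exists>B. \<forall>s\<le>1. \<bar>bump_deriv n s\<bar> \<le> B"
proof -
  have "compact (bump_deriv n ` {0..1})"
    by (intro compact_continuous_image continuous_on_bump_deriv) simp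
  then obtain B where "\<And>s. s \<in> {0..1} \<Longrightarrow> norm (bump_deriv n s) \<le> B"
    using compact_imp_bounded bounded_iff by (metis image_eqI)
  moreover from this[of 0] have "0 \<le> B" by (simp add: bump_deriv_nonpos)
  ultimately have "\<forall>s\<le>1. \<bar>bump_deriv n s\<bar> \<le> B"
    by (metis abs_0 atLeastAtMost_iff bump_deriv_nonpos linorder_le_cases real_norm_def)
  then show ?thesis ..
qed

lemma Ck_on_bump: "Ck_on k f S \<Longrightarrow> Ck_on k (\<lambda>x. bump_deriv n (f x)) S"
  by (rule Ck_on_compose_derivative_sequence[of bump_deriv])
    (rule has_real_derivative_bump_deriv)

section \<open>Weak derivatives in time\<close>

lemma borel_measurable_cnj [measurable (raw)]:
  "f \<in> borel_measurable M \<Longrightarrow> (\<lambda>x. cnj (f x)) \<in> borel_measurable M"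
  by (rule borel_measurable_continuous_on[of cnj]) (auto intro!: continuous_intros)

text \<open>Used for functions vanishing outside \<open>(0,T)\<close>, where this is the integral from \<open>0\<close> to \<open>t\<close>.\<close>

definition primitive :: "(real \<Rightarrow> complex) \<Rightarrow> real \<Rightarrow> complex" where
  "primitive F t = (LINT s|lborel. of_bool (s < t) * F s)"

lemma primitive_measurable [measurable]:
  assumes [measurable]: "F \<in> borel_measurable borel"
  shows "primitive F \<in> borel_measurable borel"
  unfolding primitive_def[abs_def] by measurable

lemma integrable_of_bool_mult:
  fixes F :: "'a \<Rightarrow> 'b::{real_normed_field, banach, second_countable_topology}"
  assumes "integrable M F" and [measurable]: "Measurable.pred M P"
  shows "integrable M (\<lambda>s. of_bool (P s) * F s)"
  by (rule Bochner_Integration.integrable_bound[OF assms(1)]) (use assms in auto)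

lemma norm_primitive_le:
  assumes "integrable lborel F"
  shows "cmod (primitive F t) \<le> (LINT s|lborel. cmod (F s))"
proof -
  have "cmod (primitive F t) \<le> (LINT s|lborel. cmod (of_bool (s < t) * F s))"
    unfolding primitive_def by (rule integral_norm_bound)
  also have "\<dots> \<le> (LINT s|lborel. cmod (F s))"
    using assms by (intro integral_mono integrable_norm integrable_of_bool_mult) auto
  finally show ?thesis .
qed

lemma integrable_triangle:
  fixes F G :: "real \<Rightarrow> 'b::{real_normed_field, banach, second_countable_topology}"
  assumes F: "integrable lborel F" and G: "integrable lborel G"
  shows "integrable (lborel \<Otimes>\<^sub>M lborel) (\<lambda>(r, s). of_bool (r < s) * (F r * G s))"
proof -
  have [measurable]: "F \<in> borel_measurable borel" "G \<in> borel_measurable borel"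
    using F G by auto
  have "integrable (lborel \<Otimes>\<^sub>M lborel) (\<lambda>p. F (fst p) * G (snd p))"
    using integrable_lborel_pair_mult[OF F G] by (simp add: lborel_prod)
  from integrable_of_bool_mult[OF this, of "\<lambda>p. fst p < snd p"]
  show ?thesis by (simp add: case_prod_unfold)
qed

text \<open>Fubini on the triangle r < s. This stands in for integration by parts and asks for no
  differentiability of the primitive.\<close>

lemma integral_primitive_mult:
  assumes F: "integrable lborel F" and G: "integrable lborel G"
  shows "(LINT s|lborel. primitive F s * G s) = (LINT r|lborel. F r * (LINT s|lborel. of_bool (r < s) * G s))"
proof -
  have "(LINT s|lborel. primitive F s * G s) = (LINT s|lborel. LINT r|lborel. of_bool (r < s) * (F r * G s))"
    unfolding primitive_def by (simp add: mult.assoc flip: integral_mult_left_zero)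
  also have "\<dots> = (LINT r|lborel. LINT s|lborel. of_bool (r < s) * (F r * G s))"
    by (rule lborel_pair.Fubini_integral[OF integrable_triangle[OF F G]])
  also have "\<dots> = (LINT r|lborel. F r * (LINT s|lborel. of_bool (r < s) * G s))"
    by (simp add: mult.left_commute flip: integral_mult_right_zero)
  finally show ?thesis .
qed

text \<open>The square is the double integral of F(r) times the conjugate of F(s). The diagonal is a
  null set, and the halves r < s and s < r are complex conjugates of each other, which leaves twice
  a real part.\<close>

lemma norm_integral_square:
  assumes F: "integrable lborel F"
  shows "(cmod (LINT s|lborel. F s))\<^sup>2 = 2 * (LINT s|lborel. Re (primitive F s * cnj (F s)))"
proof -
  have cF: "integrable lborel (\<lambda>s. cnj (F s))" using F by simp
  have [measurable]: "F \<in> borel_measurable borel" using F by auto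
  define Z where "Z = (LINT s|lborel. primitive F s * cnj (F s))"
  have prim: "integrable lborel (\<lambda>s. primitive F s * cnj (F s))"
  proof (rule Bochner_Integration.integrable_bound[OF integrable_mult_left[OF F, of "complex_of_real (LINT s|lborel. cmod (F s))"]])
    show "AE s in lborel. cmod (primitive F s * cnj (F s)) \<le> cmod (F s * complex_of_real (LINT s|lborel. cmod (F s)))"
      using norm_primitive_le[OF F] by (auto simp: norm_mult mult.commute[of "cmod (F _)"] intro!: mult_right_mono)
  qed measurable
  have "complex_of_real ((cmod (LINT s|lborel. F s))\<^sup>2) = (LINT r|lborel. F r * (LINT s|lborel. cnj (F s)))"
    by (simp only: complex_norm_square Bochner_Integration.integral_cnj integral_mult_left_zero)
  also have "\<dots> = (LINT r|lborel. F r * (LINT s|lborel. of_bool (r < s) * cnj (F s)) + cnj (primitive F r * cnj (F r)))"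
  proof (rule Bochner_Integration.integral_cong[OF refl])
    fix r
    have "(LINT s|lborel. cnj (F s)) = (LINT s|lborel. of_bool (r < s) * cnj (F s) + of_bool (s < r) * cnj (F s))"
    proof (rule integral_cong_AE)
      show "AE s in lborel. cnj (F s) = of_bool (r < s) * cnj (F s) + of_bool (s < r) * cnj (F s)"
        using AE_lborel_singleton[of r] by eventually_elim auto
    qed measurable
    also have "\<dots> = (LINT s|lborel. of_bool (r < s) * cnj (F s)) + (LINT s|lborel. of_bool (s < r) * cnj (F s))"
      by (intro Bochner_Integration.integral_add integrable_of_bool_mult[OF cF]) measurable
    also have "(LINT s|lborel. of_bool (s < r) * cnj (F s)) = cnj (primitive F r)"
    proof -
      have "cnj (primitive F r) = (LINT s|lborel. cnj (of_bool (s < r) * F s))"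
        unfolding primitive_def by (rule Bochner_Integration.integral_cnj[symmetric])
      also have "\<dots> = (LINT s|lborel. of_bool (s < r) * cnj (F s))"
        by (intro Bochner_Integration.integral_cong refl) auto
      finally show ?thesis ..
    qed
    finally show "F r * (LINT s|lborel. cnj (F s)) = F r * (LINT s|lborel. of_bool (r < s) * cnj (F s)) + cnj (primitive F r * cnj (F r))"
      by (simp add: algebra_simps)
  qed
  also have "\<dots> = (LINT r|lborel. F r * (LINT s|lborel. of_bool (r < s) * cnj (F s))) + (LINT r|lborel. cnj (primitive F r * cnj (F r)))"
  proof (rule Bochner_Integration.integral_add)
    have "integrable lborel (\<lambda>r. LINT s|lborel. of_bool (r < s) * (F r * cnj (F s)))"
      using lborel_pair.integrable_fst'[OF integrable_triangle[OF F cF]] by simp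
    then show "integrable lborel (\<lambda>r. F r * (LINT s|lborel. of_bool (r < s) * cnj (F s)))"
      by (simp add: mult.left_commute flip: integral_mult_right_zero)
  qed (rule integrable_bounded_linear[OF bounded_linear_cnj prim])
  also have "\<dots> = Z + cnj Z"
    unfolding Z_def integral_primitive_mult[OF F cF, symmetric] Bochner_Integration.integral_cnj ..
  also have "\<dots> = complex_of_real (2 * Re Z)"
    by (simp add: complex_eq_iff)
  finally have "(cmod (LINT s|lborel. F s))\<^sup>2 = 2 * Re Z"
    by (simp only: of_real_eq_iff)
  also have "Re Z = (LINT s|lborel. Re (primitive F s * cnj (F s)))"
    unfolding Z_def by (rule integral_bounded_linear[OF bounded_linear_Re prim, symmetric])
  finally show ?thesis .
qed

text \<open>Integrated form of the rule (|P|^2)' = 2 Re(P conj(P')), obtained from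
  \<open>norm_integral_square\<close> for F cut off at time t; before t the cut does not affect the
  primitive.\<close>

lemma norm_primitive_square:
  assumes F: "integrable lborel F"
  shows "(cmod (primitive F t))\<^sup>2 = 2 * (LINT s|lborel. of_bool (s < t) * Re (primitive F s * cnj (F s)))"
proof -
  let ?G = "\<lambda>s. of_bool (s < t) * F s"
  have G: "integrable lborel ?G" by (rule integrable_of_bool_mult[OF F]) auto
  have "primitive ?G s = primitive F s" if "s < t" for s
    unfolding primitive_def by (intro Bochner_Integration.integral_cong refl) (use that in auto)
  then have *: "Re (primitive ?G s * cnj (?G s)) = of_bool (s < t) * Re (primitive F s * cnj (F s))" for s
    by (cases "s < t") auto
  show ?thesis
    using norm_integral_square[OF G] unfolding * by (simp add: primitive_def)
qed

text \<open>For large n the argument of the bump is positive exactly between p and q - 1/n, and at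
  each fixed t of the open interval it tends to infinity, so exp(-1/s) tends to 1. The shift by 1/n
  keeps the supports away from the right end, which may be the final time.\<close>

lemma bump_interval_tendsto:
  assumes "p < q"
  shows "(\<lambda>n. bump_deriv 0 (real n * (t - p) * (q - 1 / real n - t))) \<longlonglongrightarrow> indicat_real {p<..<q} t"
proof (cases "t \<in> {p<..<q}")
  case True
  \<comment> \<open>The factor \<open>real n\<close> turns the shift 1/n into the correction
    \<open>t - p\<close>, which does not grow with n.\<close>
  have lim: "filterlim (\<lambda>n. real n * ((t - p) * (q - t)) - (t - p)) at_top sequentially"
    using True by real_asymp
  have ev: "\<forall>\<^sub>F n in sequentially. exp (- (1 / (real n * ((t - p) * (q - t)) - (t - p)))) =
     bump_deriv 0 (real n * (t - p) * (q - 1 / real n - t))"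
    using eventually_gt_at_top[of 0] filterlim_at_top_dense[THEN iffD1, OF lim, rule_format, of 0]
  proof eventually_elim
    case (elim n)
    have "real n * (t - p) * (q - 1 / real n - t) = real n * ((t - p) * (q - t)) - (t - p)"
      using elim(1) by (simp add: field_simps)
    with elim(2) show ?case by (simp add: bump_deriv_0)
  qed
  have "(\<lambda>n. exp (- (1 / (real n * ((t - p) * (q - t)) - (t - p))))) \<longlonglongrightarrow> exp (- 0)"
    by (intro tendsto_intros tendsto_divide_0[OF tendsto_const] filterlim_at_top_imp_at_infinity lim)
  then show ?thesis
    using True ev by (auto intro: Lim_transform_eventually)
next
  case False
  have "(\<lambda>n. q - 1 / real n) \<longlonglongrightarrow> q - 0"
    by (intro tendsto_intros lim_1_over_n)
  then have "\<forall>\<^sub>F n in sequentially. p < q - 1 / real n"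
    using assms by (intro order_tendstoD) auto
  then have "\<forall>\<^sub>F n in sequentially. bump_deriv 0 (real n * (t - p) * (q - 1 / real n - t)) = 0"
  proof eventually_elim
    case (elim n)
    have "0 \<le> 1 / real n" by simp
    then have "(t - p) * (q - 1 / real n - t) \<le> 0"
    proof (cases "t \<le> p")
      case True
      with elim show ?thesis by (intro mult_nonpos_nonneg) auto
    next
      case t: False
      with False have "q \<le> t" by simp
      with \<open>0 \<le> 1 / real n\<close> have "q - 1 / real n - t \<le> 0" by linarith
      with t show ?thesis by (intro mult_nonneg_nonpos) auto
    qed
    then have "real n * ((t - p) * (q - 1 / real n - t)) \<le> 0"
      by (simp add: mult_nonneg_nonpos)
    then show ?case by (simp add: bump_deriv_nonpos mult.assoc)
  qed
  then show ?thesis using False by (simp add: tendsto_eventually)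
qed

lemma bump_deriv_0_le_1: "\<bar>bump_deriv 0 x\<bar> \<le> 1"
  by (cases "x > 0") (auto simp: bump_deriv_0 bump_deriv_nonpos)

lemma bump_deriv_measurable [measurable]: "bump_deriv n \<in> borel_measurable borel"
  by (intro borel_measurable_continuous_onI continuous_on_bump_deriv)

text \<open>Open intervals are an intersection-stable generator of the Borel sets, so vanishing over
  them spreads to all Borel sets by Dynkin's argument, and a density with zero integral over every
  set is zero. Intervals reaching beyond [0,T] are first trimmed, h being zero there.\<close>

lemma AE_zero_if_integral_intervals_zero:
  fixes h :: "real \<Rightarrow> complex"
  assumes h: "integrable lborel h" and z: "\<And>t. t \<notin> {0<..<T} \<Longrightarrow> h t = 0"
    and I: "\<And>p q. 0 \<le> p \<Longrightarrow> p < q \<Longrightarrow> q \<le> T \<Longrightarrow> (LINT t|lborel. indicat_real {p<..<q} t *\<^sub>R h t) = 0"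
  shows "AE t in lborel. h t = 0"
proof -
  have I': "(LINT t:{p<..<q}|lborel. h t) = 0" for p q
  proof -
    have "(LINT t:{p<..<q}|lborel. h t) = (LINT t:{max 0 p<..<min T q}|lborel. h t)"
      unfolding set_lebesgue_integral_def
      by (intro Bochner_Integration.integral_cong refl) (use z in \<open>auto simp: indicator_def\<close>)
    also have "\<dots> = 0"
      using I[of "max 0 p" "min T q"] by (cases "max 0 p < min T q") (auto simp: set_lebesgue_integral_def)
    finally show ?thesis .
  qed
  have Iall: "(LINT t|lborel. h t) = 0"
  proof -
    have "(LINT t|lborel. h t) = (LINT t:{0<..<T}|lborel. h t)"
      unfolding set_lebesgue_integral_def
      by (intro Bochner_Integration.integral_cong refl) (use z in \<open>auto simp: indicator_def\<close>)
    then show ?thesis using I' by simp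
  qed
  have hs: "set_integrable lborel A h" if "A \<in> sets borel" for A
    unfolding set_integrable_def using that h by (intro integrable_mult_indicator) auto
  let ?G = "range (\<lambda>(p, q). box p q) :: real set set"
  have gen: "A \<in> sigma_sets UNIV ?G \<longleftrightarrow> A \<in> sets borel" for A :: "real set"
    by (simp add: borel_eq_box)
  have stable: "Int_stable ?G"
  proof (rule Int_stableI)
    fix A B assume "A \<in> ?G" "B \<in> ?G"
    then obtain a b c d where "A = {a<..<b}" "B = {c<..<d}" by (auto simp: box_real)
    then have "A \<inter> B = (\<lambda>(p, q). box p q) (max a c, min b d)" by auto
    then show "A \<inter> B \<in> ?G" by blast
  qed
  have closed: "?G \<subseteq> Pow UNIV" by simp
  have "(LINT t:A|lborel. h t) = 0" if "A \<in> sigma_sets UNIV ?G" for A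
    using stable closed that
  proof (induction rule: sigma_sets_induct_disjoint)
    case (basic A)
    then show ?case using I' by (auto simp: box_real)
  next
    case (compl A)
    then have "A \<in> sets borel" unfolding gen by simp
    then have "(LINT t:A \<union> (UNIV - A)|lborel. h t) = (LINT t:A|lborel. h t) + (LINT t:UNIV - A|lborel. h t)"
      by (intro set_integral_Un) (auto intro: hs)
    then show ?case using compl Iall by (simp add: set_lebesgue_integral_def)
  next
    case (union A)
    have m: "A i \<in> sets borel" for i
      by (rule gen[THEN iffD1]) (use union(2) in blast)
    have "(LINT t:(\<Union>i. A i)|lborel. h t) = (\<Sum>i. LINT t:A i|lborel. h t)"
      by (rule lebesgue_integral_countable_add) (use m union(1) hs in \<open>auto simp: disjoint_family_on_def\<close>)
    then show ?case using union by simp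
  qed (use I' in \<open>auto simp: set_lebesgue_integral_def\<close>)
  then have "(LINT t:A|lborel. h t) = 0" if "A \<in> sets borel" for A
    using that unfolding gen .
  then show ?thesis
    by (intro sigma_finite_measure.density_zero[OF sigma_finite_lborel h]) auto
qed

text \<open>Test functions must vanish before T, so only \<open>q < T\<close> is available;
  intervals ending at T are reached through bumps ending at q - 1/n.\<close>

lemma AE_zero_if_bump_integrals_zero:
  fixes h :: "real \<Rightarrow> complex"
  assumes h: "integrable lborel h" and z: "\<And>t. t \<notin> {0<..<T} \<Longrightarrow> h t = 0"
    and I: "\<And>p q n. 0 \<le> p \<Longrightarrow> p < q \<Longrightarrow> q < T \<Longrightarrow>
      (LINT t|lborel. bump_deriv 0 (real n * (t - p) * (q - t)) *\<^sub>R h t) = 0"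
  shows "AE t in lborel. h t = 0"
proof (rule AE_zero_if_integral_intervals_zero[OF h z])
  fix p q :: real assume pq: "0 \<le> p" "p < q" "q \<le> T"
  have [measurable]: "h \<in> borel_measurable borel" using h by auto
  have lim: "(\<lambda>n. LINT t|lborel. bump_deriv 0 (real n * (t - p) * (q - 1 / real n - t)) *\<^sub>R h t)
    \<longlonglongrightarrow> (LINT t|lborel. indicat_real {p<..<q} t *\<^sub>R h t)"
  proof (rule integral_dominated_convergence[where w="\<lambda>t. cmod (h t)"])
    show "AE t in lborel. (\<lambda>n. bump_deriv 0 (real n * (t - p) * (q - 1 / real n - t)) *\<^sub>R h t) \<longlonglongrightarrow> indicat_real {p<..<q} t *\<^sub>R h t"
      by (intro AE_I2 tendsto_scaleR tendsto_const bump_interval_tendsto pq)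
    show "AE t in lborel. norm (bump_deriv 0 (real n * (t - p) * (q - 1 / real n - t)) *\<^sub>R h t) \<le> cmod (h t)" for n
      by (auto intro!: AE_I2 mult_left_le_one_le bump_deriv_0_le_1)
  qed (use h in auto)
  have "(\<lambda>n. q - 1 / real n) \<longlonglongrightarrow> q - 0"
    by (intro tendsto_intros lim_1_over_n)
  then have "\<forall>\<^sub>F n in sequentially. p < q - 1 / real n"
    using pq by (intro order_tendstoD) auto
  then have "\<forall>\<^sub>F n in sequentially. (LINT t|lborel. bump_deriv 0 (real n * (t - p) * (q - 1 / real n - t)) *\<^sub>R h t) = 0"
    using eventually_gt_at_top[of 0]
  proof eventually_elim
    case (elim n)
    have "0 < 1 / real n" using elim by simp
    with elim pq show ?case by (intro I) linarith+
  qed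
  from tendsto_unique[OF _ lim tendsto_eventually[OF this]]
  show "(LINT t|lborel. indicat_real {p<..<q} t *\<^sub>R h t) = 0" by simp
qed

text \<open>The antiderivative is normalised to vanish after q instead of before p. It is thus
  admissible in time while in general nonzero at time 0, which is what detects the initial
  value.\<close>

lemma bump_time_profile:
  assumes "p < q" "0 \<le> c"
  defines "\<eta> \<equiv> \<lambda>t. bump_deriv 0 (c * (t - p) * (q - t))"
  obtains \<theta> where "\<And>t. (\<theta> has_real_derivative \<eta> t) (at t)" "\<And>k. Ck_on k \<theta> UNIV"
    "\<And>t. t \<ge> q \<Longrightarrow> \<theta> t = 0" "\<And>t. \<theta> t = - (LINT s|lborel. of_bool (t < s) * \<eta> s)"
proof -
  have cont: "continuous_on S \<eta>" for S
    unfolding \<eta>_def by (intro continuous_on_compose2[OF continuous_on_bump_deriv[of UNIV]] continuous_intros) auto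
  have eta0: "\<eta> t = 0" if "t \<ge> q" for t
    unfolding \<eta>_def using that assms
    by (intro bump_deriv_nonpos) (auto simp: mult_nonneg_nonpos)
  have "\<exists>F. \<forall>x. - \<infinity> < ereal x \<longrightarrow> ereal x < \<infinity> \<longrightarrow> (F has_vector_derivative \<eta> x) (at x)"
    using cont[of UNIV] by (intro einterval_antiderivative) (auto simp: continuous_on_eq_continuous_at)
  then obtain F where F: "\<And>x. (F has_real_derivative \<eta> x) (at x)"
    by (auto simp: has_real_derivative_iff_has_vector_derivative)
  define \<theta> where "\<theta> t = F t - F q" for t
  have D: "(\<theta> has_real_derivative \<eta> t) (at t)" for t
    unfolding \<theta>_def using F by (auto intro!: derivative_eq_intros)
  have th0: "\<theta> t = 0" if "t \<ge> q" for t
  proof (cases "t = q")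
    case False
    have "\<theta> t = \<theta> q"
    proof (rule DERIV_isconst2[of q t \<theta>])
      show "continuous_on {q..t} \<theta>"
        by (meson D DERIV_continuous_on has_field_derivative_at_within)
      show "DERIV \<theta> x :> 0" if "q < x" for x
        using D[of x] eta0[of x] that by simp
    qed (use False that in auto)
    then show ?thesis by (simp add: \<theta>_def)
  qed (simp add: \<theta>_def)
  show ?thesis
  proof (rule that[OF D _ th0])
    have "Ck_on k \<eta> UNIV" for k
    proof -
      have "Ck_on k (\<lambda>t. (c * (t + - p)) * (q + - 1 * t)) UNIV"
        by (intro Ck_on_mult Ck_on_add Ck_on_const Ck_on_linear[OF bounded_linear_ident])
      from Ck_on_bump[OF this, of 0] show ?thesis by (simp add: \<eta>_def)
    qed
    with D show "Ck_on k \<theta> UNIV" for k by (rule Ck_on_antiderivative)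
    show "\<theta> t = - (LINT s|lborel. of_bool (t < s) * \<eta> s)" for t
    proof (cases "t < q")
      case True
      have "(LINT s|lborel. of_bool (t < s) * \<eta> s) = (LINT s|lborel. indicator {t..q} s *\<^sub>R \<eta> s)"
      proof (rule integral_cong_AE)
        have [measurable]: "\<eta> \<in> borel_measurable borel"
          using cont by (rule borel_measurable_continuous_onI)
        show "(\<lambda>s. of_bool (t < s) * \<eta> s) \<in> borel_measurable lborel"
          "(\<lambda>s. indicator {t..q} s *\<^sub>R \<eta> s) \<in> borel_measurable lborel"
          by measurable
        show "AE s in lborel. of_bool (t < s) * \<eta> s = indicator {t..q} s *\<^sub>R \<eta> s"
          using AE_lborel_singleton[of t] by eventually_elim (auto simp: indicator_def eta0)
      qed
      also have "\<dots> = \<theta> q - \<theta> t"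
        using True cont D by (intro integral_FTC_atLeastAtMost)
          (auto intro: has_vector_derivative_at_within simp: has_real_derivative_iff_has_vector_derivative)
      finally show ?thesis using th0 by simp
    next
      case False
      then have "(\<lambda>s. of_bool (t < s) * \<eta> s) = (\<lambda>s. 0)"
        by (auto simp: eta0)
      with False th0 show ?thesis by simp
    qed
  qed
qed

text \<open>Du Bois-Reymond argument with the initial value built in: \<theta> need not vanish at
  time 0 and no boundary term occurs, so the constant of integration is 0. For \<theta> the backward
  antiderivative of a bump \<eta>, Fubini turns the second integral into minus the integral of
  \<eta> times \<open>primitive F\<close>.\<close>

lemma weak_derivative_imp_primitive:
  fixes a F :: "real \<Rightarrow> complex"
  assumes a: "integrable lborel a" and F: "integrable lborel F"
    and weak: "\<And>\<theta> \<eta> q. (\<And>t. (\<theta> has_real_derivative \<eta> t) (at t)) \<Longrightarrow> continuous_on UNIV \<eta> \<Longrightarrow>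
      (\<And>k. Ck_on k \<theta> UNIV) \<Longrightarrow> q < T \<Longrightarrow> (\<And>t. t \<ge> q \<Longrightarrow> \<theta> t = 0) \<Longrightarrow>
      (LINT t|lborel. \<eta> t *\<^sub>R a t) + (LINT t|lborel. \<theta> t *\<^sub>R F t) = 0"
  shows "AE t in lborel. t \<in> {0<..<T} \<longrightarrow> a t = primitive F t"
proof -
  have [measurable]: "a \<in> borel_measurable borel" "F \<in> borel_measurable borel"
    using a F by auto
  define h where "h t = indicator {0<..<T} t *\<^sub>R (a t - primitive F t)" for t
  have prim_i: "integrable lborel (\<lambda>t. indicator {0<..<T} t *\<^sub>R primitive F t)"
  proof (rule Bochner_Integration.integrable_bound)
    show "integrable lborel (\<lambda>t. indicator {0<..<T} t *\<^sub>R (LINT s|lborel. cmod (F s)))"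
      by (intro integrable_indicator emeasure_bounded_finite) auto
    show "AE t in lborel. norm (indicator {0<..<T} t *\<^sub>R primitive F t) \<le> norm (indicator {0<..<T} t *\<^sub>R (LINT s|lborel. cmod (F s)))"
      using norm_primitive_le[OF F] by (auto simp: indicator_def)
  qed measurable
  have a_i: "integrable lborel (\<lambda>t. indicator {0<..<T} t *\<^sub>R a t)"
    using a by (intro integrable_mult_indicator) auto
  have "AE t in lborel. h t = 0"
  proof (rule AE_zero_if_bump_integrals_zero)
    show "integrable lborel h" unfolding h_def scaleR_diff_right using a_i prim_i by simp
    show "h t = 0" if "t \<notin> {0<..<T}" for t using that by (simp add: h_def)
    fix p q :: real and n :: nat
    assume pq: "0 \<le> p" "p < q" "q < T"
    define \<eta> where "\<eta> t = bump_deriv 0 (real n * (t - p) * (q - t))" for t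
    obtain \<theta> where \<theta>: "\<And>t. (\<theta> has_real_derivative \<eta> t) (at t)" "\<And>k. Ck_on k \<theta> UNIV"
      "\<And>t. t \<ge> q \<Longrightarrow> \<theta> t = 0" "\<And>t. \<theta> t = - (LINT s|lborel. of_bool (t < s) * \<eta> s)"
      using bump_time_profile[OF pq(2), of "real n"] unfolding \<eta>_def by auto
    have cont: "continuous_on UNIV \<eta>"
      unfolding \<eta>_def by (intro continuous_on_compose2[OF continuous_on_bump_deriv[of UNIV]] continuous_intros) auto
    then have [measurable]: "\<eta> \<in> borel_measurable borel" by (rule borel_measurable_continuous_onI)
    have eta0: "\<eta> t = 0" if "t \<notin> {0<..<T}" for t
    proof -
      have "(t - p) * (q - t) \<le> 0" using that pq by (auto simp: mult_le_0_iff)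
      then have "real n * ((t - p) * (q - t)) \<le> 0" by (simp add: mult_nonneg_nonpos)
      then show ?thesis unfolding \<eta>_def by (intro bump_deriv_nonpos) (simp add: mult.assoc)
    qed
    have eta_le: "\<bar>\<eta> t\<bar> \<le> 1" for t unfolding \<eta>_def by (rule bump_deriv_0_le_1)
    have eta_i: "integrable lborel \<eta>"
    proof (rule Bochner_Integration.integrable_bound[of _ "indicat_real {0<..<T}"])
      show "AE t in lborel. norm (\<eta> t) \<le> norm (indicat_real {0<..<T} t)"
        using eta0 eta_le by (auto simp: indicator_def)
    qed (auto intro!: integrable_real_indicator emeasure_bounded_finite)
    have weak': "(LINT t|lborel. \<eta> t *\<^sub>R a t) + (LINT t|lborel. \<theta> t *\<^sub>R F t) = 0"
      by (rule weak[OF \<theta>(1) cont \<theta>(2) pq(3) \<theta>(3)])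
    have cth: "complex_of_real (\<theta> t) = - (LINT s|lborel. of_bool (t < s) * complex_of_real (\<eta> s))" for t
    proof -
      have "complex_of_real (of_bool P * x) = of_bool P * complex_of_real x" for P and x :: real
        by (cases P) auto
      note of_bool_eq = this
      show ?thesis
        unfolding \<theta>(4)[of t] of_real_minus integral_complex_of_real[symmetric] of_bool_eq ..
    qed
    have "(LINT t|lborel. \<theta> t *\<^sub>R F t) = - (LINT t|lborel. F t * (LINT s|lborel. of_bool (t < s) * complex_of_real (\<eta> s)))"
      unfolding scaleR_conv_of_real cth by (simp add: mult.commute)
    also have "\<dots> = - (LINT s|lborel. primitive F s * complex_of_real (\<eta> s))"
      by (subst integral_primitive_mult[OF F]) (use eta_i in auto)
    finally have 1: "(LINT t|lborel. \<theta> t *\<^sub>R F t) = - (LINT t|lborel. \<eta> t *\<^sub>R primitive F t)"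
      by (simp add: scaleR_conv_of_real mult.commute)
    have "integrable lborel (\<lambda>t. \<eta> t *\<^sub>R a t)"
      by (rule Bochner_Integration.integrable_bound[OF a]) (auto intro!: mult_left_le_one_le eta_le)
    moreover have "integrable lborel (\<lambda>t. \<eta> t *\<^sub>R primitive F t)"
    proof (rule Bochner_Integration.integrable_bound[OF prim_i])
      show "AE t in lborel. norm (\<eta> t *\<^sub>R primitive F t) \<le> norm (indicator {0<..<T} t *\<^sub>R primitive F t)"
        using eta0 eta_le by (auto simp: indicator_def intro!: mult_left_le_one_le)
    qed measurable
    ultimately have "(LINT t|lborel. \<eta> t *\<^sub>R (a t - primitive F t)) = 0"
      using weak' 1 by (simp add: scaleR_diff_right)
    moreover have "\<eta> t *\<^sub>R h t = \<eta> t *\<^sub>R (a t - primitive F t)" for t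
      using eta0[of t] by (cases "t \<in> {0<..<T}") (auto simp: h_def)
    ultimately show "(LINT t|lborel. bump_deriv 0 (real n * (t - p) * (q - t)) *\<^sub>R h t) = 0"
      by (simp only: \<eta>_def[symmetric])
  qed
  then show ?thesis
    by eventually_elim (auto simp: h_def)
qed

section \<open>The energy estimate\<close>

lemma integral_exp_interval_le:
  fixes l s T :: real
  assumes "l > 0" "s \<le> T"
  shows "(LINT t|lborel. of_bool (s < t) * (indicat_real {0<..<T} t * exp (- l * t))) \<le> exp (- l * s) / l"
proof -
  have int: "has_bochner_integral lborel (\<lambda>t. indicator {s..T} t *\<^sub>R exp (- l * t)) (- exp (- l * T) / l - - exp (- l * s) / l)"
  proof (rule has_bochner_integral_FTC_Icc)
    show "((\<lambda>t. - exp (- l * t) / l) has_vector_derivative exp (- l * x)) (at x within {s..T})" for x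
      unfolding has_real_derivative_iff_has_vector_derivative[symmetric]
      using assms by (auto intro!: derivative_eq_intros)
  qed (use assms in \<open>auto intro!: continuous_intros\<close>)
  have "(LINT t|lborel. of_bool (s < t) * (indicat_real {0<..<T} t * exp (- l * t))) \<le> (LINT t|lborel. indicator {s..T} t *\<^sub>R exp (- l * t))"
    by (rule integral_mono_AE') (use int in \<open>auto simp: has_bochner_integral_iff indicator_def\<close>)
  also have "\<dots> = - exp (- l * T) / l - - exp (- l * s) / l"
    using int by (simp only: has_bochner_integral_iff)
  also have "\<dots> \<le> exp (- l * s) / l" using assms by simp
  finally show ?thesis .
qed

text \<open>Since \<open>e\<close> is merely integrable and the inequality holds almost everywhere,
  the argument works with a weighted integral over all times instead of pointwise values.\<close>

lemma gronwall_integrable: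
  fixes e :: "real \<Rightarrow> real"
  assumes e: "integrable lborel e" "\<And>t. 0 \<le> e t" "\<And>t. t \<notin> {0<..<T} \<Longrightarrow> e t = 0" and "C \<ge> 0"
    and le: "AE t in lborel. e t \<le> C * (LINT s|lborel. of_bool (s < t) * e s)"
  shows "AE t in lborel. e t = 0"
proof -
  have [measurable]: "e \<in> borel_measurable borel" using e by auto
  \<comment> \<open>With the weight \<open>e\<^sup>-\<^sup>l\<^sup>t\<close> the hypothesis reads \<open>I \<le> (C/l) I\<close>, so \<open>l > C\<close> forces \<open>I = 0\<close>.\<close>
  define l where "l = 2 * C + 1"
  have l: "l > 0" "C / l < 1" using \<open>C \<ge> 0\<close> by (auto simp: l_def)
  define k where "k t = indicat_real {0<..<T} t * exp (- l * t)" for t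
  have [measurable]: "k \<in> borel_measurable borel" unfolding k_def by measurable
  have k: "0 \<le> k t" "k t \<le> 1" for t
    using l by (auto simp: k_def indicator_def)
  have ki: "integrable lborel k"
  proof (rule Bochner_Integration.integrable_bound[of _ "indicat_real {0<..<T}"])
    show "AE t in lborel. norm (k t) \<le> norm (indicat_real {0<..<T} t)"
      using l by (auto simp: k_def indicator_def)
  qed (auto intro!: integrable_real_indicator emeasure_bounded_finite)
  have kei: "integrable lborel (\<lambda>t. k t * e t)"
    by (rule Bochner_Integration.integrable_bound[OF e(1)]) (use k in \<open>auto simp: abs_mult intro!: mult_left_le_one_le\<close>)
  define I where "I = (LINT t|lborel. k t * e t)"
  have tri: "integrable (lborel \<Otimes>\<^sub>M lborel) (\<lambda>(s, t). of_bool (s < t) * (e s * k t))"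
    by (rule integrable_triangle[OF e(1) ki])
  have "I \<le> (LINT t|lborel. C * (LINT s|lborel. of_bool (s < t) * (e s * k t)))"
    unfolding I_def
  proof (rule integral_mono_AE[OF kei])
    show "integrable lborel (\<lambda>t. C * (LINT s|lborel. of_bool (s < t) * (e s * k t)))"
      using lborel_pair.integrable_snd[OF tri] by simp
    show "AE t in lborel. k t * e t \<le> C * (LINT s|lborel. of_bool (s < t) * (e s * k t))"
      using le
    proof eventually_elim
      case (elim t)
      have "k t * e t \<le> k t * (C * (LINT s|lborel. of_bool (s < t) * e s))"
        using elim k by (intro mult_left_mono)
      also have "\<dots> = C * (LINT s|lborel. k t * (of_bool (s < t) * e s))" by simp
      also have "\<dots> = C * (LINT s|lborel. of_bool (s < t) * (e s * k t))"
        by (simp only: mult_ac)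
      finally show ?case .
    qed
  qed
  also have "\<dots> = C * (LINT t|lborel. LINT s|lborel. of_bool (s < t) * (e s * k t))" by simp
  also have "\<dots> = C * (LINT s|lborel. LINT t|lborel. of_bool (s < t) * (e s * k t))"
    by (simp only: lborel_pair.Fubini_integral[OF tri])
  also have "\<dots> = C * (LINT s|lborel. e s * (LINT t|lborel. of_bool (s < t) * k t))"
    by (simp only: mult.left_commute integral_mult_right_zero)
  also have "(LINT s|lborel. e s * (LINT t|lborel. of_bool (s < t) * k t)) \<le> (LINT s|lborel. k s * e s / l)"
  proof (rule integral_mono)
    show "integrable lborel (\<lambda>s. e s * (LINT t|lborel. of_bool (s < t) * k t))"
      using lborel_pair.integrable_fst'[OF tri] by (simp add: mult.left_commute flip: integral_mult_right_zero)
    show "e s * (LINT t|lborel. of_bool (s < t) * k t) \<le> k s * e s / l" for s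
    proof (cases "s \<in> {0<..<T}")
      case True
      then have "(LINT t|lborel. of_bool (s < t) * k t) \<le> exp (- l * s) / l"
        unfolding k_def using l by (intro integral_exp_interval_le) auto
      with True show ?thesis
        using mult_left_mono[OF _ e(2)[of s]] by (fastforce simp: k_def mult.commute)
    qed (use e(3) in auto)
  qed (use kei in simp)
  also have "(LINT s|lborel. k s * e s / l) = I / l" by (simp add: I_def)
  finally have "I \<le> (C / l) * I" using \<open>C \<ge> 0\<close> by (simp add: mult_left_mono)
  moreover have "0 \<le> I" unfolding I_def using k e by simp
  ultimately have "I = 0" using l(2) mult_strict_right_mono[of "C / l" 1 I] by (cases "I = 0") auto
  then have "AE t in lborel. k t * e t = 0"
    unfolding I_def using integral_nonneg_eq_0_iff_AE[OF kei] k e by simp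
  then show ?thesis
    by eventually_elim (use e(3) in \<open>auto simp: k_def indicator_def split: if_splits\<close>)
qed

section \<open>Estimates at a single frequency and at a single time\<close>

lemma norm_symbol_sum_le:
  fixes V :: "'a::euclidean_space \<Rightarrow> complex"
  shows "cmod (\<Sum>b\<in>Basis. complex_of_real (\<xi> \<bullet> b) * V b) \<le> norm \<xi> * sqrt (\<Sum>b\<in>Basis. (cmod (V b))\<^sup>2)"
proof -
  have "cmod (\<Sum>b\<in>Basis. complex_of_real (\<xi> \<bullet> b) * V b) \<le> (\<Sum>b\<in>Basis. \<bar>\<xi> \<bullet> b\<bar> * \<bar>cmod (V b)\<bar>)"
    by (rule order_trans[OF norm_sum]) (simp add: norm_mult)
  also have "\<dots> \<le> L2_set (\<lambda>b. \<xi> \<bullet> b) Basis * L2_set (\<lambda>b. cmod (V b)) Basis"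
    by (rule L2_set_mult_ineq)
  also have "L2_set (\<lambda>b. \<xi> \<bullet> b) Basis = norm \<xi>"
    by (simp add: L2_set_def norm_sum_Basis_square)
  finally show ?thesis by (simp add: L2_set_def)
qed

lemma young_inequality:
  fixes a b l :: real
  assumes "l > 0"
  shows "a * b \<le> b\<^sup>2 / (2 * l) + l / 2 * a\<^sup>2"
proof -
  have "0 \<le> (b - l * a)\<^sup>2" by simp
  then show ?thesis using assms by (simp add: field_simps power2_eq_square)
qed

text \<open>The transform of \<open>\<Delta>w - div G\<close> at frequency \<open>\<xi>\<close>, where \<open>B\<close> and \<open>V b\<close> are the transforms of
  \<open>w\<close> and of the components of \<open>G\<close>.\<close>

definition evolution_symbol :: "'a::euclidean_space \<Rightarrow> complex \<Rightarrow> ('a \<Rightarrow> complex) \<Rightarrow> complex" where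
  "evolution_symbol \<xi> B V = - complex_of_real ((norm \<xi>)\<^sup>2) * B - \<i> * (\<Sum>b\<in>Basis. complex_of_real (\<xi> \<bullet> b) * V b)"

text \<open>Dividing by \<open>q\<close> realises the inverse of 1 - Laplacian. As |xi|^2/q = 1 -
  1/q, diffusion yields the good term -Re(A conj(B)) and a remainder with factor 1/q, while the
  drift carries |xi|/q. Young's inequality moves A in both remainders into the energy density
  |A|^2/q. Its weights 1/(2L) and 1/(2 L \<kappa>^2) are chosen so that, after integration, the B
  and V terms are covered by the good term. The crude bound \<open>abs_symbol_le\<close> provides
  integrability.\<close>

lemma
  fixes A B :: complex and V :: "'a::euclidean_space \<Rightarrow> complex" and \<xi> :: 'a
  defines "S \<equiv> \<Sum>b\<in>Basis. (cmod (V b))\<^sup>2" and "q \<equiv> 1 + (norm \<xi>)\<^sup>2"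
    and "R \<equiv> Re (A * cnj (evolution_symbol \<xi> B V))"
  shows abs_symbol_le: "\<bar>R / q\<bar> \<le> 2 * ((cmod A)\<^sup>2 + (cmod B)\<^sup>2 + S)"
    and symbol_le: "L > 0 \<Longrightarrow> \<kappa> > 0 \<Longrightarrow> R / q \<le> - Re (A * cnj B) + (cmod B)\<^sup>2 / (2 * L) + S / (2 * (L * \<kappa>\<^sup>2))
      + (L / 2 + L * \<kappa>\<^sup>2 / 2) * ((cmod A)\<^sup>2 / q)"
proof -
  define X where "X = (\<Sum>b\<in>Basis. complex_of_real (\<xi> \<bullet> b) * V b)"
  define Y where "Y = Re (A * cnj (\<i> * X))"
  have S: "S \<ge> 0" by (simp add: S_def sum_nonneg)
  have q: "q \<ge> 1" "(norm \<xi>)\<^sup>2 \<le> q" "norm \<xi> \<le> q"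
  proof -
    show "q \<ge> 1" "(norm \<xi>)\<^sup>2 \<le> q" by (auto simp: q_def)
    show "norm \<xi> \<le> q" using zero_le_power2[of "norm \<xi> - 1"] by (simp add: q_def power2_diff)
      (smt (verit) norm_ge_zero)
  qed
  have R: "R = - (norm \<xi>)\<^sup>2 * Re (A * cnj B) - Y"
    unfolding R_def Y_def X_def evolution_symbol_def by (simp add: algebra_simps)
  have Y: "\<bar>Y\<bar> \<le> cmod A * (norm \<xi> * sqrt S)"
  proof -
    have "\<bar>Y\<bar> \<le> cmod A * cmod X"
      unfolding Y_def by (rule order_trans[OF abs_Re_le_cmod]) (simp add: norm_mult)
    then show ?thesis
      using norm_symbol_sum_le[of \<xi> V] mult_left_mono[of "cmod X" "norm \<xi> * sqrt S" "cmod A"]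
      unfolding X_def S_def by simp
  qed
  have AB: "\<bar>Re (A * cnj B)\<bar> \<le> cmod A * cmod B"
    by (rule order_trans[OF abs_Re_le_cmod]) (simp add: norm_mult)
  show "\<bar>R / q\<bar> \<le> 2 * ((cmod A)\<^sup>2 + (cmod B)\<^sup>2 + S)"
  proof -
    have "\<bar>R\<bar> \<le> (norm \<xi>)\<^sup>2 * \<bar>Re (A * cnj B)\<bar> + \<bar>Y\<bar>"
      unfolding R by (rule order_trans[OF abs_triangle_ineq4]) (simp add: abs_mult)
    also have "\<dots> \<le> q * (cmod A * cmod B) + q * (cmod A * sqrt S)"
    proof (rule add_mono)
      show "(norm \<xi>)\<^sup>2 * \<bar>Re (A * cnj B)\<bar> \<le> q * (cmod A * cmod B)"
        using q AB by (intro mult_mono) auto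
      have "norm \<xi> * (cmod A * sqrt S) \<le> q * (cmod A * sqrt S)"
        using q S by (intro mult_right_mono) auto
      with Y show "\<bar>Y\<bar> \<le> q * (cmod A * sqrt S)" by (simp add: mult_ac)
    qed
    finally have "\<bar>R\<bar> / q \<le> cmod A * cmod B + cmod A * sqrt S"
      using q by (simp add: field_simps)
    also have "\<dots> \<le> ((cmod B)\<^sup>2 / 2 + (cmod A)\<^sup>2 / 2) + ((sqrt S)\<^sup>2 / 2 + (cmod A)\<^sup>2 / 2)"
      using young_inequality[of 1 "cmod A" "cmod B"] young_inequality[of 1 "cmod A" "sqrt S"] by simp
    also have "\<dots> \<le> 2 * ((cmod A)\<^sup>2 + (cmod B)\<^sup>2 + S)"
    proof -
      have "x / 2 + y / 2 + (s / 2 + y / 2) \<le> 2 * (y + x + s)" if "0 \<le> x" "0 \<le> y" "0 \<le> s" for x y s :: real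
        using that by simp
      from this[OF zero_le_power2 zero_le_power2 S] show ?thesis
        unfolding real_sqrt_pow2[OF S] .
    qed
    finally show ?thesis using q by (simp add: abs_divide)
  qed
  show "R / q \<le> - Re (A * cnj B) + (cmod B)\<^sup>2 / (2 * L) + S / (2 * (L * \<kappa>\<^sup>2))
      + (L / 2 + L * \<kappa>\<^sup>2 / 2) * ((cmod A)\<^sup>2 / q)" if L: "L > 0" and \<kappa>: "\<kappa> > 0"
  proof -
    have eq: "R / q = - Re (A * cnj B) + Re (A * cnj B) / q - Y / q"
    proof -
      have "(- (q - 1) * r - y) / q = - r + r / q - y / q" for r y
        using q by (simp add: field_simps)
      from this[of "Re (A * cnj B)" Y] show ?thesis unfolding R by (simp only: q_def) simp
    qed
    have qq: "(cmod A / q)\<^sup>2 \<le> (cmod A)\<^sup>2 / q"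
    proof -
      have "(cmod A)\<^sup>2 / (q * q) \<le> (cmod A)\<^sup>2 / q"
        using q by (intro divide_left_mono) auto
      then show ?thesis by (simp add: power_divide power2_eq_square[of q])
    qed
    \<comment> \<open>One power of \<open>q\<close> absorbs |xi|^2, so a first order drift costs no
      more than the energy density.\<close>
    have nq: "(cmod A * norm \<xi> / q)\<^sup>2 \<le> (cmod A)\<^sup>2 / q"
    proof -
      have "(cmod A)\<^sup>2 * (norm \<xi>)\<^sup>2 / (q * q) \<le> (cmod A)\<^sup>2 * q / (q * q)"
        using q by (intro divide_right_mono mult_left_mono) auto
      then show ?thesis using q by (simp add: power_divide power_mult_distrib power2_eq_square[of q])
    qed
    have "Re (A * cnj B) / q \<le> cmod A / q * cmod B"
      using AB q by (simp add: divide_right_mono)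
    also have "\<dots> \<le> (cmod B)\<^sup>2 / (2 * L) + L / 2 * (cmod A / q)\<^sup>2"
      by (rule young_inequality[OF L])
    also have "\<dots> \<le> (cmod B)\<^sup>2 / (2 * L) + L / 2 * ((cmod A)\<^sup>2 / q)"
      using qq L by (intro add_left_mono mult_left_mono) auto
    finally have 1: "Re (A * cnj B) / q \<le> \<dots>" .
    have "- Y / q \<le> cmod A * norm \<xi> / q * sqrt S"
    proof -
      have "- Y \<le> cmod A * norm \<xi> * sqrt S" using Y by (simp add: mult.assoc)
      from divide_right_mono[OF this, of q] q show ?thesis by simp
    qed
    also have "\<dots> \<le> (sqrt S)\<^sup>2 / (2 * (L * \<kappa>\<^sup>2)) + (L * \<kappa>\<^sup>2) / 2 * (cmod A * norm \<xi> / q)\<^sup>2"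
      using L \<kappa> by (intro young_inequality) auto
    also have "\<dots> \<le> (sqrt S)\<^sup>2 / (2 * (L * \<kappa>\<^sup>2)) + (L * \<kappa>\<^sup>2) / 2 * ((cmod A)\<^sup>2 / q)"
      using nq L \<kappa> by (intro add_left_mono mult_left_mono) auto
    finally have 2: "- Y / q \<le> S / (2 * (L * \<kappa>\<^sup>2)) + (L * \<kappa>\<^sup>2) / 2 * ((cmod A)\<^sup>2 / q)"
      using S by simp
    show ?thesis unfolding eq using 1 2 by (simp add: algebra_simps)
  qed
qed

definition slice_symbol :: "('a::euclidean_space \<Rightarrow> real) \<Rightarrow> ('a \<Rightarrow> 'a) \<Rightarrow> 'a \<Rightarrow> complex" where
  "slice_symbol g H \<xi> = evolution_symbol \<xi> (fourier g \<xi>) (\<lambda>b. fourier (\<lambda>x. H x \<bullet> b) \<xi>)"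

lemma slice_symbol_measurable [measurable]:
  assumes [measurable]: "g \<in> borel_measurable borel" "H \<in> borel_measurable borel"
  shows "slice_symbol g H \<in> borel_measurable borel"
  unfolding slice_symbol_def[abs_def] evolution_symbol_def by measurable

lemma energy_density_le: "\<bar>(cmod A)\<^sup>2 / (1 + (norm \<xi>)\<^sup>2)\<bar> \<le> (cmod A)\<^sup>2"
proof -
  have "(cmod A)\<^sup>2 / (1 + (norm \<xi>)\<^sup>2) \<le> (cmod A)\<^sup>2 / 1"
    by (intro divide_left_mono) (auto intro: add_pos_nonneg)
  then show ?thesis by simp
qed

lemma energy_density_integrable:
  fixes f :: "'a::euclidean_space \<Rightarrow> real"
  assumes f: "integrable lborel f" "\<And>x. \<bar>f x\<bar> \<le> M"
  shows "integrable lborel (\<lambda>\<xi>. (cmod (fourier f \<xi>))\<^sup>2 / (1 + (norm \<xi>)\<^sup>2))"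
proof (rule Bochner_Integration.integrable_bound[OF fourier_square_integrable[OF f]])
  have [measurable]: "f \<in> borel_measurable borel" using f by auto
  show "(\<lambda>\<xi>. (cmod (fourier f \<xi>))\<^sup>2 / (1 + (norm \<xi>)\<^sup>2)) \<in> borel_measurable lborel"
    by measurable
qed (use energy_density_le in auto)

text \<open>\<open>R\<close> is half the time derivative of the energy density at a frequency.
  Plancherel's theorem carries the pointwise relations among f, g and H over to the frequencies. The
  L^1 bound on \<open>R\<close> in terms of L^2 norms is what later makes the rate integrable
  jointly in time and frequency.\<close>

proposition
  fixes f g :: "'a::euclidean_space \<Rightarrow> real" and H :: "'a \<Rightarrow> 'a"
  assumes f: "integrable lborel f" "\<And>x. \<bar>f x\<bar> \<le> M" and g: "integrable lborel g" "\<And>x. \<bar>g x\<bar> \<le> M"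
    and H [measurable]: "H \<in> borel_measurable borel" and HM: "\<And>x. norm (H x) \<le> \<kappa> * \<bar>g x\<bar>" and \<kappa>: "\<kappa> > 0"
    and L: "L > 0" "\<And>x. (g x)\<^sup>2 \<le> L * (f x * g x)"
  defines "R \<equiv> \<lambda>\<xi>. Re (fourier f \<xi> * cnj (slice_symbol g H \<xi>)) / (1 + (norm \<xi>)\<^sup>2)"
  shows energy_rate_integrable: "integrable lborel R" (is ?A)
    and energy_rate_norm_le: "(LINT \<xi>|lborel. norm (R \<xi>)) \<le> 2 * (2 * pi) ^ DIM('a) *
      ((LINT x|lborel. (f x)\<^sup>2) + (LINT x|lborel. (g x)\<^sup>2) + (LINT x|lborel. (norm (H x))\<^sup>2))" (is ?B)
    and energy_rate_le: "(LINT \<xi>|lborel. R \<xi>) \<le>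
      (L / 2 + L * \<kappa>\<^sup>2 / 2) * (LINT \<xi>|lborel. (cmod (fourier f \<xi>))\<^sup>2 / (1 + (norm \<xi>)\<^sup>2))" (is ?C)
proof -
  have [measurable]: "f \<in> borel_measurable borel" "g \<in> borel_measurable borel" using f g by auto
  define c where "c = (2 * pi) ^ DIM('a)"
  have c: "c > 0" by (simp add: c_def)
  define S where "S \<xi> = (\<Sum>b\<in>Basis. (cmod (fourier (\<lambda>x. H x \<bullet> b) \<xi>))\<^sup>2)" for \<xi>
  have Hb: "integrable lborel (\<lambda>x. H x \<bullet> b)" "\<bar>H x \<bullet> b\<bar> \<le> \<kappa> * M" if "b \<in> Basis" for b x
  proof -
    have le: "\<bar>H x \<bullet> b\<bar> \<le> \<kappa> * \<bar>g x\<bar>" for x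
      using Basis_le_norm[OF that, of "H x"] HM[of x] by linarith
    show "integrable lborel (\<lambda>x. H x \<bullet> b)"
      by (rule Bochner_Integration.integrable_bound[OF integrable_mult_right[OF g(1), of \<kappa>]])
        (use le \<kappa> in \<open>auto simp: abs_mult\<close>)
    show "\<bar>H x \<bullet> b\<bar> \<le> \<kappa> * M"
      using le[of x] mult_left_mono[OF g(2)[of x], of \<kappa>] \<kappa> by linarith
  qed
  have g2: "integrable lborel (\<lambda>x. (g x)\<^sup>2)" and f2: "integrable lborel (\<lambda>x. (f x)\<^sup>2)"
    and fg: "integrable lborel (\<lambda>x. f x * g x)"
    using integrable_mult_bounded[OF g(1) _ g(2)] integrable_mult_bounded[OF f(1) _ f(2)]
      integrable_mult_bounded[OF f(1) _ g(2)] by (auto simp: power2_eq_square)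
  have Hb2: "integrable lborel (\<lambda>x. (H x \<bullet> b)\<^sup>2)" if "b \<in> Basis" for b
    using integrable_mult_bounded[OF Hb(1)[OF that] _ Hb(2)[OF that]] by (auto simp: power2_eq_square)
  have Sint: "has_bochner_integral lborel S (c * (LINT x|lborel. (norm (H x))\<^sup>2))"
  proof -
    have "has_bochner_integral lborel S (\<Sum>b\<in>Basis. c * (LINT x|lborel. (H x \<bullet> b)\<^sup>2))"
      unfolding S_def c_def
      by (intro has_bochner_integral_sum)
        (simp add: has_bochner_integral_iff fourier_square_integrable[OF Hb] plancherel[OF Hb])
    also have "(\<Sum>b\<in>Basis. c * (LINT x|lborel. (H x \<bullet> b)\<^sup>2)) = c * (LINT x|lborel. (norm (H x))\<^sup>2)"
      unfolding norm_sum_Basis_square[symmetric]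
      by (subst Bochner_Integration.integral_sum) (auto simp: Hb2 sum_distrib_left)
    finally show ?thesis .
  qed
  then have Si: "integrable lborel S" and Sv: "(LINT \<xi>|lborel. S \<xi>) = c * (LINT x|lborel. (norm (H x))\<^sup>2)"
    by (auto simp: has_bochner_integral_iff)
  note fi = fourier_square_integrable[OF f] and gi = fourier_square_integrable[OF g]
  note pl = plancherel[OF f, folded c_def] plancherel[OF g, folded c_def]
  have [measurable]: "R \<in> borel_measurable borel" unfolding R_def by measurable
  have bound: "\<bar>R \<xi>\<bar> \<le> 2 * ((cmod (fourier f \<xi>))\<^sup>2 + (cmod (fourier g \<xi>))\<^sup>2 + S \<xi>)" for \<xi>
    unfolding R_def S_def slice_symbol_def by (rule abs_symbol_le)
  have bi: "integrable lborel (\<lambda>\<xi>. 2 * ((cmod (fourier f \<xi>))\<^sup>2 + (cmod (fourier g \<xi>))\<^sup>2 + S \<xi>))"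
    using fi gi Si by (intro integrable_mult_right Bochner_Integration.integrable_add)
  show A: ?A
    by (rule Bochner_Integration.integrable_bound[OF bi])
      (use order_trans[OF bound abs_ge_self] in auto)
  have "(LINT \<xi>|lborel. norm (R \<xi>)) \<le> (LINT \<xi>|lborel. 2 * ((cmod (fourier f \<xi>))\<^sup>2 + (cmod (fourier g \<xi>))\<^sup>2 + S \<xi>))"
    by (rule integral_mono[OF integrable_norm[OF A] bi]) (use bound in simp)
  also have "\<dots> = 2 * (c * (LINT x|lborel. (f x)\<^sup>2) + c * (LINT x|lborel. (g x)\<^sup>2) + c * (LINT x|lborel. (norm (H x))\<^sup>2))"
    using fi gi Si by (simp add: pl Sv)
  finally show ?B unfolding c_def by (simp add: algebra_simps)
  define E where "E \<xi> = (cmod (fourier f \<xi>))\<^sup>2 / (1 + (norm \<xi>)\<^sup>2)" for \<xi>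
  have Ei: "integrable lborel E"
    unfolding E_def by (rule energy_density_integrable[OF f])
  define P where "P \<xi> = Re (fourier f \<xi> * cnj (fourier g \<xi>))" for \<xi>
  let ?U = "\<lambda>\<xi>. - P \<xi> + (cmod (fourier g \<xi>))\<^sup>2 / (2 * L) + S \<xi> / (2 * (L * \<kappa>\<^sup>2))
      + (L / 2 + L * \<kappa>\<^sup>2 / 2) * E \<xi>"
  note Pi = parseval_integrable[OF f g, folded P_def] and Pv = parseval[OF f g, folded c_def P_def]
  have "(LINT \<xi>|lborel. R \<xi>) \<le> (LINT \<xi>|lborel. ?U \<xi>)"
  proof (rule integral_mono[OF A])
    show "integrable lborel ?U"
      using Pi gi Si Ei by (intro Bochner_Integration.integrable_add integrable_mult_right
          Bochner_Integration.integrable_minus integrable_divide) 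
    show "R \<xi> \<le> ?U \<xi>" for \<xi>
      unfolding R_def S_def P_def E_def slice_symbol_def by (rule symbol_le[OF L(1) \<kappa>])
  qed
  also have "\<dots> = - (c * (LINT x|lborel. f x * g x)) + c * (LINT x|lborel. (g x)\<^sup>2) / (2 * L) + c * (LINT x|lborel. (norm (H x))\<^sup>2) / (2 * (L * \<kappa>\<^sup>2))
      + (L / 2 + L * \<kappa>\<^sup>2 / 2) * (LINT \<xi>|lborel. E \<xi>)"
    using Pi gi Si Ei by (simp add: pl Pv Sv)
  also have "\<dots> \<le> (L / 2 + L * \<kappa>\<^sup>2 / 2) * (LINT \<xi>|lborel. E \<xi>)"
  proof -
    have 1: "(LINT x|lborel. (g x)\<^sup>2) \<le> L * (LINT x|lborel. f x * g x)"
      unfolding integral_mult_right_zero[symmetric]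
      using g2 fg L by (intro integral_mono) auto
    have "(LINT x|lborel. (norm (H x))\<^sup>2) \<le> (LINT x|lborel. \<kappa>\<^sup>2 * (g x)\<^sup>2)"
    proof (rule integral_mono_AE')
      show "AE x in lborel. (norm (H x))\<^sup>2 \<le> \<kappa>\<^sup>2 * (g x)\<^sup>2"
        using power_mono[OF HM norm_ge_zero, where n=2] by (auto simp: power_mult_distrib)
    qed (use g2 in auto)
    then have 2: "(LINT x|lborel. (norm (H x))\<^sup>2) \<le> \<kappa>\<^sup>2 * (LINT x|lborel. (g x)\<^sup>2)" by simp
    have "c * (LINT x|lborel. (norm (H x))\<^sup>2) / (2 * (L * \<kappa>\<^sup>2)) \<le> c * (\<kappa>\<^sup>2 * (LINT x|lborel. (g x)\<^sup>2)) / (2 * (L * \<kappa>\<^sup>2))"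
      using c L \<kappa> 2 by (intro divide_right_mono mult_left_mono) auto
    also have "\<dots> = c * (LINT x|lborel. (g x)\<^sup>2) / (2 * L)" using \<kappa> by simp
    finally have "c * (LINT x|lborel. (norm (H x))\<^sup>2) / (2 * (L * \<kappa>\<^sup>2)) \<le> c * (LINT x|lborel. (g x)\<^sup>2) / (2 * L)" .
    then have "c * (LINT x|lborel. (g x)\<^sup>2) / (2 * L) + c * (LINT x|lborel. (norm (H x))\<^sup>2) / (2 * (L * \<kappa>\<^sup>2)) \<le>
      c * (LINT x|lborel. (g x)\<^sup>2) / (2 * L) + c * (LINT x|lborel. (g x)\<^sup>2) / (2 * L)"
      by (rule add_left_mono)
    also have "\<dots> = c * (LINT x|lborel. (g x)\<^sup>2) / L"
      by (simp flip: add_divide_distrib)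
    \<comment> \<open>The g and H terms, each at most half of this bound, add up to no more than the
      good term: this is \<open>L(2)\<close> in integrated form.\<close>
    also have "\<dots> \<le> c * (LINT x|lborel. f x * g x)"
      using mult_left_mono[OF 1, of c] c L by (simp add: field_simps)
    finally show ?thesis by simp
  qed
  finally show ?C unfolding E_def .
qed

section \<open>Time slices and the uniqueness argument on the frequency side\<close>

lemma fourier_slice_measurable [measurable]:
  fixes f :: "real \<times> 'a::euclidean_space \<Rightarrow> real"
  assumes [measurable]: "f \<in> borel_measurable borel"
  shows "(\<lambda>p. fourier (\<lambda>x. f (fst p, x)) (snd p)) \<in> borel_measurable (borel \<Otimes>\<^sub>M borel)"
proof -
  have [measurable]: "f \<in> borel_measurable (borel \<Otimes>\<^sub>M borel)" by (simp add: borel_prod)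
  show ?thesis unfolding fourier_def by measurable
qed

lemma slice_symbol_slice_measurable [measurable]:
  fixes g :: "real \<times> 'a::euclidean_space \<Rightarrow> real" and H :: "real \<times> 'a \<Rightarrow> 'a"
  assumes [measurable]: "g \<in> borel_measurable borel" "H \<in> borel_measurable borel"
  shows "(\<lambda>p. slice_symbol (\<lambda>x. g (fst p, x)) (\<lambda>x. H (fst p, x)) (snd p)) \<in> borel_measurable (borel \<Otimes>\<^sub>M borel)"
proof -
  have [measurable]: "(\<lambda>p. fourier (\<lambda>x. H (fst p, x) \<bullet> b) (snd p)) \<in> borel_measurable (borel \<Otimes>\<^sub>M borel)" for b
    using fourier_slice_measurable[of "\<lambda>p. H p \<bullet> b"] by simp
  show ?thesis unfolding slice_symbol_def evolution_symbol_def by measurable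
qed

text \<open>At every frequency the transform is bounded by the L^1 norm of the slice, which is
  integrable in time by Fubini.\<close>

lemma fourier_slice_integrable:
  fixes f :: "real \<times> 'a::euclidean_space \<Rightarrow> real"
  assumes f: "integrable lborel f"
  shows "integrable lborel (\<lambda>t. fourier (\<lambda>x. f (t, x)) \<xi>)"
proof (rule Bochner_Integration.integrable_bound)
  have [measurable]: "f \<in> borel_measurable borel" using f by auto
  have "integrable (lborel \<Otimes>\<^sub>M lborel) (\<lambda>p. \<bar>f p\<bar>)"
    using f by (simp add: lborel_prod)
  from lborel_pair.integrable_fst'[OF this]
  show "integrable lborel (\<lambda>t. LINT x|lborel. \<bar>f (t, x)\<bar>)" .
  show "AE t in lborel. cmod (fourier (\<lambda>x. f (t, x)) \<xi>) \<le> norm (LINT x|lborel. \<bar>f (t, x)\<bar>)"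
    using norm_fourier_le by (auto intro!: AE_I2 order_trans[OF norm_fourier_le])
  have "(\<lambda>t. fourier (\<lambda>x. f (fst (t, \<xi>), x)) (snd (t, \<xi>))) \<in> borel_measurable borel"
    by (rule measurable_compose[OF _ fourier_slice_measurable]) auto
  then show "(\<lambda>t. fourier (\<lambda>x. f (t, x)) \<xi>) \<in> borel_measurable lborel" by simp
qed

lemma slice_symbol_slice_integrable:
  fixes g :: "real \<times> 'a::euclidean_space \<Rightarrow> real" and H :: "real \<times> 'a \<Rightarrow> 'a"
  assumes g: "integrable lborel g" and H: "integrable lborel H"
  shows "integrable lborel (\<lambda>t. slice_symbol (\<lambda>x. g (t, x)) (\<lambda>x. H (t, x)) \<xi>)"
  unfolding slice_symbol_def evolution_symbol_def
  by (intro Bochner_Integration.integrable_diff integrable_mult_right Bochner_Integration.integrable_sum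
      fourier_slice_integrable g fourier_slice_integrable[of "\<lambda>p. H p \<bullet> _"] integrable_inner_left H)

lemma AE_slice_integrable:
  fixes f :: "real \<times> 'a::euclidean_space \<Rightarrow> real"
  assumes "integrable lborel f"
  shows "AE t in lborel. integrable lborel (\<lambda>x. f (t, x))"
  using lborel_pair.AE_integrable_fst'[of f] assms by (simp add: lborel_prod)

text \<open>At each frequency \<open>norm_primitive_square\<close> expresses the squared transform
  through earlier times. Dividing by 1 + |xi|^2, integrating over the frequencies and exchanging
  integrals bounds the energy by 2C times its own time integral, the 2 coming from differentiating a
  square. Once the energy vanishes for almost every t, so does the transform, and Plancherel's
  theorem returns to z.\<close>

theorem fourier_evolution_uniqueness:
  fixes z w :: "real \<times> 'a::euclidean_space \<Rightarrow> real" and G :: "real \<times> 'a \<Rightarrow> 'a"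
  assumes z: "integrable lborel z" "\<And>p. \<bar>z p\<bar> \<le> M" and w: "integrable lborel w" "\<And>p. \<bar>w p\<bar> \<le> M"
    and G: "G \<in> borel_measurable borel" "\<And>p. norm (G p) \<le> \<kappa> * \<bar>w p\<bar>" and \<kappa>: "\<kappa> > 0"
    and L: "L > 0" "\<And>p. (w p)\<^sup>2 \<le> L * (z p * w p)"
    and zero: "\<And>t x. t \<notin> {0<..<T} \<Longrightarrow> z (t, x) = 0"
    and ode: "\<And>\<xi>. AE t in lborel. t \<in> {0<..<T} \<longrightarrow>
      fourier (\<lambda>x. z (t, x)) \<xi> = primitive (\<lambda>s. slice_symbol (\<lambda>x. w (s, x)) (\<lambda>x. G (s, x)) \<xi>) t"
  shows "AE p in lborel. z p = 0"
proof -
  have [measurable]: "z \<in> borel_measurable borel" "w \<in> borel_measurable borel" "G \<in> borel_measurable borel"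
    using z w G by auto
  have [measurable]: "z \<in> borel_measurable (borel \<Otimes>\<^sub>M borel)" "w \<in> borel_measurable (borel \<Otimes>\<^sub>M borel)"
    "G \<in> borel_measurable (borel \<Otimes>\<^sub>M borel)"
    by (simp_all add: borel_prod)
  have Gi: "integrable lborel G"
    by (rule Bochner_Integration.integrable_bound[OF integrable_mult_right[OF w(1), of \<kappa>]])
      (use G \<kappa> in \<open>auto simp: abs_mult\<close>)
  define c where "c = (2 * pi) ^ DIM('a)"
  define C where "C = L / 2 + L * \<kappa>\<^sup>2 / 2"
  have C: "C \<ge> 0" using L by (simp add: C_def)
  define Z where "Z t \<xi> = fourier (\<lambda>x. z (t, x)) \<xi>" for t \<xi>
  define S where "S t \<xi> = slice_symbol (\<lambda>x. w (t, x)) (\<lambda>x. G (t, x)) \<xi>" for t \<xi>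
  define K where "K t \<xi> = Re (Z t \<xi> * cnj (S t \<xi>)) / (1 + (norm \<xi>)\<^sup>2)" for t \<xi>
  define D where "D t \<xi> = (cmod (Z t \<xi>))\<^sup>2 / (1 + (norm \<xi>)\<^sup>2)" for t \<xi>
  have [measurable]: "case_prod Z \<in> borel_measurable (borel \<Otimes>\<^sub>M borel)"
    unfolding Z_def case_prod_beta by measurable
  have [measurable]: "case_prod S \<in> borel_measurable (borel \<Otimes>\<^sub>M borel)"
    unfolding S_def case_prod_beta by measurable
  have [measurable]: "case_prod K \<in> borel_measurable (borel \<Otimes>\<^sub>M borel)"
    unfolding K_def by measurable
  have [measurable]: "case_prod D \<in> borel_measurable (borel \<Otimes>\<^sub>M borel)"
    unfolding D_def by measurable
  have sl: "AE t in lborel. integrable lborel (\<lambda>x. z (t, x)) \<and> integrable lborel (\<lambda>x. w (t, x))"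
    using AE_slice_integrable[OF z(1)] AE_slice_integrable[OF w(1)] by eventually_elim simp
  have sq: "integrable (lborel \<Otimes>\<^sub>M lborel) (\<lambda>p. (z p)\<^sup>2)" "integrable (lborel \<Otimes>\<^sub>M lborel) (\<lambda>p. (w p)\<^sup>2)"
    using integrable_mult_bounded[OF z(1) _ z(2)] integrable_mult_bounded[OF w(1) _ w(2)]
    by (simp_all add: power2_eq_square lborel_prod)
  have G2: "(norm (G p))\<^sup>2 \<le> \<kappa>\<^sup>2 * (w p)\<^sup>2" for p
    using power_mono[OF G(2) norm_ge_zero, where n=2] by (simp add: power_mult_distrib)
  have sqG: "integrable (lborel \<Otimes>\<^sub>M lborel) (\<lambda>p. (norm (G p))\<^sup>2)"
    by (rule Bochner_Integration.integrable_bound[OF integrable_mult_right[OF sq(2), of "\<kappa>\<^sup>2"]])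
      (use G2 in auto)
  have rate: "integrable lborel (K t)" "(LINT \<xi>|lborel. norm (K t \<xi>)) \<le> 2 * c *
      ((LINT x|lborel. (z (t, x))\<^sup>2) + (LINT x|lborel. (w (t, x))\<^sup>2) + (LINT x|lborel. (norm (G (t, x)))\<^sup>2))"
    "(LINT \<xi>|lborel. K t \<xi>) \<le> C * (LINT \<xi>|lborel. D t \<xi>)"
    if "integrable lborel (\<lambda>x. z (t, x)) \<and> integrable lborel (\<lambda>x. w (t, x))" for t
  proof -
    from that have zt: "integrable lborel (\<lambda>x. z (t, x))" and wt: "integrable lborel (\<lambda>x. w (t, x))" by auto
    have Gt: "(\<lambda>x. G (t, x)) \<in> borel_measurable borel" by measurable
    note args = zt z(2) wt w(2) Gt G(2) \<kappa> L
    show "integrable lborel (K t)"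
      using energy_rate_integrable[OF args] unfolding K_def Z_def S_def .
    show "(LINT \<xi>|lborel. norm (K t \<xi>)) \<le> 2 * c *
      ((LINT x|lborel. (z (t, x))\<^sup>2) + (LINT x|lborel. (w (t, x))\<^sup>2) + (LINT x|lborel. (norm (G (t, x)))\<^sup>2))"
      using energy_rate_norm_le[OF args] unfolding K_def Z_def S_def c_def .
    show "(LINT \<xi>|lborel. K t \<xi>) \<le> C * (LINT \<xi>|lborel. D t \<xi>)"
      using energy_rate_le[OF args] unfolding K_def D_def Z_def S_def C_def .
  qed
  \<comment> \<open>Joint integrability licenses the later exchange of time and frequency; the slice
    bound \<open>rate(2)\<close> is integrable in t because z, w and G are square
    integrable.\<close>
  have Ki: "integrable (lborel \<Otimes>\<^sub>M lborel) (case_prod K)"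
  proof (rule lborel_pair.Fubini_integrable)
    show "integrable lborel (\<lambda>t. LINT \<xi>|lborel. norm (case_prod K (t, \<xi>)))"
    proof (rule Bochner_Integration.integrable_bound)
      show "integrable lborel (\<lambda>t. 2 * c *
        ((LINT x|lborel. (z (t, x))\<^sup>2) + (LINT x|lborel. (w (t, x))\<^sup>2) + (LINT x|lborel. (norm (G (t, x)))\<^sup>2)))"
        by (intro integrable_mult_right Bochner_Integration.integrable_add lborel_pair.integrable_fst'[OF sq(1)]
            lborel_pair.integrable_fst'[OF sq(2)] lborel_pair.integrable_fst'[OF sqG])
      show "AE t in lborel. norm (LINT \<xi>|lborel. norm (case_prod K (t, \<xi>))) \<le> norm (2 * c *
        ((LINT x|lborel. (z (t, x))\<^sup>2) + (LINT x|lborel. (w (t, x))\<^sup>2) + (LINT x|lborel. (norm (G (t, x)))\<^sup>2)))"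
        using sl by eventually_elim (use rate(2) in \<open>auto intro: order_trans[OF _ abs_ge_self]\<close>)
    qed measurable
    show "AE t in lborel. integrable lborel (\<lambda>\<xi>. case_prod K (t, \<xi>))"
      using sl by eventually_elim (use rate(1) in auto)
  qed measurable
  have Di: "integrable (lborel \<Otimes>\<^sub>M lborel) (case_prod D)"
  proof (rule lborel_pair.Fubini_integrable)
    show "integrable lborel (\<lambda>t. LINT \<xi>|lborel. norm (case_prod D (t, \<xi>)))"
    proof (rule Bochner_Integration.integrable_bound)
      show "integrable lborel (\<lambda>t. c * (LINT x|lborel. (z (t, x))\<^sup>2))"
        by (intro integrable_mult_right lborel_pair.integrable_fst'[OF sq(1)])
      show "AE t in lborel. norm (LINT \<xi>|lborel. norm (case_prod D (t, \<xi>))) \<le> norm (c * (LINT x|lborel. (z (t, x))\<^sup>2))"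
        using sl
      proof eventually_elim
        case (elim t)
        then have zt: "integrable lborel (\<lambda>x. z (t, x))" ..
        have "(LINT \<xi>|lborel. norm (D t \<xi>)) \<le> (LINT \<xi>|lborel. (cmod (Z t \<xi>))\<^sup>2)"
          unfolding D_def Z_def
          by (intro integral_mono integrable_norm energy_density_integrable[OF zt z(2)]
              fourier_square_integrable[OF zt z(2)]) (use energy_density_le in auto)
        also have "\<dots> = c * (LINT x|lborel. (z (t, x))\<^sup>2)"
          unfolding Z_def c_def by (rule plancherel[OF zt z(2)])
        finally show ?case by (auto intro: order_trans[OF _ abs_ge_self])
      qed
    qed measurable
    show "AE t in lborel. integrable lborel (\<lambda>\<xi>. case_prod D (t, \<xi>))"
      using sl by eventually_elim (auto simp: D_def Z_def intro: energy_density_integrable z)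
  qed measurable
  define e where "e t = (LINT \<xi>|lborel. D t \<xi>)" for t
  have Sint: "integrable lborel (\<lambda>s. S s \<xi>)" for \<xi>
    unfolding S_def by (rule slice_symbol_slice_integrable[OF w(1) Gi])
  have Z0: "Z t \<xi> = 0" if "t \<notin> {0<..<T}" for t \<xi>
    unfolding Z_def fourier_def using zero[OF that] by simp
  \<comment> \<open>Where z vanishes, \<open>L(2)\<close> reads w^2 \<le> 0.\<close>
  have w0: "w (t, x) = 0" if "t \<notin> {0<..<T}" for t x
    using L(2)[of "(t, x)"] zero[OF that] by simp
  have S0: "S t \<xi> = 0" if "t \<notin> {0<..<T}" for t \<xi>
  proof -
    have "G (t, x) = 0" for x using G(2)[of "(t, x)"] w0[OF that] by simp
    then show ?thesis
      unfolding S_def slice_symbol_def evolution_symbol_def fourier_def using w0[OF that] by simp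
  qed
  \<comment> \<open>Under the time integral the primitive may be replaced by the transform: they
    agree almost everywhere inside (0,T), and the factor \<open>S s \<xi>\<close> vanishes
    outside.\<close>
  have Zsq: "(cmod (Z t \<xi>))\<^sup>2 = 2 * (LINT s|lborel. of_bool (s < t) * Re (Z s \<xi> * cnj (S s \<xi>)))"
    if "Z t \<xi> = primitive (\<lambda>s. S s \<xi>) t" for t \<xi>
  proof -
    have "(cmod (Z t \<xi>))\<^sup>2 = 2 * (LINT s|lborel. of_bool (s < t) * Re (primitive (\<lambda>s. S s \<xi>) s * cnj (S s \<xi>)))"
      unfolding that by (rule norm_primitive_square[OF Sint])
    also have "(LINT s|lborel. of_bool (s < t) * Re (primitive (\<lambda>s. S s \<xi>) s * cnj (S s \<xi>))) =
      (LINT s|lborel. of_bool (s < t) * Re (Z s \<xi> * cnj (S s \<xi>)))"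
    proof (rule integral_cong_AE)
      show "AE s in lborel. of_bool (s < t) * Re (primitive (\<lambda>s. S s \<xi>) s * cnj (S s \<xi>)) =
        of_bool (s < t) * Re (Z s \<xi> * cnj (S s \<xi>))"
        using ode[of \<xi>] unfolding Z_def[symmetric] S_def[symmetric]
      proof eventually_elim
        case (elim s)
        then show ?case using S0[of s \<xi>] by (cases "s \<in> {0<..<T}") auto
      qed
    qed measurable
    finally show ?thesis .
  qed
  have "AE \<xi> in lborel. AE t in lborel. t \<in> {0<..<T} \<longrightarrow> Z t \<xi> = primitive (\<lambda>s. S s \<xi>) t"
    using ode unfolding Z_def S_def by simp
  \<comment> \<open>The exceptional set of times depends on the frequency. Joint measurability
    allows the two quantifiers to be exchanged, so that one t serves almost all frequencies.\<close>
  then have "AE t in lborel. AE \<xi> in lborel. t \<in> {0<..<T} \<longrightarrow> Z t \<xi> = primitive (\<lambda>s. S s \<xi>) t"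
    unfolding primitive_def by (subst (asm) lborel_pair.AE_commute) measurable
  then have "AE t in lborel. e t \<le> (2 * C) * (LINT s|lborel. of_bool (s < t) * e s)"
  proof eventually_elim
    case (elim t)
    show ?case
    proof (cases "t \<in> {0<..<T}")
      case True
      have tri: "integrable (lborel \<Otimes>\<^sub>M lborel) (\<lambda>(s, \<xi>). of_bool (s < t) * K s \<xi>)"
        using integrable_of_bool_mult[OF Ki, of "\<lambda>p. fst p < t"] by (simp add: case_prod_unfold)
      have "e t = (LINT \<xi>|lborel. 2 * (LINT s|lborel. of_bool (s < t) * K s \<xi>))"
        unfolding e_def
      proof (rule integral_cong_AE)
        show "AE \<xi> in lborel. D t \<xi> = 2 * (LINT s|lborel. of_bool (s < t) * K s \<xi>)"
          using elim
        proof eventually_elim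
          case (elim \<xi>)
          then show ?case unfolding D_def K_def using Zsq[of t \<xi>] True by simp
        qed
      qed measurable
      also have "\<dots> = 2 * (LINT s|lborel. LINT \<xi>|lborel. of_bool (s < t) * K s \<xi>)"
        using lborel_pair.Fubini_integral[OF tri] by simp
      also have "\<dots> = 2 * (LINT s|lborel. of_bool (s < t) * (LINT \<xi>|lborel. K s \<xi>))" by simp
      also have "(LINT s|lborel. of_bool (s < t) * (LINT \<xi>|lborel. K s \<xi>)) \<le> (LINT s|lborel. C * (of_bool (s < t) * e s))"
      proof (rule integral_mono_AE)
        show "integrable lborel (\<lambda>s. of_bool (s < t) * (LINT \<xi>|lborel. K s \<xi>))"
          using lborel_pair.integrable_fst'[OF tri] by simp
        show "integrable lborel (\<lambda>s. C * (of_bool (s < t) * e s))"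
          unfolding e_def using lborel_pair.integrable_fst'[OF Di]
          by (intro integrable_mult_right integrable_of_bool_mult) auto
        show "AE s in lborel. of_bool (s < t) * (LINT \<xi>|lborel. K s \<xi>) \<le> C * (of_bool (s < t) * e s)"
          using sl by eventually_elim (use rate(3) in \<open>auto simp: e_def\<close>)
      qed
      finally show ?thesis by simp
    next
      case False
      then have "e t = 0" by (simp add: e_def D_def Z0)
      moreover have "0 \<le> (LINT s|lborel. of_bool (s < t) * e s)"
        by (intro Bochner_Integration.integral_nonneg) (simp add: e_def D_def)
      ultimately show ?thesis using C by simp
    qed
  qed
  then have "AE t in lborel. e t = 0"
  proof (rule gronwall_integrable[where T=T, rotated 4])
    show "integrable lborel e"
      unfolding e_def using lborel_pair.integrable_fst'[OF Di] by simp
    show "0 \<le> e t" for t unfolding e_def D_def by simp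
    show "e t = 0" if "t \<notin> {0<..<T}" for t
      using Z0[OF that] by (simp add: e_def D_def)
    show "0 \<le> 2 * C" using C by simp
  qed
  then have "AE t in lborel. AE x in lborel. z (t, x) = 0"
    using sl
  proof eventually_elim
    case (elim t)
    then have zt: "integrable lborel (\<lambda>x. z (t, x))" by simp
    have Dti: "integrable lborel (D t)"
      unfolding D_def Z_def by (rule energy_density_integrable[OF zt z(2)])
    have "AE \<xi> in lborel. D t \<xi> = 0"
      using elim(1) integral_nonneg_eq_0_iff_AE[OF Dti] unfolding e_def by (simp add: D_def)
    then have "AE \<xi> in lborel. (cmod (Z t \<xi>))\<^sup>2 = 0"
    proof eventually_elim
      case (elim \<xi>)
      have "1 + (norm \<xi>)\<^sup>2 > 0" by (intro add_pos_nonneg) auto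
      with elim show ?case by (simp add: D_def)
    qed
    then have "(LINT \<xi>|lborel. (cmod (Z t \<xi>))\<^sup>2) = 0"
      by (rule integral_eq_zero_AE)
    then have "(LINT x|lborel. (z (t, x))\<^sup>2) = 0"
      using plancherel[OF zt z(2)] unfolding Z_def by simp
    moreover have "integrable lborel (\<lambda>x. (z (t, x))\<^sup>2)"
      using integrable_mult_bounded[OF zt _ z(2)] zt by (simp add: power2_eq_square)
    ultimately show ?case
      by (subst (asm) integral_nonneg_eq_0_iff_AE) auto
  qed
  then have "AE p in lborel \<Otimes>\<^sub>M lborel. z p = 0"
  proof (rule lborel_pair.AE_pair_measure[rotated])
    show "{p \<in> space (lborel \<Otimes>\<^sub>M lborel). z p = 0} \<in> sets (lborel \<Otimes>\<^sub>M lborel)"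
      by measurable
  qed
  then show ?thesis by (simp only: lborel_prod)
qed

section \<open>Truncated plane waves\<close>

text \<open>With \<open>c = 1/R\<^sup>2\<close> this is supported in the ball of radius \<open>R\<close>; the truncation is removed by
  letting \<open>c\<close> tend to \<open>0\<close>.\<close>

definition cutoff :: "nat \<Rightarrow> real \<Rightarrow> real ^ 'd \<Rightarrow> real" where
  "cutoff n c x = bump_deriv n (1 - c * (x \<bullet> x))"

text \<open>Test functions are real, so the complex wave is recovered from two phases:
  \<open>a = 0\<close> gives the cosine and \<open>a = pi / 2\<close> the sine.\<close>

definition cutoff_wave :: "real \<Rightarrow> real ^ 'd \<Rightarrow> real \<Rightarrow> real ^ 'd \<Rightarrow> real" where
  "cutoff_wave c \<xi> a x = cos (\<xi> \<bullet> x - a) * cutoff 0 c x"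

definition cutoff_wave_grad :: "real \<Rightarrow> real ^ 'd \<Rightarrow> real \<Rightarrow> real ^ 'd \<Rightarrow> real ^ 'd" where
  "cutoff_wave_grad c \<xi> a x =
    (\<chi> i. - (\<xi> $ i) * sin (\<xi> \<bullet> x - a) * cutoff 0 c x + cos (\<xi> \<bullet> x - a) * (cutoff 1 c x * (- 2 * c * x $ i)))"

definition cutoff_wave_laplacian :: "real \<Rightarrow> real ^ 'd \<Rightarrow> real \<Rightarrow> real ^ 'd \<Rightarrow> real" where
  "cutoff_wave_laplacian c \<xi> a x = (\<Sum>i\<in>UNIV.
    - (\<xi> $ i)\<^sup>2 * cos (\<xi> \<bullet> x - a) * cutoff 0 c x
    - 2 * (\<xi> $ i) * sin (\<xi> \<bullet> x - a) * (cutoff 1 c x * (- 2 * c * x $ i))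
    + cos (\<xi> \<bullet> x - a) * (cutoff 2 c x * (- 2 * c * x $ i)\<^sup>2 - cutoff 1 c x * (2 * c)))"

lemma inner_line: "\<xi> \<bullet> (x + h *\<^sub>R axis i 1) = \<xi> \<bullet> x + h * \<xi> $ i" for \<xi> x :: "real ^ 'd"
  by (simp add: inner_add_right inner_axis)

lemma inner_line_self: "(x + h *\<^sub>R axis i 1) \<bullet> (x + h *\<^sub>R axis i 1) = x \<bullet> x + 2 * h * x $ i + h\<^sup>2" for x :: "real ^ 'd"
  by (simp add: inner_add_right inner_add_left inner_axis inner_axis' power2_eq_square algebra_simps)

lemma cutoff_line_derivative:
  fixes x :: "real ^ 'd"
  shows "((\<lambda>h. cutoff n c (x + h *\<^sub>R axis i 1)) has_real_derivative cutoff (Suc n) c x * (- 2 * c * x $ i)) (at 0)"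
  unfolding cutoff_def inner_line_self
  by (rule DERIV_cong[OF DERIV_chain2[OF has_real_derivative_bump_deriv]])
    (auto intro!: derivative_eq_intros)

text \<open>The constant \<open>C\<close> will be the value of the time factor of the test
  function.\<close>

lemma partial_deriv_cutoff_wave:
  fixes x :: "real ^ 'd"
  shows "partial_deriv i (\<lambda>x. C * cutoff_wave c \<xi> a x) x = C * cutoff_wave_grad c \<xi> a x $ i"
  unfolding partial_deriv_def cutoff_wave_def inner_line
  by (rule DERIV_imp_deriv) (auto intro!: derivative_eq_intros cutoff_line_derivative simp: cutoff_wave_grad_def algebra_simps)

lemma grad_cutoff_wave: "grad (\<lambda>x. C * cutoff_wave c \<xi> a x) x = C *\<^sub>R cutoff_wave_grad c \<xi> a x"
  by (simp add: grad_def partial_deriv_cutoff_wave vec_eq_iff)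

lemma laplacian_cutoff_wave:
  fixes x :: "real ^ 'd"
  shows "laplacian (\<lambda>x. C * cutoff_wave c \<xi> a x) x = C * cutoff_wave_laplacian c \<xi> a x"
proof -
  have "partial_deriv i (\<lambda>x. C * cutoff_wave_grad c \<xi> a x $ i) x = C * (
    - (\<xi> $ i)\<^sup>2 * cos (\<xi> \<bullet> x - a) * cutoff 0 c x
    - 2 * (\<xi> $ i) * sin (\<xi> \<bullet> x - a) * (cutoff 1 c x * (- 2 * c * x $ i))
    + cos (\<xi> \<bullet> x - a) * (cutoff 2 c x * (- 2 * c * x $ i)\<^sup>2 - cutoff 1 c x * (2 * c)))" for i
    unfolding partial_deriv_def cutoff_wave_grad_def vec_lambda_beta inner_line
    by (rule DERIV_imp_deriv)
      (auto intro!: derivative_eq_intros cutoff_line_derivative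
        simp: algebra_simps power2_eq_square numeral_2_eq_2)
  then show ?thesis
    unfolding laplacian_def partial_deriv_cutoff_wave[abs_def] cutoff_wave_laplacian_def
    by (simp add: sum_distrib_left)
qed

lemma cutoff_zero: "1 \<le> c * (x \<bullet> x) \<Longrightarrow> cutoff n c x = 0"
  by (simp add: cutoff_def bump_deriv_nonpos)

lemma cutoff_bounded: "\<exists>B\<ge>0. \<forall>c\<ge>0. \<forall>x :: real ^ 'd. \<bar>cutoff n c x\<bar> \<le> B"
proof -
  obtain B where B: "\<And>s. s \<le> 1 \<Longrightarrow> \<bar>bump_deriv n s\<bar> \<le> B" using bump_deriv_bounded by blast
  have "0 \<le> B" using B[of 0] by (simp add: bump_deriv_nonpos)
  moreover have "\<bar>cutoff n c x\<bar> \<le> B" if "c \<ge> 0" for c and x :: "real ^ 'd"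
    unfolding cutoff_def by (rule B) (use that in simp)
  ultimately show ?thesis by blast
qed

text \<open>Where the cutoff is nonzero, c |x|^2 < 1 and hence (c |x|)^2 = c (c |x|^2) \<le> 1. The
  derivatives of the cutoff thus stay bounded as c tends to 0 although its support grows.\<close>

lemma cutoff_scaled_component_le:
  fixes x :: "real ^ 'd"
  assumes c: "0 \<le> c" "c \<le> 1" and le: "\<And>c x. 0 \<le> c \<Longrightarrow> \<bar>cutoff n c (x :: real ^ 'd)\<bar> \<le> B"
  shows "\<bar>cutoff n c x * (- 2 * c * x $ i)\<bar> \<le> 2 * B" "\<bar>cutoff n c x * (- 2 * c * x $ i)\<^sup>2\<bar> \<le> 4 * B"
proof -
  have B: "0 \<le> B" using order_trans[OF abs_ge_zero le[OF c(1)]] .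
  have "cutoff n c x = 0 \<or> \<bar>- 2 * c * x $ i\<bar> \<le> 2"
  proof (cases "1 \<le> c * (x \<bullet> x)")
    case True
    then show ?thesis by (simp add: cutoff_zero)
  next
    case False
    have "(c * norm x)\<^sup>2 = c * (c * (x \<bullet> x))"
      by (simp add: power2_norm_eq_inner power_mult_distrib power2_eq_square[of c])
    also have "\<dots> \<le> 1 * 1" using c False by (intro mult_mono) auto
    finally have "c * norm x \<le> 1" using power2_le_imp_le[of "c * norm x" 1] by simp
    moreover have "c * \<bar>x $ i\<bar> \<le> c * norm x"
      using component_le_norm_cart[of x i] c by (intro mult_left_mono) auto
    ultimately show ?thesis using c by (simp add: abs_mult)
  qed
  then have "\<bar>cutoff n c x * (- 2 * c * x $ i)\<bar> \<le> B * 2 \<and> \<bar>cutoff n c x * (- 2 * c * x $ i)\<^sup>2\<bar> \<le> B * 2\<^sup>2"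
  proof
    assume le': "\<bar>- 2 * c * x $ i\<bar> \<le> 2"
    then have "\<bar>- 2 * c * x $ i\<bar>\<^sup>2 \<le> 2\<^sup>2" by (intro power_mono) auto
    with le' show ?thesis
      unfolding abs_mult[of "cutoff n c x"] power_abs[symmetric] by (intro conjI mult_mono le c) (use B in auto)
  qed (use B in auto)
  then show "\<bar>cutoff n c x * (- 2 * c * x $ i)\<bar> \<le> 2 * B" "\<bar>cutoff n c x * (- 2 * c * x $ i)\<^sup>2\<bar> \<le> 4 * B"
    by auto
qed

text \<open>A single constant for all \<open>c\<close> in [0,1] and all phases provides the
  dominating function when the truncation is removed.\<close>

lemma cutoff_wave_bounds:
  fixes \<xi> :: "real ^ 'd"
  obtains B where "\<And>c a x. 0 \<le> c \<Longrightarrow> c \<le> 1 \<Longrightarrow> \<bar>cutoff_wave c \<xi> a x\<bar> \<le> B"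
    "\<And>c a x. 0 \<le> c \<Longrightarrow> c \<le> 1 \<Longrightarrow> norm (cutoff_wave_grad c \<xi> a x) \<le> B"
    "\<And>c a x. 0 \<le> c \<Longrightarrow> c \<le> 1 \<Longrightarrow> \<bar>cutoff_wave_laplacian c \<xi> a x\<bar> \<le> B"
proof -
  obtain B0 B1 B2 where B: "B0 \<ge> 0" "B1 \<ge> 0" "B2 \<ge> 0"
    "\<And>c x. 0 \<le> c \<Longrightarrow> \<bar>cutoff 0 c (x :: real ^ 'd)\<bar> \<le> B0"
    "\<And>c x. 0 \<le> c \<Longrightarrow> \<bar>cutoff 1 c (x :: real ^ 'd)\<bar> \<le> B1" "\<And>c x. 0 \<le> c \<Longrightarrow> \<bar>cutoff 2 c (x :: real ^ 'd)\<bar> \<le> B2"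
    using cutoff_bounded by metis
  have m: "\<bar>u * v\<bar> \<le> V" if "\<bar>u\<bar> \<le> 1" "\<bar>v\<bar> \<le> V" for u v V :: real
    using mult_mono[OF that] by (simp add: abs_mult)
  have sc: "\<bar>cos y\<bar> \<le> 1" "\<bar>sin y\<bar> \<le> 1" for y :: real by auto
  define N where "N = real CARD('d)"
  define k where "k = norm \<xi>"
  have k: "\<bar>\<xi> $ i\<bar> \<le> k" "0 \<le> k" for i using component_le_norm_cart[of \<xi> i] by (auto simp: k_def)
  have k2: "\<bar>(\<xi> $ i)\<^sup>2\<bar> \<le> k\<^sup>2" for i using power_mono[OF k(1), where n=2] by simp
  \<comment> \<open>\<open>G\<close> and \<open>A\<close> add up the term-by-term bounds for one
    gradient component and one summand of the Laplacian.\<close>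
  define G where "G = k * B0 + 2 * B1"
  define A where "A = k\<^sup>2 * B0 + 2 * k * (2 * B1) + (4 * B2 + 2 * B1)"
  have 1: "\<bar>cutoff_wave c \<xi> a x\<bar> \<le> B0" if "0 \<le> c" for c a x
    unfolding cutoff_wave_def by (intro m sc B that)
  have 2: "norm (cutoff_wave_grad c \<xi> a x) \<le> N * G" if c: "0 \<le> c" "c \<le> 1" for c a x
  proof -
    have "\<bar>cutoff_wave_grad c \<xi> a x $ i\<bar> \<le> G" for i
    proof -
      have "\<bar>- (\<xi> $ i) * sin (\<xi> \<bullet> x - a) * cutoff 0 c x\<bar> \<le> k * B0"
        unfolding mult.assoc abs_mult[of "- (\<xi> $ i)"] by (intro mult_mono m sc B c) (use k in auto)
      moreover have "\<bar>cos (\<xi> \<bullet> x - a) * (cutoff 1 c x * (- 2 * c * x $ i))\<bar> \<le> 2 * B1"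
        by (intro m sc cutoff_scaled_component_le c B)
      ultimately show ?thesis
        unfolding cutoff_wave_grad_def G_def vec_lambda_beta by linarith
    qed
    then have "(\<Sum>i\<in>UNIV. \<bar>cutoff_wave_grad c \<xi> a x $ i\<bar>) \<le> (\<Sum>i\<in>(UNIV :: 'd set). G)"
      by (intro sum_mono)
    then show ?thesis
      using order_trans[OF norm_le_l1_cart] by (fastforce simp: N_def)
  qed
  have 3: "\<bar>cutoff_wave_laplacian c \<xi> a x\<bar> \<le> N * A" if c: "0 \<le> c" "c \<le> 1" for c a x
  proof -
    have "\<bar>cutoff_wave_laplacian c \<xi> a x\<bar> \<le> (\<Sum>i\<in>(UNIV :: 'd set). A)"
      unfolding cutoff_wave_laplacian_def
    proof (rule order_trans[OF sum_abs], rule sum_mono)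
      fix i
      have "\<bar>- (\<xi> $ i)\<^sup>2 * cos (\<xi> \<bullet> x - a) * cutoff 0 c x\<bar> \<le> k\<^sup>2 * B0"
        unfolding mult.assoc abs_mult[of "- (\<xi> $ i)\<^sup>2"] by (intro mult_mono m sc B c) (use k2 in auto)
      moreover have "\<bar>2 * (\<xi> $ i) * sin (\<xi> \<bullet> x - a) * (cutoff 1 c x * (- 2 * c * x $ i))\<bar> \<le> 2 * k * (2 * B1)"
      proof -
        have "\<bar>2 * (\<xi> $ i)\<bar> * \<bar>sin (\<xi> \<bullet> x - a) * (cutoff 1 c x * (- 2 * c * x $ i))\<bar> \<le> 2 * k * (2 * B1)"
        proof (rule mult_mono)
          show "\<bar>sin (\<xi> \<bullet> x - a) * (cutoff 1 c x * (- 2 * c * x $ i))\<bar> \<le> 2 * B1"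
            by (intro m sc cutoff_scaled_component_le c B)
        qed (use k in \<open>auto simp: abs_mult\<close>)
        then show ?thesis by (simp only: abs_mult[symmetric] mult.assoc)
      qed
      moreover have "\<bar>cos (\<xi> \<bullet> x - a) * (cutoff 2 c x * (- 2 * c * x $ i)\<^sup>2 - cutoff 1 c x * (2 * c))\<bar> \<le> 4 * B2 + 2 * B1"
      proof (rule m[OF sc(1)], rule order_trans[OF abs_triangle_ineq4 add_mono])
        show "\<bar>cutoff 2 c x * (- 2 * c * x $ i)\<^sup>2\<bar> \<le> 4 * B2"
          by (rule cutoff_scaled_component_le[OF c B(6)])
        have "\<bar>cutoff 1 c x\<bar> * \<bar>2 * c\<bar> \<le> B1 * 2"
          using c by (intro mult_mono B) auto
        then show "\<bar>cutoff 1 c x * (2 * c)\<bar> \<le> 2 * B1" by (simp add: abs_mult)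
      qed
      ultimately show "\<bar>- (\<xi> $ i)\<^sup>2 * cos (\<xi> \<bullet> x - a) * cutoff 0 c x
        - 2 * (\<xi> $ i) * sin (\<xi> \<bullet> x - a) * (cutoff 1 c x * (- 2 * c * x $ i))
        + cos (\<xi> \<bullet> x - a) * (cutoff 2 c x * (- 2 * c * x $ i)\<^sup>2 - cutoff 1 c x * (2 * c))\<bar> \<le> A"
        unfolding A_def by linarith
    qed
    then show ?thesis by (simp add: N_def)
  qed
  show ?thesis
    by (rule that[of "max B0 (max (N * G) (N * A))"])
      (use order_trans[OF 1 max.cobounded1] 2 3 in \<open>auto simp: le_max_iff_disj\<close>)
qed

lemma cutoff_tendsto:
  assumes "c \<longlonglongrightarrow> 0"
  shows "(\<lambda>n. cutoff k (c n) x) \<longlonglongrightarrow> bump_deriv k 1"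
proof -
  have "(\<lambda>n. 1 - c n * (x \<bullet> x)) \<longlonglongrightarrow> 1"
    by (rule tendsto_eq_intros assms refl)+ simp
  moreover have "isCont (bump_deriv k) 1"
    using has_real_derivative_bump_deriv by (rule DERIV_isCont)
  ultimately show ?thesis unfolding cutoff_def by (rule isCont_tendsto_compose[rotated])
qed

text \<open>Every derivative that falls on the cutoff brings a factor c, so only derivatives of the
  wave survive. The cutoff itself tends to the positive constant \<open>bump_deriv 0 1\<close> and
  not to 1.\<close>

lemma
  fixes \<xi> x :: "real ^ 'd"
  assumes c0: "c \<longlonglongrightarrow> 0"
  shows cutoff_wave_tendsto: "(\<lambda>n. cutoff_wave (c n) \<xi> a x) \<longlonglongrightarrow> bump_deriv 0 1 * cos (\<xi> \<bullet> x - a)"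
    and cutoff_wave_grad_tendsto: "(\<lambda>n. cutoff_wave_grad (c n) \<xi> a x) \<longlonglongrightarrow> (bump_deriv 0 1 * - sin (\<xi> \<bullet> x - a)) *\<^sub>R \<xi>"
    and cutoff_wave_laplacian_tendsto: "(\<lambda>n. cutoff_wave_laplacian (c n) \<xi> a x) \<longlonglongrightarrow>
      bump_deriv 0 1 * (- (norm \<xi>)\<^sup>2 * cos (\<xi> \<bullet> x - a))"
proof -
  note c = cutoff_tendsto[OF c0]
  have s: "(\<lambda>n. - 2 * c n * y) \<longlonglongrightarrow> 0" "(\<lambda>n. 2 * c n) \<longlonglongrightarrow> 0" for y :: real
    by ((rule tendsto_eq_intros c0 refl)+, simp)+
  show "(\<lambda>n. cutoff_wave (c n) \<xi> a x) \<longlonglongrightarrow> bump_deriv 0 1 * cos (\<xi> \<bullet> x - a)"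
    unfolding cutoff_wave_def by (rule tendsto_eq_intros c refl)+ simp
  show "(\<lambda>n. cutoff_wave_grad (c n) \<xi> a x) \<longlonglongrightarrow> (bump_deriv 0 1 * - sin (\<xi> \<bullet> x - a)) *\<^sub>R \<xi>"
  proof (rule vec_tendstoI)
    fix i
    have "(\<lambda>n. cutoff_wave_grad (c n) \<xi> a x $ i) \<longlonglongrightarrow> - (\<xi> $ i) * sin (\<xi> \<bullet> x - a) * bump_deriv 0 1 + cos (\<xi> \<bullet> x - a) * (bump_deriv 1 1 * 0)"
      unfolding cutoff_wave_grad_def vec_lambda_beta by (intro tendsto_intros c s)
    then show "(\<lambda>n. cutoff_wave_grad (c n) \<xi> a x $ i) \<longlonglongrightarrow> ((bump_deriv 0 1 * - sin (\<xi> \<bullet> x - a)) *\<^sub>R \<xi>) $ i"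
      by (simp add: mult_ac)
  qed
  have "(\<lambda>n. cutoff_wave_laplacian (c n) \<xi> a x) \<longlonglongrightarrow> (\<Sum>i\<in>UNIV.
    - (\<xi> $ i)\<^sup>2 * cos (\<xi> \<bullet> x - a) * bump_deriv 0 1
    - 2 * (\<xi> $ i) * sin (\<xi> \<bullet> x - a) * (bump_deriv 1 1 * 0)
    + cos (\<xi> \<bullet> x - a) * (bump_deriv 2 1 * 0\<^sup>2 - bump_deriv 1 1 * 0))"
    unfolding cutoff_wave_laplacian_def by (intro tendsto_intros c s)
  also have "(\<Sum>i\<in>UNIV. - (\<xi> $ i)\<^sup>2 * cos (\<xi> \<bullet> x - a) * bump_deriv 0 1
    - 2 * (\<xi> $ i) * sin (\<xi> \<bullet> x - a) * (bump_deriv 1 1 * 0)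
    + cos (\<xi> \<bullet> x - a) * (bump_deriv 2 1 * 0\<^sup>2 - bump_deriv 1 1 * 0)) = (\<Sum>i\<in>UNIV. (\<xi> $ i)\<^sup>2) * (- cos (\<xi> \<bullet> x - a) * bump_deriv 0 1)"
    unfolding sum_distrib_right by (intro sum.cong refl) simp
  also have "(\<Sum>i\<in>UNIV. (\<xi> $ i)\<^sup>2) = (norm \<xi>)\<^sup>2"
    by (simp add: norm_vec_def L2_set_def sum_nonneg)
  finally show "(\<lambda>n. cutoff_wave_laplacian (c n) \<xi> a x) \<longlonglongrightarrow>
      bump_deriv 0 1 * (- (norm \<xi>)\<^sup>2 * cos (\<xi> \<bullet> x - a))"
    by (simp add: mult_ac)
qed

lemma test_function_cutoff_wave:
  assumes \<theta>: "\<And>k. Ck_on k \<theta> UNIV" "q < T" "\<And>t. t \<ge> q \<Longrightarrow> \<theta> t = 0" and c: "0 < c" "c \<le> 1"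
  shows "(\<lambda>p. \<theta> (fst p) * cutoff_wave c \<xi> a (snd p :: real ^ 'd)) \<in> test_functions T"
proof -
  let ?\<phi> = "\<lambda>p. \<theta> (fst p) * cutoff_wave c \<xi> a (snd p :: real ^ 'd)"
  let ?S = "{0..<T} \<times> (UNIV :: (real ^ 'd) set)"
  have lin: "Ck_on k (\<lambda>p. \<zeta> \<bullet> snd p) S" for k S and \<zeta> :: "real ^ 'd"
    by (rule Ck_on_linear) (intro bounded_linear_intros)
  have quad: "Ck_on k (\<lambda>p. (snd p :: real ^ 'd) \<bullet> snd p) S" for k and S :: "(real \<times> (real ^ 'd)) set"
  proof -
    have sum: "Ck_on k (\<lambda>p. \<Sum>i\<in>I. (snd p $ i) * (snd p $ i)) S" if "finite I" for I :: "'d set"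
      using that
    proof (induction I)
      case (insert i I)
      have "Ck_on k (\<lambda>p. axis i 1 \<bullet> (snd p :: real ^ 'd)) S" by (rule lin)
      then have "Ck_on k (\<lambda>p. (snd p :: real ^ 'd) $ i) S" by (simp add: inner_axis')
      with insert show ?case by (auto intro!: Ck_on_add Ck_on_mult)
    qed (auto intro: Ck_on_const)
    then show ?thesis by (simp add: inner_vec_def)
  qed
  have "Ck_on k ?\<phi> ?S" for k
  proof -
    have "Ck_on k (\<lambda>p. \<theta> (fst p)) ?S"
      by (rule Ck_on_compose_linear[OF bounded_linear_fst \<theta>(1)])
    moreover have "Ck_on k (\<lambda>p. cos (\<xi> \<bullet> snd p + - a)) ?S"
      by (intro Ck_on_cos Ck_on_add lin Ck_on_const)
    moreover have "Ck_on k (\<lambda>p. bump_deriv 0 (1 + (- c) * ((snd p :: real ^ 'd) \<bullet> snd p))) ?S"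
      by (intro Ck_on_bump Ck_on_add Ck_on_mult quad Ck_on_const)
    ultimately have "Ck_on k (\<lambda>p. \<theta> (fst p) * (cos (\<xi> \<bullet> snd p + - a) * bump_deriv 0 (1 + (- c) * ((snd p :: real ^ 'd) \<bullet> snd p)))) ?S"
      by (intro Ck_on_mult)
    then show ?thesis by (simp add: cutoff_wave_def cutoff_def)
  qed
  then have smooth: "smooth_on ?\<phi> ?S" by (simp add: smooth_on_def)
  \<comment> \<open>The support has radius 1/sqrt(c); as c \<le> 1, the radius \<open>1 / c\<close>
    is at least as large and avoids the root.\<close>
  let ?K = "{0..q} \<times> cball (0 :: real ^ 'd) (1 / c)"
  have K: "compact ?K" by (intro compact_Times) auto
  have "{p \<in> ?S. ?\<phi> p \<noteq> 0} \<subseteq> ?K"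
  proof (rule subsetI, rule ccontr)
    fix p assume p: "p \<in> {p \<in> ?S. ?\<phi> p \<noteq> 0}" "p \<notin> ?K"
    then consider "fst p \<ge> q" | "norm (snd p) \<ge> 1 / c" by (cases p) fastforce
    then show False
    proof cases
      case 1
      then show ?thesis using p \<theta>(3)[of "fst p"] by simp
    next
      case 2
      have "1 * 1 \<le> (c * norm (snd p)) * norm (snd p)"
      proof (intro mult_mono)
        show "1 \<le> c * norm (snd p)" using 2 c by (simp add: field_simps)
        have "1 \<le> 1 / c" using c by simp
        with 2 show "1 \<le> norm (snd p)" by linarith
      qed (use c in auto)
      then have "1 \<le> c * (snd p \<bullet> snd p)"
        by (simp add: power2_norm_eq_inner[symmetric] power2_eq_square mult.assoc)
      then show ?thesis using p by (simp add: cutoff_wave_def cutoff_zero)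
    qed
  qed
  then have cl: "closure {p \<in> ?S. ?\<phi> p \<noteq> 0} \<subseteq> ?K"
    by (rule closure_minimal) (use K compact_imp_closed in blast)
  then have "compact (closure {p \<in> ?S. ?\<phi> p \<noteq> 0})"
    using K by (meson closed_closure compact_closure bounded_subset compact_imp_bounded closure_subset subset_trans)
  moreover have "closure {p \<in> ?S. ?\<phi> p \<noteq> 0} \<subseteq> ?S"
    using cl \<theta>(2) by fastforce
  ultimately show ?thesis
    using smooth by (simp add: test_functions_def)
qed

section \<open>The weak formulation tested with truncated plane waves\<close>

lemma continuous_on_cutoff [continuous_intros]: "continuous_on S (cutoff n c)"
  unfolding cutoff_def[abs_def]
  by (intro continuous_on_compose2[OF continuous_on_bump_deriv[of UNIV]] continuous_intros) auto

lemma cutoff_wave_measurable [measurable]: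
  fixes \<xi> :: "real ^ 'd"
  shows "cutoff_wave c \<xi> a \<in> borel_measurable borel"
    and "cutoff_wave_laplacian c \<xi> a \<in> borel_measurable borel"
    and "cutoff_wave_grad c \<xi> a \<in> borel_measurable borel"
  unfolding cutoff_wave_def[abs_def] cutoff_wave_laplacian_def[abs_def] cutoff_wave_grad_def[abs_def]
  by (intro borel_measurable_continuous_onI continuous_intros)+

text \<open>Measurability of f comes from completeness. The lemma transfers the iterated Lebesgue
  integrals of \<open>distributional_solution\<close> to Borel representatives without inspecting
  individual slices.\<close>

lemma integral_completion_AE_eq:
  fixes f g :: "'a \<Rightarrow> 'b::{banach, second_countable_topology}"
  assumes g: "g \<in> borel_measurable M" and eq: "AE x in M. f x = g x"
  shows "integral\<^sup>L (completion M) f = integral\<^sup>L M g"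
proof -
  from eq obtain N where N: "{x \<in> space M. f x \<noteq> g x} \<subseteq> N" "emeasure M N = 0" "N \<in> sets M"
    by (rule AE_E)
  have "f \<in> borel_measurable (completion M)"
  proof (rule measurableI)
    fix S :: "'b set" assume S: "S \<in> sets borel"
    show "f -` S \<inter> space (completion M) \<in> sets (completion M)"
    proof (rule sets_completionI)
      show "f -` S \<inter> space (completion M) = (g -` S \<inter> space M - N) \<union> (f -` S \<inter> space M \<inter> N)"
        using N(1) by auto
      show "f -` S \<inter> space M \<inter> N \<subseteq> N" by auto
      show "N \<in> null_sets M" using N by auto
      show "g -` S \<inter> space M - N \<in> sets M" using g S N by measurable
    qed
  qed simp
  then have "integral\<^sup>L (completion M) f = integral\<^sup>L (completion M) g"
    using g eq by (intro integral_cong_AE) (auto intro: measurable_completion AE_completion)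
  then show ?thesis by (simp add: integral_completion[OF g])
qed

text \<open>Here \<open>u\<close>, \<open>v\<close>, \<open>V\<close> play the roles of a spatial test function, its Laplacian and its gradient,
  and \<open>\<eta>\<close> that of \<open>\<theta>'\<close>.\<close>

definition weak_integrand ::
  "(real \<Rightarrow> real) \<Rightarrow> (real \<Rightarrow> real) \<Rightarrow> (real \<times> 'a::euclidean_space \<Rightarrow> real) \<Rightarrow> (real \<times> 'a \<Rightarrow> real) \<Rightarrow> (real \<times> 'a \<Rightarrow> 'a) \<Rightarrow>
    ('a \<Rightarrow> real) \<Rightarrow> ('a \<Rightarrow> real) \<Rightarrow> ('a \<Rightarrow> 'a) \<Rightarrow> real \<times> 'a \<Rightarrow> real" where
  "weak_integrand \<eta> \<theta> z w G u v V p =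
    \<eta> (fst p) * u (snd p) * z p + \<theta> (fst p) * v (snd p) * w p + \<theta> (fst p) * (G p \<bullet> V (snd p))"

text \<open>Bounds on (0,T) suffice because the functions multiplied by \<eta> and \<theta> vanish
  at all other times.\<close>

locale time_slab =
  fixes T Bt :: real and \<eta> \<theta> :: "real \<Rightarrow> real"
  assumes \<eta>_measurable [measurable]: "\<eta> \<in> borel_measurable borel"
    and \<theta>_measurable [measurable]: "\<theta> \<in> borel_measurable borel"
    and \<eta>_bound: "\<And>t. t \<in> {0<..<T} \<Longrightarrow> \<bar>\<eta> t\<bar> \<le> Bt"
    and \<theta>_bound: "\<And>t. t \<in> {0<..<T} \<Longrightarrow> \<bar>\<theta> t\<bar> \<le> Bt"
begin

lemma fst_snd_measurable [measurable]:
  "f \<in> borel_measurable borel \<Longrightarrow> (\<lambda>p::real \<times> 'a::euclidean_space. f (fst p)) \<in> borel_measurable borel"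
  "g \<in> borel_measurable borel \<Longrightarrow> (\<lambda>p::real \<times> 'a::euclidean_space. g (snd p)) \<in> borel_measurable borel"
  by (simp_all flip: borel_prod)

lemma weak_integrand_dominated:
  fixes z w :: "real \<times> 'a::euclidean_space \<Rightarrow> real" and G :: "real \<times> 'a \<Rightarrow> 'a"
  assumes z: "integrable lborel z" and w: "integrable lborel w" and G: "integrable lborel G"
    and zero: "\<And>t x. t \<notin> {0<..<T} \<Longrightarrow> z (t, x) = 0" "\<And>t x. t \<notin> {0<..<T} \<Longrightarrow> w (t, x) = 0"
      "\<And>t x. t \<notin> {0<..<T} \<Longrightarrow> G (t, x) = 0"
    and uvV: "\<And>x. \<bar>u x\<bar> \<le> B" "\<And>x. \<bar>v x\<bar> \<le> B" "\<And>x. norm (V x) \<le> B"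
  shows "\<bar>weak_integrand \<eta> \<theta> z w G u v V p\<bar> \<le> Bt * B * (\<bar>z p\<bar> + \<bar>w p\<bar> + norm (G p))"
proof (cases "fst p \<in> {0<..<T}")
  case True
  have Bt: "0 \<le> Bt" using order_trans[OF abs_ge_zero \<eta>_bound[OF True]] .
  have B: "0 \<le> B" using order_trans[OF abs_ge_zero uvV(1)] .
  have "\<bar>\<eta> (fst p) * u (snd p) * z p\<bar> \<le> Bt * B * \<bar>z p\<bar>"
    unfolding abs_mult by (intro mult_mono \<eta>_bound True uvV) (use B Bt in auto)
  moreover have "\<bar>\<theta> (fst p) * v (snd p) * w p\<bar> \<le> Bt * B * \<bar>w p\<bar>"
    unfolding abs_mult by (intro mult_mono \<theta>_bound True uvV) (use B Bt in auto)
  moreover have "\<bar>\<theta> (fst p) * (G p \<bullet> V (snd p))\<bar> \<le> Bt * (B * norm (G p))"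
  proof -
    have "\<bar>G p \<bullet> V (snd p)\<bar> \<le> norm (G p) * B"
      by (rule order_trans[OF Cauchy_Schwarz_ineq2]) (intro mult_left_mono uvV, simp)
    then show ?thesis
      unfolding abs_mult by (intro mult_mono \<theta>_bound True) (use Bt in \<open>auto simp: mult.commute\<close>)
  qed
  ultimately show ?thesis
    unfolding weak_integrand_def by (simp add: distrib_left mult.assoc)
next
  case False
  then show ?thesis
    using zero[of "fst p" "snd p"] by (simp add: weak_integrand_def)
qed

lemma weak_integrand_integrable:
  fixes z w :: "real \<times> 'a::euclidean_space \<Rightarrow> real" and G :: "real \<times> 'a \<Rightarrow> 'a"
  assumes z: "integrable lborel z" and w: "integrable lborel w" and G: "integrable lborel G"
    and zero: "\<And>t x. t \<notin> {0<..<T} \<Longrightarrow> z (t, x) = 0" "\<And>t x. t \<notin> {0<..<T} \<Longrightarrow> w (t, x) = 0"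
      "\<And>t x. t \<notin> {0<..<T} \<Longrightarrow> G (t, x) = 0"
    and [measurable]: "u \<in> borel_measurable borel" "v \<in> borel_measurable borel" "V \<in> borel_measurable borel"
    and uvV: "\<And>x. \<bar>u x\<bar> \<le> B" "\<And>x. \<bar>v x\<bar> \<le> B" "\<And>x. norm (V x) \<le> B"
  shows "integrable lborel (weak_integrand \<eta> \<theta> z w G u v V)"
proof (rule Bochner_Integration.integrable_bound)
  show "integrable lborel (\<lambda>p. Bt * B * (\<bar>z p\<bar> + \<bar>w p\<bar> + norm (G p)))"
    using z w G by (intro integrable_mult_right Bochner_Integration.integrable_add) auto
  have [measurable]: "z \<in> borel_measurable borel" "w \<in> borel_measurable borel" "G \<in> borel_measurable borel"
    using z w G by auto
  show "weak_integrand \<eta> \<theta> z w G u v V \<in> borel_measurable lborel"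
    unfolding weak_integrand_def[abs_def] by measurable
  show "AE p in lborel. norm (weak_integrand \<eta> \<theta> z w G u v V p) \<le> norm (Bt * B * (\<bar>z p\<bar> + \<bar>w p\<bar> + norm (G p)))"
    using weak_integrand_dominated[OF assms(1-6) uvV] by (auto intro!: AE_I2 order_trans[OF _ abs_ge_self])
qed

text \<open>Plane waves lack compact support; integrability of z, w and G and the uniform bounds of
  \<open>cutoff_wave_bounds\<close> allow dominated convergence as the truncation is removed. The
  limit carries the nonzero factor \<open>bump_deriv 0 1\<close>, which is divided out.\<close>

lemma weak_equation_plane_wave:
  fixes z w :: "real \<times> (real ^ 'd) \<Rightarrow> real" and G :: "real \<times> (real ^ 'd) \<Rightarrow> real ^ 'd"
  assumes z: "integrable lborel z" and w: "integrable lborel w" and G: "integrable lborel G"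
    and zero: "\<And>t x. t \<notin> {0<..<T} \<Longrightarrow> z (t, x) = 0" "\<And>t x. t \<notin> {0<..<T} \<Longrightarrow> w (t, x) = 0"
      "\<And>t x. t \<notin> {0<..<T} \<Longrightarrow> G (t, x) = 0"
    and weak: "\<And>c. 0 < c \<Longrightarrow> c \<le> 1 \<Longrightarrow> (LINT p|lborel. weak_integrand \<eta> \<theta> z w G
      (cutoff_wave c \<xi> a) (cutoff_wave_laplacian c \<xi> a) (cutoff_wave_grad c \<xi> a) p) = 0"
  shows "(LINT p|lborel. weak_integrand \<eta> \<theta> z w G (\<lambda>x. cos (\<xi> \<bullet> x - a))
    (\<lambda>x. - (norm \<xi>)\<^sup>2 * cos (\<xi> \<bullet> x - a)) (\<lambda>x. - sin (\<xi> \<bullet> x - a) *\<^sub>R \<xi>) p) = 0"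
    (is "(LINT p|lborel. ?W p) = 0")
proof -
  define e where "e = bump_deriv 0 1"
  have e: "e > 0" by (simp add: e_def bump_deriv_0)
  define c where "c n = inverse (real (Suc n))" for n
  have c: "0 < c n" "0 \<le> c n" "c n \<le> 1" "c \<longlonglongrightarrow> 0" for n
    using LIMSEQ_inverse_real_of_nat by (auto simp: c_def[abs_def] field_simps)
  obtain B where B: "\<And>R a x. 0 \<le> R \<Longrightarrow> R \<le> 1 \<Longrightarrow> \<bar>cutoff_wave R \<xi> a x\<bar> \<le> B"
    "\<And>R a x. 0 \<le> R \<Longrightarrow> R \<le> 1 \<Longrightarrow> norm (cutoff_wave_grad R \<xi> a x) \<le> B"
    "\<And>R a x. 0 \<le> R \<Longrightarrow> R \<le> 1 \<Longrightarrow> \<bar>cutoff_wave_laplacian R \<xi> a x\<bar> \<le> B"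
    using cutoff_wave_bounds[of \<xi>] by metis
  have [measurable]: "z \<in> borel_measurable borel" "w \<in> borel_measurable borel" "G \<in> borel_measurable borel"
    using z w G by auto
  let ?C = "\<lambda>n. weak_integrand \<eta> \<theta> z w G (cutoff_wave (c n) \<xi> a) (cutoff_wave_laplacian (c n) \<xi> a) (cutoff_wave_grad (c n) \<xi> a)"
  have "(\<lambda>n. LINT p|lborel. ?C n p) \<longlonglongrightarrow> (LINT p|lborel. e * ?W p)"
  proof (rule integral_dominated_convergence)
    show "integrable lborel (\<lambda>p. Bt * B * (\<bar>z p\<bar> + \<bar>w p\<bar> + norm (G p)))"
      using z w G by (intro integrable_mult_right Bochner_Integration.integrable_add) auto
    show "?C n \<in> borel_measurable lborel" for n
      unfolding weak_integrand_def[abs_def] by measurable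
    show "(\<lambda>p. e * ?W p) \<in> borel_measurable lborel"
      unfolding weak_integrand_def[abs_def] by measurable
    show "AE p in lborel. norm (?C n p) \<le> Bt * B * (\<bar>z p\<bar> + \<bar>w p\<bar> + norm (G p))" for n
      unfolding real_norm_def
      by (intro AE_I2 weak_integrand_dominated assms B c)
    show "AE p in lborel. (\<lambda>n. ?C n p) \<longlonglongrightarrow> e * ?W p"
    proof (rule AE_I2)
      fix p
      have "(\<lambda>n. ?C n p) \<longlonglongrightarrow> \<eta> (fst p) * (e * cos (\<xi> \<bullet> snd p - a)) * z p
        + \<theta> (fst p) * (e * (- (norm \<xi>)\<^sup>2 * cos (\<xi> \<bullet> snd p - a))) * w p
        + \<theta> (fst p) * (G p \<bullet> ((e * - sin (\<xi> \<bullet> snd p - a)) *\<^sub>R \<xi>))"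
        unfolding weak_integrand_def e_def
        by (intro tendsto_intros cutoff_wave_tendsto cutoff_wave_grad_tendsto cutoff_wave_laplacian_tendsto c)
      also have "\<eta> (fst p) * (e * cos (\<xi> \<bullet> snd p - a)) * z p
        + \<theta> (fst p) * (e * (- (norm \<xi>)\<^sup>2 * cos (\<xi> \<bullet> snd p - a))) * w p
        + \<theta> (fst p) * (G p \<bullet> ((e * - sin (\<xi> \<bullet> snd p - a)) *\<^sub>R \<xi>)) = e * ?W p"
        unfolding weak_integrand_def by (simp add: algebra_simps)
      finally show "(\<lambda>n. ?C n p) \<longlonglongrightarrow> e * ?W p" .
    qed
  qed
  moreover have "(LINT p|lborel. ?C n p) = 0" for n
    by (intro weak c)
  ultimately have "(\<lambda>n. 0) \<longlonglongrightarrow> (LINT p|lborel. e * ?W p)" by simp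
  then have "(LINT p|lborel. e * ?W p) = 0"
    using LIMSEQ_unique tendsto_const by blast
  then show ?thesis using e by simp
qed

end

context time_slab
begin

lemma integrable_scaleR_time:
  fixes f :: "real \<Rightarrow> complex"
  assumes f: "integrable lborel f" and zero: "\<And>t. t \<notin> {0<..<T} \<Longrightarrow> f t = 0"
  shows "integrable lborel (\<lambda>t. \<eta> t *\<^sub>R f t)" and "integrable lborel (\<lambda>t. \<theta> t *\<^sub>R f t)"
proof -
  have *: "integrable lborel (\<lambda>t. k t *\<^sub>R f t)" if [measurable]: "k \<in> borel_measurable borel"
    and k: "\<And>t. t \<in> {0<..<T} \<Longrightarrow> \<bar>k t\<bar> \<le> Bt" for k
  proof (rule Bochner_Integration.integrable_bound[OF integrable_scaleR_right[of Bt, OF f]])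
    show "AE t in lborel. norm (k t *\<^sub>R f t) \<le> norm (Bt *\<^sub>R f t)"
    proof (rule AE_I2)
      fix t show "norm (k t *\<^sub>R f t) \<le> norm (Bt *\<^sub>R f t)"
        using zero[of t] order_trans[OF k[of t] abs_ge_self]
        by (cases "t \<in> {0<..<T}") (auto intro!: mult_right_mono)
    qed
  qed (use f in auto)
  show "integrable lborel (\<lambda>t. \<eta> t *\<^sub>R f t)" by (intro * \<eta>_bound) auto
  show "integrable lborel (\<lambda>t. \<theta> t *\<^sub>R f t)" by (intro * \<theta>_bound) auto
qed

proposition fourier_weak_equation:
  fixes z w :: "real \<times> (real ^ 'd) \<Rightarrow> real" and G :: "real \<times> (real ^ 'd) \<Rightarrow> real ^ 'd"
  assumes z: "integrable lborel z" and w: "integrable lborel w" and G: "integrable lborel G"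
    and zero: "\<And>t x. t \<notin> {0<..<T} \<Longrightarrow> z (t, x) = 0" "\<And>t x. t \<notin> {0<..<T} \<Longrightarrow> w (t, x) = 0"
      "\<And>t x. t \<notin> {0<..<T} \<Longrightarrow> G (t, x) = 0"
    and weak: "\<And>c a. 0 < c \<Longrightarrow> c \<le> 1 \<Longrightarrow> (LINT p|lborel. weak_integrand \<eta> \<theta> z w G
      (cutoff_wave c \<xi> a) (cutoff_wave_laplacian c \<xi> a) (cutoff_wave_grad c \<xi> a) p) = 0"
  shows "(LINT t|lborel. \<eta> t *\<^sub>R fourier (\<lambda>x. z (t, x)) \<xi>) +
    (LINT t|lborel. \<theta> t *\<^sub>R slice_symbol (\<lambda>x. w (t, x)) (\<lambda>x. G (t, x)) \<xi>) = 0"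
proof -
  define W where "W a = weak_integrand \<eta> \<theta> z w G (\<lambda>x. cos (\<xi> \<bullet> x - a))
    (\<lambda>x. - (norm \<xi>)\<^sup>2 * cos (\<xi> \<bullet> x - a)) (\<lambda>x. - sin (\<xi> \<bullet> x - a) *\<^sub>R \<xi>)" for a
  \<comment> \<open>Since cos s - i cos(s - pi/2) = exp(-i s), the two real phases combine into the
    kernel of the transform.\<close>
  define \<Phi> where "\<Phi> p = complex_of_real (W 0 p) - \<i> * complex_of_real (W (pi / 2) p)" for p
  have Wi: "integrable lborel (W a)" for a
  proof -
    let ?B = "1 + (norm \<xi>)\<^sup>2 + norm \<xi>"
    have n: "0 \<le> (norm \<xi>)\<^sup>2" "0 \<le> norm \<xi>" by auto
    have m: "\<bar>cos s\<bar> \<le> 1" "\<bar>sin s\<bar> \<le> 1" for s :: real by auto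
    have c1: "\<bar>cos s\<bar> \<le> ?B" for s using m(1)[of s] n by linarith
    have c2: "\<bar>- (norm \<xi>)\<^sup>2 * cos s\<bar> \<le> ?B" for s
    proof -
      have "\<bar>- (norm \<xi>)\<^sup>2 * cos s\<bar> = (norm \<xi>)\<^sup>2 * \<bar>cos s\<bar>" by (simp add: abs_mult)
      also have "\<dots> \<le> (norm \<xi>)\<^sup>2 * 1" by (intro mult_left_mono m n)
      finally show ?thesis using n by linarith
    qed
    have c3: "norm (- sin s *\<^sub>R \<xi>) \<le> ?B" for s
    proof -
      have "norm (- sin s *\<^sub>R \<xi>) = \<bar>sin s\<bar> * norm \<xi>" by simp
      also have "\<dots> \<le> 1 * norm \<xi>" by (intro mult_right_mono m n)
      finally show ?thesis using n by linarith
    qed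
    show ?thesis
      unfolding W_def by (rule weak_integrand_integrable[OF z w G zero, where B="?B"]) (use c1 c2 c3 in \<open>auto simp del: norm_scaleR\<close>)
  qed
  have W0: "(LINT p|lborel. W a p) = 0" for a
    unfolding W_def by (rule weak_equation_plane_wave[OF z w G zero weak])
  have \<Phi>i: "integrable lborel \<Phi>"
    unfolding \<Phi>_def by (intro Bochner_Integration.integrable_diff integrable_mult_right integrable_of_real Wi)
  have "(LINT p|lborel. \<Phi> p) = complex_of_real (LINT p|lborel. W 0 p) - \<i> * complex_of_real (LINT p|lborel. W (pi / 2) p)"
    unfolding \<Phi>_def using Wi
    by (subst Bochner_Integration.integral_diff) (auto intro: integrable_of_real)
  also have "\<dots> = 0"
    by (simp add: W0)
  finally have "(LINT t|lborel. LINT x|lborel. \<Phi> (t, x)) = 0"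
    using lborel_pair.integral_fst'[of \<Phi>] \<Phi>i by (simp add: lborel_prod)
  moreover have "(LINT t|lborel. LINT x|lborel. \<Phi> (t, x)) = (LINT t|lborel. \<eta> t *\<^sub>R fourier (\<lambda>x. z (t, x)) \<xi> +
    \<theta> t *\<^sub>R slice_symbol (\<lambda>x. w (t, x)) (\<lambda>x. G (t, x)) \<xi>)"
  proof (rule integral_cong_AE)
    show "(\<lambda>t. LINT x|lborel. \<Phi> (t, x)) \<in> borel_measurable lborel"
      using lborel_pair.integrable_fst'[of \<Phi>] \<Phi>i by (auto simp: lborel_prod)
    show "(\<lambda>t. \<eta> t *\<^sub>R fourier (\<lambda>x. z (t, x)) \<xi> + \<theta> t *\<^sub>R slice_symbol (\<lambda>x. w (t, x)) (\<lambda>x. G (t, x)) \<xi>) \<in> borel_measurable lborel"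
      using borel_measurable_integrable[OF fourier_slice_integrable[OF z, of \<xi>]]
        borel_measurable_integrable[OF slice_symbol_slice_integrable[OF w G, of \<xi>]] by measurable
    have "AE t in lborel. integrable lborel (\<lambda>x. G (t, x))"
      using lborel_pair.AE_integrable_fst'[of G] G by (simp add: lborel_prod)
    then show "AE t in lborel. (LINT x|lborel. \<Phi> (t, x)) = \<eta> t *\<^sub>R fourier (\<lambda>x. z (t, x)) \<xi> +
      \<theta> t *\<^sub>R slice_symbol (\<lambda>x. w (t, x)) (\<lambda>x. G (t, x)) \<xi>"
      using AE_slice_integrable[OF z] AE_slice_integrable[OF w]
    proof eventually_elim
      case (elim t)
      let ?e = "\<lambda>x. cis (- (\<xi> \<bullet> x))"
      have fi: "integrable lborel (\<lambda>x. complex_of_real (f x) * ?e x)" if "integrable lborel f" for f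
        using fourier_integrable[OF that, of "-1" \<xi>] by simp
      have Gb: "integrable lborel (\<lambda>x. G (t, x) \<bullet> b)" for b using elim(1) by simp
      have "\<Phi> (t, x) = \<eta> t *\<^sub>R (complex_of_real (z (t, x)) * ?e x) +
        \<theta> t *\<^sub>R (- complex_of_real ((norm \<xi>)\<^sup>2) * (complex_of_real (w (t, x)) * ?e x) -
          \<i> * (\<Sum>b\<in>Basis. complex_of_real (\<xi> \<bullet> b) * (complex_of_real (G (t, x) \<bullet> b) * ?e x)))" for x
      proof -
        have "(\<Sum>b\<in>Basis. complex_of_real (\<xi> \<bullet> b) * (complex_of_real (G (t, x) \<bullet> b) * ?e x)) = complex_of_real (G (t, x) \<bullet> \<xi>) * ?e x"
          unfolding euclidean_inner[of "G (t, x)" \<xi>] of_real_sum sum_distrib_right by (simp add: mult_ac)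
        then show ?thesis
          unfolding \<Phi>_def W_def weak_integrand_def
          by (simp only:) (simp add: complex_eq_iff cos_diff sin_diff algebra_simps)
      qed
      then have "(LINT x|lborel. \<Phi> (t, x)) = (LINT x|lborel. \<eta> t *\<^sub>R (complex_of_real (z (t, x)) * ?e x) +
        \<theta> t *\<^sub>R (- complex_of_real ((norm \<xi>)\<^sup>2) * (complex_of_real (w (t, x)) * ?e x) -
          \<i> * (\<Sum>b\<in>Basis. complex_of_real (\<xi> \<bullet> b) * (complex_of_real (G (t, x) \<bullet> b) * ?e x))))"
        by simp
      also have "\<dots> = (LINT x|lborel. \<eta> t *\<^sub>R (complex_of_real (z (t, x)) * ?e x)) +
        (LINT x|lborel. \<theta> t *\<^sub>R (- complex_of_real ((norm \<xi>)\<^sup>2) * (complex_of_real (w (t, x)) * ?e x) -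
          \<i> * (\<Sum>b\<in>Basis. complex_of_real (\<xi> \<bullet> b) * (complex_of_real (G (t, x) \<bullet> b) * ?e x))))"
        by (intro Bochner_Integration.integral_add integrable_scaleR_right Bochner_Integration.integrable_diff
            integrable_mult_right Bochner_Integration.integrable_sum fi elim Gb)
      also have "(LINT x|lborel. \<theta> t *\<^sub>R (- complex_of_real ((norm \<xi>)\<^sup>2) * (complex_of_real (w (t, x)) * ?e x) -
          \<i> * (\<Sum>b\<in>Basis. complex_of_real (\<xi> \<bullet> b) * (complex_of_real (G (t, x) \<bullet> b) * ?e x)))) =
        \<theta> t *\<^sub>R ((LINT x|lborel. - complex_of_real ((norm \<xi>)\<^sup>2) * (complex_of_real (w (t, x)) * ?e x)) -
          (LINT x|lborel. \<i> * (\<Sum>b\<in>Basis. complex_of_real (\<xi> \<bullet> b) * (complex_of_real (G (t, x) \<bullet> b) * ?e x))))"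
        by (subst integral_scaleR_right, subst Bochner_Integration.integral_diff)
          (intro integrable_mult_right Bochner_Integration.integrable_sum fi elim Gb refl)+
      also have "(LINT x|lborel. \<i> * (\<Sum>b\<in>Basis. complex_of_real (\<xi> \<bullet> b) * (complex_of_real (G (t, x) \<bullet> b) * ?e x)))
        = \<i> * (\<Sum>b\<in>Basis. complex_of_real (\<xi> \<bullet> b) * fourier (\<lambda>x. G (t, x) \<bullet> b) \<xi>)"
        unfolding fourier_def integral_mult_right_zero
        by (subst Bochner_Integration.integral_sum) (intro integrable_mult_right fi Gb, simp)
      finally show ?case
        unfolding slice_symbol_def evolution_symbol_def fourier_def by simp
    qed
  qed
  moreover have "\<dots> = (LINT t|lborel. \<eta> t *\<^sub>R fourier (\<lambda>x. z (t, x)) \<xi>) +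
    (LINT t|lborel. \<theta> t *\<^sub>R slice_symbol (\<lambda>x. w (t, x)) (\<lambda>x. G (t, x)) \<xi>)"
  proof (intro Bochner_Integration.integral_add integrable_scaleR_time fourier_slice_integrable[OF z] slice_symbol_slice_integrable[OF w G])
    show "fourier (\<lambda>x. z (t, x)) \<xi> = 0" if "t \<notin> {0<..<T}" for t
      using zero(1)[OF that] by (simp add: fourier_def)
    show "slice_symbol (\<lambda>x. w (t, x)) (\<lambda>x. G (t, x)) \<xi> = 0" if "t \<notin> {0<..<T}" for t
      using zero(2,3)[OF that] by (simp add: slice_symbol_def evolution_symbol_def fourier_def)
  qed
  ultimately show ?thesis by simp
qed

text \<open>The Borel representatives replace y and D almost everywhere, and Fubini merges the
  iterated Lebesgue integrals into one integral. The initial term is carried along unevaluated,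
  ready to cancel between two solutions.\<close>

lemma distributional_solution_cutoff_wave:
  fixes y Y :: "real \<times> (real ^ 'd) \<Rightarrow> real" and D D' :: "real ^ 'd \<Rightarrow> real ^ 'd"
  assumes sol: "distributional_solution T \<beta> b D \<rho>\<^sub>0 y"
    and eq: "AE p in lborel. fst p \<in> {0<..<T} \<longrightarrow> y p = Y p" "AE x in lborel. D x = D' x"
    and Y: "integrable lborel Y" "integrable lborel (\<lambda>p. \<beta> (Y p))" "integrable lborel (\<lambda>p. (b (Y p) * Y p) *\<^sub>R D' (snd p))"
    and zero: "\<And>t x. t \<notin> {0<..<T} \<Longrightarrow> Y (t, x) = 0" "\<beta> 0 = 0"
    and test: "(\<lambda>p. \<theta> (fst p) * cutoff_wave c \<xi> a (snd p)) \<in> test_functions T" and c: "0 \<le> c" "c \<le> 1"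
    and deriv: "\<And>t. (\<theta> has_real_derivative \<eta> t) (at t)"
  defines "W \<equiv> weak_integrand \<eta> \<theta> Y (\<lambda>p. \<beta> (Y p)) (\<lambda>p. (b (Y p) * Y p) *\<^sub>R D' (snd p))
      (cutoff_wave c \<xi> a) (cutoff_wave_laplacian c \<xi> a) (cutoff_wave_grad c \<xi> a)"
  shows "integrable lborel W" (is ?A)
    and "(LINT p|lborel. W p) + (LINT x|\<rho>\<^sub>0. \<theta> 0 * cutoff_wave c \<xi> a x) = 0" (is ?B)
proof -
  obtain B where B: "\<And>R a x. 0 \<le> R \<Longrightarrow> R \<le> 1 \<Longrightarrow> \<bar>cutoff_wave R \<xi> a x\<bar> \<le> B"
    "\<And>R a x. 0 \<le> R \<Longrightarrow> R \<le> 1 \<Longrightarrow> norm (cutoff_wave_grad R \<xi> a x) \<le> B"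
    "\<And>R a x. 0 \<le> R \<Longrightarrow> R \<le> 1 \<Longrightarrow> \<bar>cutoff_wave_laplacian R \<xi> a x\<bar> \<le> B"
    using cutoff_wave_bounds[of \<xi>] by metis
  show W: ?A
    unfolding W_def
    by (rule weak_integrand_integrable[where B=B]) (use Y zero B c in auto)
  then have W': "integrable (lborel \<Otimes>\<^sub>M lborel) W" by (simp add: lborel_prod)
  then have [measurable]: "W \<in> borel_measurable (lborel \<Otimes>\<^sub>M lborel)" by auto
  have dt: "deriv (\<lambda>s. \<theta> s * cutoff_wave c \<xi> a x) t = \<eta> t * cutoff_wave c \<xi> a x" for t x
    by (rule DERIV_imp_deriv) (rule derivative_eq_intros deriv refl | simp)+
  let ?J = "\<lambda>t x. y (t, x) * (\<eta> t * cutoff_wave c \<xi> a x) + \<beta> (y (t, x)) * (\<theta> t * cutoff_wave_laplacian c \<xi> a x)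
          + b (y (t, x)) * y (t, x) * (D x \<bullet> \<theta> t *\<^sub>R cutoff_wave_grad c \<xi> a x)"
  \<comment> \<open>A null set of pairs has null slices for almost every t, so the replacement is
    legitimate inside the inner integral.\<close>
  have "AE t in lborel. AE x in lborel. fst (t, x) \<in> {0<..<T} \<longrightarrow> y (t, x) = Y (t, x)"
    by (rule lborel_pair.AE_pair) (use eq(1) in \<open>simp only: lborel_prod\<close>)
  then have inner: "AE t in lborel. indicator {0<..<T} t *\<^sub>R (LINT x|lebesgue. ?J t x) = (LINT x|lborel. W (t, x))"
  proof eventually_elim
    case (elim t)
    show ?case
    proof (cases "t \<in> {0<..<T}")
      case True
      have "(LINT x|lebesgue. ?J t x) = (LINT x|lborel. W (t, x))"
      proof (rule integral_completion_AE_eq)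
        show "(\<lambda>x. W (t, x)) \<in> borel_measurable lborel" by measurable
        show "AE x in lborel. ?J t x = W (t, x)"
          using elim eq(2) by eventually_elim (use True in \<open>simp add: W_def weak_integrand_def mult_ac\<close>)
      qed
      with True show ?thesis by simp
    next
      case False
      then show ?thesis using zero by (simp add: W_def weak_integrand_def)
    qed
  qed
  have "(LINT t:{0<..<T}|lebesgue. LINT x|lebesgue. ?J t x) = (LINT t|lborel. LINT x|lborel. W (t, x))"
    unfolding set_lebesgue_integral_def
    by (rule integral_completion_AE_eq[OF _ inner]) measurable
  also have "\<dots> = (LINT p|lborel. W p)"
    using lborel_pair.integral_fst'[OF W'] by (simp add: lborel_prod)
  finally have "(LINT t:{0<..<T}|lebesgue. LINT x|lebesgue. ?J t x) = (LINT p|lborel. W p)" .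
  moreover have "(LINT t:{0<..<T}|lebesgue. LINT x|lebesgue. ?J t x) + (LINT x|\<rho>\<^sub>0. \<theta> 0 * cutoff_wave c \<xi> a x) = 0"
    using sol[unfolded distributional_solution_def, rule_format, OF test]
    by (simp only: fst_conv snd_conv dt laplacian_cutoff_wave grad_cutoff_wave)
  ultimately show ?B by simp
qed

end

section \<open>Uniqueness\<close>

text \<open>Bounds that hold almost everywhere become pointwise, as the Fourier estimates require of
  every slice.\<close>

lemma borel_representative:
  fixes y :: "real \<times> (real ^ 'd) \<Rightarrow> real" and T :: real
  defines "Q \<equiv> {0<..<T} \<times> (UNIV :: (real ^ 'd) set)"
  assumes y: "y \<in> L_infinity (lebesgue_on Q)" "integrable (lebesgue_on Q) y" "AE p in lebesgue_on Q. 0 \<le> y p"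
  obtains Y M where "integrable lborel Y" "\<And>p. 0 \<le> Y p" "\<And>p. Y p \<le> M" "\<And>t x. t \<notin> {0<..<T} \<Longrightarrow> Y (t, x) = 0"
    "AE p in lborel. fst p \<in> {0<..<T} \<longrightarrow> y p = Y p"
proof -
  have "open Q" unfolding Q_def by (intro open_Times) auto
  then have Qb [measurable]: "Q \<in> sets borel" by simp
  have Q: "Q \<inter> space lebesgue \<in> sets lebesgue" by simp
  have y0: "integrable lebesgue (\<lambda>p. indicator Q p *\<^sub>R y p)"
    using y(2) by (subst (asm) integrable_restrict_space[OF Q])
  then obtain g where g [measurable]: "g \<in> borel_measurable lborel" and eq: "AE p in lborel. indicator Q p *\<^sub>R y p = g p"
    using completion_ex_borel_measurable_real[of "\<lambda>p. indicator Q p *\<^sub>R y p" lborel] by auto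
  have gi: "integrable lborel g"
  proof -
    have "integrable lebesgue g"
      using y0 eq g by (subst integrable_cong_AE[of _ _ "\<lambda>p. indicator Q p *\<^sub>R y p"])
        (auto intro!: AE_completion measurable_completion elim: AE_mp)
    then show ?thesis by (simp add: integrable_completion)
  qed
  obtain C where C: "AE p in lebesgue_on Q. norm (y p) \<le> C"
    using y(1) by (auto simp: L_infinity_def)
  \<comment> \<open>Clipping to [0, max C 0] and cutting off outside \<open>Q\<close> changes
    \<open>g\<close> on a null set only; the maximum covers a negative \<open>C\<close>.\<close>
  define Y where "Y p = indicator Q p * max 0 (min (max C 0) (g p))" for p
  have "AE p in lborel. p \<in> Q \<longrightarrow> 0 \<le> y p" "AE p in lborel. p \<in> Q \<longrightarrow> norm (y p) \<le> C"
    using y(3) C by (simp_all add: AE_restrict_space_iff AE_completion_iff)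
  with eq have *: "AE p in lborel. (p \<in> Q \<longrightarrow> y p = Y p) \<and> g p = Y p"
    by eventually_elim (auto simp: Y_def indicator_def split: if_splits)
  show ?thesis
  proof (rule that[of Y "max C 0"])
    show "integrable lborel Y"
      by (rule integrable_cong_AE_imp[OF gi]) (use * in \<open>auto simp: Y_def[abs_def]\<close>)
    show "AE p in lborel. fst p \<in> {0<..<T} \<longrightarrow> y p = Y p"
      using * by eventually_elim (auto simp: Q_def mem_Times_iff)
  qed (auto simp: Y_def indicator_def Q_def)
qed

text \<open>Representatives are taken componentwise. Resetting large values to 0 makes the bound
  pointwise, and \<open>max C 1\<close> makes it positive, as the constant \<kappa> of the
  uniqueness theorem has to be.\<close>

lemma borel_representative_vector:
  fixes D :: "'a::euclidean_space \<Rightarrow> 'b::euclidean_space"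
  assumes D: "D \<in> L_infinity lebesgue"
  obtains D' C where "D' \<in> borel_measurable borel" "C > 0" "\<And>x. norm (D' x) \<le> C" "AE x in lborel. D x = D' x"
proof -
  from D obtain C where C: "AE x in lborel. norm (D x) \<le> C" and m: "D \<in> borel_measurable lebesgue"
    by (auto simp: L_infinity_def AE_completion_iff)
  have "\<exists>g \<in> borel_measurable lborel. AE x in lborel. D x \<bullet> i = g x" if "i \<in> Basis" for i
    by (rule completion_ex_borel_measurable_real) (use m in measurable)
  then obtain g where g: "\<And>i. i \<in> Basis \<Longrightarrow> g i \<in> borel_measurable lborel"
    "\<And>i. i \<in> Basis \<Longrightarrow> AE x in lborel. D x \<bullet> i = g i x"
    by metis
  define E where "E x = (\<Sum>i\<in>Basis. g i x *\<^sub>R i)" for x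
  have [measurable]: "E \<in> borel_measurable borel"
    unfolding E_def[abs_def] using g(1) by (intro borel_measurable_sum borel_measurable_scaleR) auto
  have "AE x in lborel. \<forall>i\<in>Basis. D x \<bullet> i = g i x"
    by (intro AE_finite_allI g) auto
  then have "AE x in lborel. D x = E x"
  proof eventually_elim
    case (elim x)
    have "D x = (\<Sum>i\<in>Basis. (D x \<bullet> i) *\<^sub>R i)" by (simp add: euclidean_representation)
    with elim show ?case by (simp add: E_def)
  qed
  with C have *: "AE x in lborel. D x = (if norm (E x) \<le> max C 1 then E x else 0)"
    by eventually_elim auto
  show ?thesis
    by (rule that[of "\<lambda>x. if norm (E x) \<le> max C 1 then E x else 0" "max C 1"]) (use * in auto)
qed

text \<open>Both g - f and g + f are nondecreasing on the interval. This passes from derivative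
  bounds to difference bounds, for hypothesis (jv) as well as for the Lipschitz estimate.\<close>

lemma abs_diff_le_of_abs_derivative_le:
  fixes f g f' g' :: "real \<Rightarrow> real"
  assumes f: "\<And>x. (f has_real_derivative f' x) (at x)" and g: "\<And>x. (g has_real_derivative g' x) (at x)"
    and le: "\<And>x. x \<in> {a..b} \<Longrightarrow> \<bar>f' x\<bar> \<le> g' x" and rs: "r \<in> {a..b}" "s \<in> {a..b}"
  shows "\<bar>f r - f s\<bar> \<le> \<bar>g r - g s\<bar>"
proof -
  have *: "\<bar>f r - f s\<bar> \<le> g r - g s" if "s \<le> r" "a \<le> s" "r \<le> b" for r s
  proof -
    have "g s - f s \<le> g r - f r"
    proof (rule DERIV_nonneg_imp_nondecreasing[OF that(1)])
      fix x assume "s \<le> x" "x \<le> r"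
      with le[of x] that show "\<exists>y. ((\<lambda>x. g x - f x) has_real_derivative y) (at x) \<and> 0 \<le> y"
        by (intro exI[of _ "g' x - f' x"] conjI DERIV_diff f g) auto
    qed
    moreover have "g s + f s \<le> g r + f r"
    proof (rule DERIV_nonneg_imp_nondecreasing[OF that(1)])
      fix x assume "s \<le> x" "x \<le> r"
      with le[of x] that show "\<exists>y. ((\<lambda>x. g x + f x) has_real_derivative y) (at x) \<and> 0 \<le> y"
        by (intro exI[of _ "g' x + f' x"] conjI DERIV_add f g) auto
    qed
    ultimately show ?thesis by linarith
  qed
  from *[of s r] *[of r s] rs show ?thesis by (cases "s \<le> r") (auto simp: abs_minus_commute)
qed

lemma C1_on_UNIV_real:
  fixes f :: "real \<Rightarrow> real"
  assumes "f C1_differentiable_on UNIV"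
  shows "(f has_real_derivative deriv f x) (at x)" and "continuous_on UNIV (deriv f)" and "continuous_on UNIV f"
proof -
  from assms obtain D where D: "\<And>x. (f has_real_derivative D x) (at x)" "continuous_on UNIV D"
    by (auto simp: C1_differentiable_on_def has_real_derivative_iff_has_vector_derivative)
  then have "deriv f = D" by (auto intro: DERIV_imp_deriv)
  with D show "(f has_real_derivative deriv f x) (at x)" "continuous_on UNIV (deriv f)" by auto
  show "continuous_on UNIV f" using D(1) by (meson DERIV_continuous_on has_field_derivative_at_within)
qed

text \<open>On a compact range \<beta> is Lipschitz. Multiplying that bound by |\<beta> r - \<beta>
  s| gives the quadratic one, because monotonicity makes r - s and \<beta> r - \<beta> s agree in
  sign. The flux bound is the difference form of (jv).\<close>

lemma nonlinearity_bounds: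
  fixes \<beta> b :: "real \<Rightarrow> real"
  assumes \<beta>: "\<beta> C1_differentiable_on UNIV" "\<And>r. deriv \<beta> r \<ge> 0" and b: "b C1_differentiable_on UNIV"
    and dom: "\<And>K :: real set. compact K \<Longrightarrow> \<exists>\<alpha>>0. \<forall>r\<in>K. \<bar>deriv b r * r + b r\<bar> \<le> \<alpha> * \<bar>deriv \<beta> r\<bar>"
  obtains L \<alpha> where "L > 0" "\<alpha> > 0"
    "\<And>r s. r \<in> {0..M} \<Longrightarrow> s \<in> {0..M} \<Longrightarrow> \<bar>\<beta> r - \<beta> s\<bar> \<le> L * \<bar>r - s\<bar>"
    "\<And>r s. r \<in> {0..M} \<Longrightarrow> s \<in> {0..M} \<Longrightarrow> (\<beta> r - \<beta> s)\<^sup>2 \<le> L * ((r - s) * (\<beta> r - \<beta> s))"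
    "\<And>r s. r \<in> {0..M} \<Longrightarrow> s \<in> {0..M} \<Longrightarrow> \<bar>b r * r - b s * s\<bar> \<le> \<alpha> * \<bar>\<beta> r - \<beta> s\<bar>"
proof -
  note \<beta>' = C1_on_UNIV_real[OF \<beta>(1)] and b' = C1_on_UNIV_real[OF b]
  have "compact (deriv \<beta> ` {0..M})"
    by (intro compact_continuous_image continuous_on_subset[OF \<beta>'(2)]) auto
  then obtain L0 where L0: "\<And>r. r \<in> {0..M} \<Longrightarrow> \<bar>deriv \<beta> r\<bar> \<le> L0"
    using compact_imp_bounded bounded_iff by (metis image_eqI real_norm_def)
  \<comment> \<open>The maximum keeps \<open>L\<close> positive, as the derivative of \<beta> may
    vanish on the whole range.\<close>
  define L where "L = max L0 1"
  have L: "L > 0" "\<bar>deriv \<beta> r\<bar> \<le> L" if "r \<in> {0..M}" for r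
    using L0[OF that] by (auto simp: L_def)
  have L1: "L > 0" by (simp add: L_def)
  from dom[OF compact_Icc[of 0 M]] obtain \<alpha> where \<alpha>: "\<alpha> > 0" "\<And>r. r \<in> {0..M} \<Longrightarrow> \<bar>deriv b r * r + b r\<bar> \<le> \<alpha> * \<bar>deriv \<beta> r\<bar>"
    by blast
  have 1: "\<bar>\<beta> r - \<beta> s\<bar> \<le> L * \<bar>r - s\<bar>" if "r \<in> {0..M}" "s \<in> {0..M}" for r s
  proof -
    have "\<bar>\<beta> r - \<beta> s\<bar> \<le> \<bar>L * r - L * s\<bar>"
      by (rule abs_diff_le_of_abs_derivative_le[where g="\<lambda>r. L * r" and g'="\<lambda>_. L", OF \<beta>'(1) _ L(2) that])
        (auto intro!: derivative_eq_intros)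
    then show ?thesis using L1 by (simp add: abs_mult flip: right_diff_distrib)
  qed
  have 2: "(\<beta> r - \<beta> s)\<^sup>2 \<le> L * ((r - s) * (\<beta> r - \<beta> s))" if "r \<in> {0..M}" "s \<in> {0..M}" for r s
  proof -
    have mono: "\<beta> r \<le> \<beta> s" if "r \<le> s" for r s
      using \<beta> \<beta>'(1) by (intro DERIV_nonneg_imp_nondecreasing[OF that]) auto
    have "(\<beta> r - \<beta> s)\<^sup>2 = \<bar>\<beta> r - \<beta> s\<bar> * \<bar>\<beta> r - \<beta> s\<bar>" by (simp add: power2_eq_square)
    also have "\<dots> \<le> L * \<bar>r - s\<bar> * \<bar>\<beta> r - \<beta> s\<bar>" by (intro mult_right_mono 1 that) auto
    also have "\<dots> = L * (\<bar>r - s\<bar> * \<bar>\<beta> r - \<beta> s\<bar>)" by (rule mult.assoc)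
    also have "\<bar>r - s\<bar> * \<bar>\<beta> r - \<beta> s\<bar> = (r - s) * (\<beta> r - \<beta> s)"
      using mono[of r s] mono[of s r] by (cases "r \<le> s") (auto simp: abs_if algebra_simps)
    finally show ?thesis .
  qed
  have 3: "\<bar>b r * r - b s * s\<bar> \<le> \<alpha> * \<bar>\<beta> r - \<beta> s\<bar>" if "r \<in> {0..M}" "s \<in> {0..M}" for r s
  proof -
    have "\<bar>b r * r - b s * s\<bar> \<le> \<bar>\<alpha> * \<beta> r - \<alpha> * \<beta> s\<bar>"
    proof (rule abs_diff_le_of_abs_derivative_le[where f="\<lambda>r. b r * r" and g="\<lambda>r. \<alpha> * \<beta> r", OF _ _ _ that])
      show "((\<lambda>r. b r * r) has_real_derivative (deriv b x * x + b x)) (at x)" for x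
        by (rule derivative_eq_intros b'(1) refl | simp)+
      show "((\<lambda>r. \<alpha> * \<beta> r) has_real_derivative (\<alpha> * deriv \<beta> x)) (at x)" for x
        by (rule DERIV_cmult[OF \<beta>'(1)])
      show "\<bar>deriv b x * x + b x\<bar> \<le> \<alpha> * deriv \<beta> x" if "x \<in> {0..M}" for x
        using \<alpha>(2)[OF that] \<beta>(2)[of x] by simp
    qed
    then show ?thesis using \<alpha>(1) by (simp add: abs_mult flip: right_diff_distrib)
  qed
  show ?thesis by (rule that[OF L1 \<alpha>(1) 1 2 3])
qed

text \<open>A nonnegative Radon measure of bounded variation on \<open>real ^ 'd\<close> is the same
  as a finite measure on the Borel sets, which is the encoding of
  \<open>\<rho>\<^sub>0\<close>.\<close>

theorem corollary3p5:
  fixes T :: real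
    and \<beta> b :: "real \<Rightarrow> real"
    and D :: "real ^ 'd \<Rightarrow> real ^ 'd"
    and \<rho>\<^sub>0 :: "(real ^ 'd) measure"
    and y\<^sub>1 y\<^sub>2 :: "real \<times> (real ^ 'd) \<Rightarrow> real"
  defines "Q \<equiv> {0<..<T} \<times> (UNIV :: (real ^ 'd) set)"
  assumes "T > 0"
    and "\<beta> C1_differentiable_on UNIV" and "\<And>r. deriv \<beta> r \<ge> 0" and "\<beta> 0 = 0"
    and "D \<in> L_infinity lebesgue"
    and "b C1_differentiable_on UNIV"
    and "\<And>K :: real set. compact K \<Longrightarrow>
           \<exists>\<alpha>>0. \<forall>r\<in>K. \<bar>deriv b r * r + b r\<bar> \<le> \<alpha> * \<bar>deriv \<beta> r\<bar>"
    and "sets \<rho>\<^sub>0 = sets borel" and "finite_measure \<rho>\<^sub>0"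
    and "y\<^sub>1 \<in> L_infinity (lebesgue_on Q)" and "integrable (lebesgue_on Q) y\<^sub>1"
    and "y\<^sub>2 \<in> L_infinity (lebesgue_on Q)" and "integrable (lebesgue_on Q) y\<^sub>2"
    and "AE z in lebesgue_on Q. y\<^sub>1 z \<ge> 0"
    and "AE z in lebesgue_on Q. y\<^sub>2 z \<ge> 0"
    and "distributional_solution T \<beta> b D \<rho>\<^sub>0 y\<^sub>1"
    and "distributional_solution T \<beta> b D \<rho>\<^sub>0 y\<^sub>2"
  shows "AE z in lebesgue_on Q. y\<^sub>1 z = y\<^sub>2 z"
proof -
  note \<beta> = assms(3,4) and \<beta>0 = assms(5) and b = assms(7) and dom = assms(8)
  obtain Y\<^sub>1 M\<^sub>1 where Y1: "integrable lborel Y\<^sub>1" "\<And>p. 0 \<le> Y\<^sub>1 p" "\<And>p. Y\<^sub>1 p \<le> M\<^sub>1" "\<And>t x. t \<notin> {0<..<T} \<Longrightarrow> Y\<^sub>1 (t, x) = 0"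
    "AE p in lborel. fst p \<in> {0<..<T} \<longrightarrow> y\<^sub>1 p = Y\<^sub>1 p"
    using borel_representative[OF assms(11,12,15)[unfolded Q_def]] by blast
  obtain Y\<^sub>2 M\<^sub>2 where Y2: "integrable lborel Y\<^sub>2" "\<And>p. 0 \<le> Y\<^sub>2 p" "\<And>p. Y\<^sub>2 p \<le> M\<^sub>2" "\<And>t x. t \<notin> {0<..<T} \<Longrightarrow> Y\<^sub>2 (t, x) = 0"
    "AE p in lborel. fst p \<in> {0<..<T} \<longrightarrow> y\<^sub>2 p = Y\<^sub>2 p"
    using borel_representative[OF assms(13,14,16)[unfolded Q_def]] by blast
  obtain D' C where D': "D' \<in> borel_measurable borel" "C > 0" "\<And>x. norm (D' x) \<le> C" "AE x in lborel. D x = D' x"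
    using borel_representative_vector[OF assms(6)] by blast
  define M where "M = max M\<^sub>1 M\<^sub>2"
  have YM: "Y\<^sub>1 p \<in> {0..M}" "Y\<^sub>2 p \<in> {0..M}" for p
    using Y1(2,3)[of p] Y2(2,3)[of p] by (auto simp: M_def)
  \<comment> \<open>With 0 in the range and \<open>\<beta> 0 = 0\<close>, the difference bounds
    against 0 control \<beta>(Y) and b(Y) Y by a multiple of Y, whence their integrability.\<close>
  have M0: "0 \<in> {0..M}" using YM(1)[of undefined] by auto
  obtain L \<alpha> where L: "L > 0" and \<alpha>: "\<alpha> > 0"
    and lip: "\<And>r s. r \<in> {0..M} \<Longrightarrow> s \<in> {0..M} \<Longrightarrow> \<bar>\<beta> r - \<beta> s\<bar> \<le> L * \<bar>r - s\<bar>"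
    and mono: "\<And>r s. r \<in> {0..M} \<Longrightarrow> s \<in> {0..M} \<Longrightarrow> (\<beta> r - \<beta> s)\<^sup>2 \<le> L * ((r - s) * (\<beta> r - \<beta> s))"
    and flux: "\<And>r s. r \<in> {0..M} \<Longrightarrow> s \<in> {0..M} \<Longrightarrow> \<bar>b r * r - b s * s\<bar> \<le> \<alpha> * \<bar>\<beta> r - \<beta> s\<bar>"
    using nonlinearity_bounds[OF \<beta> b dom] by blast
  have [measurable]: "Y\<^sub>1 \<in> borel_measurable borel" "Y\<^sub>2 \<in> borel_measurable borel" "D' \<in> borel_measurable borel"
    using Y1 Y2 D' by auto
  have [measurable]: "\<beta> \<in> borel_measurable borel" "b \<in> borel_measurable borel"
    using C1_on_UNIV_real(3)[OF \<beta>(1)] C1_on_UNIV_real(3)[OF b] by (auto intro: borel_measurable_continuous_onI)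
  have [measurable]: "(\<lambda>p::real \<times> (real ^ 'd). D' (snd p)) \<in> borel_measurable borel"
    by (simp flip: borel_prod)
  have nonlin: "integrable lborel (\<lambda>p. \<beta> (Y p))" "integrable lborel (\<lambda>p. (b (Y p) * Y p) *\<^sub>R D' (snd p))"
    if Yi: "integrable lborel Y" and YM: "\<And>p. Y p \<in> {0..M}" for Y :: "real \<times> (real ^ 'd) \<Rightarrow> real"
  proof -
    have [measurable]: "Y \<in> borel_measurable borel" using Yi by auto
    have le: "\<bar>\<beta> (Y p)\<bar> \<le> L * Y p" "\<bar>b (Y p) * Y p\<bar> \<le> \<alpha> * \<bar>\<beta> (Y p)\<bar>" for p
      using lip[OF YM[of p] M0] flux[OF YM[of p] M0] YM[of p] by (auto simp: \<beta>0)
    show "integrable lborel (\<lambda>p. \<beta> (Y p))"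
      by (rule Bochner_Integration.integrable_bound[OF integrable_mult_right[of L, OF Yi]])
        (use order_trans[OF le(1) abs_ge_self] in \<open>auto intro!: AE_I2\<close>)
    show "integrable lborel (\<lambda>p. (b (Y p) * Y p) *\<^sub>R D' (snd p))"
    proof (rule Bochner_Integration.integrable_bound[OF integrable_mult_right[of "\<alpha> * L * C", OF Yi]])
      show "AE p in lborel. norm ((b (Y p) * Y p) *\<^sub>R D' (snd p)) \<le> norm (\<alpha> * L * C * Y p)"
      proof (rule AE_I2)
        fix p
        have "\<bar>b (Y p) * Y p\<bar> \<le> \<alpha> * (L * Y p)"
          using le(2)[of p] mult_left_mono[OF le(1)[of p], of \<alpha>] \<alpha> by linarith
        then have "\<bar>b (Y p) * Y p\<bar> * norm (D' (snd p)) \<le> \<alpha> * (L * Y p) * C"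
          by (intro mult_mono D') (use \<alpha> L YM[of p] in auto)
        also have "\<dots> \<le> norm (\<alpha> * L * C * Y p)"
          by (simp add: mult_ac)
        finally show "norm ((b (Y p) * Y p) *\<^sub>R D' (snd p)) \<le> norm (\<alpha> * L * C * Y p)"
          unfolding norm_scaleR .
      qed
    qed measurable
  qed
  note n1 = nonlin[OF Y1(1) YM(1)] and n2 = nonlin[OF Y2(1) YM(2)]
  define z where "z p = Y\<^sub>1 p - Y\<^sub>2 p" for p
  define w where "w p = \<beta> (Y\<^sub>1 p) - \<beta> (Y\<^sub>2 p)" for p
  define G where "G p = (b (Y\<^sub>1 p) * Y\<^sub>1 p) *\<^sub>R D' (snd p) - (b (Y\<^sub>2 p) * Y\<^sub>2 p) *\<^sub>R D' (snd p)" for p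
  have zi: "integrable lborel z" unfolding z_def using Y1(1) Y2(1) by simp
  have wi: "integrable lborel w" unfolding w_def using n1 n2 by simp
  have Gi: "integrable lborel G" unfolding G_def using n1 n2 by simp
  have zero: "z (t, x) = 0" "w (t, x) = 0" "G (t, x) = 0" if "t \<notin> {0<..<T}" for t x
    using Y1(4)[OF that] Y2(4)[OF that] by (simp_all add: z_def w_def G_def)
  have "AE p in lborel. z p = 0"
  \<comment> \<open>\<kappa> is the flux constant times the bound on \<open>D'\<close>;
    \<open>max M (L * M)\<close> bounds z and w at once.\<close>
  proof (rule fourier_evolution_uniqueness[where L=L and \<kappa>="\<alpha> * C" and M="max M (L * M)" and w=w and G=G and T=T, OF zi _ wi])
    have zM: "\<bar>z p\<bar> \<le> M" for p using YM[of p] by (auto simp: z_def)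
    then show "\<bar>z p\<bar> \<le> max M (L * M)" for p by (rule order_trans) simp
    show "\<bar>w p\<bar> \<le> max M (L * M)" for p
      using lip[OF YM(1)[of p] YM(2)[of p]] mult_left_mono[OF zM[of p], of L] L
      unfolding z_def[symmetric] w_def[symmetric] by linarith
    show "G \<in> borel_measurable borel" using Gi by auto
    show "norm (G p) \<le> \<alpha> * C * \<bar>w p\<bar>" for p
    proof -
      have "norm (G p) = \<bar>b (Y\<^sub>1 p) * Y\<^sub>1 p - b (Y\<^sub>2 p) * Y\<^sub>2 p\<bar> * norm (D' (snd p))"
        unfolding G_def by (simp flip: scaleR_left_diff_distrib)
      also have "\<dots> \<le> (\<alpha> * \<bar>w p\<bar>) * C"
        unfolding w_def by (intro mult_mono flux YM D') (use \<alpha> in auto)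
      finally show ?thesis by (simp add: mult_ac)
    qed
    show "\<alpha> * C > 0" using \<alpha> D'(2) by simp
    show "L > 0" by (rule L)
    show "(w p)\<^sup>2 \<le> L * (z p * w p)" for p
      unfolding z_def w_def by (rule mono[OF YM])
    show "z (t, x) = 0" if "t \<notin> {0<..<T}" for t x by (rule zero(1)[OF that])
    fix \<xi> :: "real ^ 'd"
    show "AE t in lborel. t \<in> {0<..<T} \<longrightarrow>
      fourier (\<lambda>x. z (t, x)) \<xi> = primitive (\<lambda>s. slice_symbol (\<lambda>x. w (s, x)) (\<lambda>x. G (s, x)) \<xi>) t"
    proof (rule weak_derivative_imp_primitive[OF fourier_slice_integrable[OF zi] slice_symbol_slice_integrable[OF wi Gi]])
      fix \<theta> \<eta> :: "real \<Rightarrow> real" and q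
      assume \<theta>: "\<And>t. (\<theta> has_real_derivative \<eta> t) (at t)" "continuous_on UNIV \<eta>" "\<And>k. Ck_on k \<theta> UNIV"
        "q < T" "\<And>t. q \<le> t \<Longrightarrow> \<theta> t = 0"
      have \<theta>c: "continuous_on UNIV \<theta>" using \<theta>(3)[of 0] by simp
      \<comment> \<open>The profiles are only known to be continuous, so the bounds for
        \<open>time_slab\<close> come from compactness of [0,T].\<close>
      have "compact (\<eta> ` {0..T})" "compact (\<theta> ` {0..T})"
        by (intro compact_continuous_image continuous_on_subset[OF \<theta>(2)] continuous_on_subset[OF \<theta>c]; simp)+
      then obtain B\<^sub>1 B\<^sub>2 where B: "\<And>t. t \<in> {0..T} \<Longrightarrow> \<bar>\<eta> t\<bar> \<le> B\<^sub>1" "\<And>t. t \<in> {0..T} \<Longrightarrow> \<bar>\<theta> t\<bar> \<le> B\<^sub>2"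
        by (metis bounded_iff compact_imp_bounded image_eqI real_norm_def)
      interpret time_slab T "max B\<^sub>1 B\<^sub>2" \<eta> \<theta>
      proof
        show "\<bar>\<eta> t\<bar> \<le> max B\<^sub>1 B\<^sub>2" "\<bar>\<theta> t\<bar> \<le> max B\<^sub>1 B\<^sub>2" if "t \<in> {0<..<T}" for t
          using B[of t] that by auto
      qed (use \<theta>(2) \<theta>c in \<open>auto intro: borel_measurable_continuous_onI\<close>)
      show "(LINT t|lborel. \<eta> t *\<^sub>R fourier (\<lambda>x. z (t, x)) \<xi>) +
        (LINT t|lborel. \<theta> t *\<^sub>R slice_symbol (\<lambda>x. w (t, x)) (\<lambda>x. G (t, x)) \<xi>) = 0"
      proof (rule fourier_weak_equation[OF zi wi Gi zero])
        fix c a :: real assume c: "0 < c" "c \<le> 1"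
        let ?W = "\<lambda>z w G. weak_integrand \<eta> \<theta> z w G (cutoff_wave c \<xi> a) (cutoff_wave_laplacian c \<xi> a) (cutoff_wave_grad c \<xi> a)"
        note test = test_function_cutoff_wave[OF \<theta>(3,4,5) c, of \<xi> a]
        have c': "0 \<le> c" using c by simp
        note s1 = distributional_solution_cutoff_wave[OF assms(17) Y1(5) D'(4) Y1(1) n1 Y1(4) \<beta>0 test c' c(2) \<theta>(1)]
        note s2 = distributional_solution_cutoff_wave[OF assms(18) Y2(5) D'(4) Y2(1) n2 Y2(4) \<beta>0 test c' c(2) \<theta>(1)]
        \<comment> \<open>The integrand is linear in the triple (z, w, G), and both solutions have
          the same initial term, which therefore drops out of the difference.\<close>
        have "?W z w G p = ?W Y\<^sub>1 (\<lambda>p. \<beta> (Y\<^sub>1 p)) (\<lambda>p. (b (Y\<^sub>1 p) * Y\<^sub>1 p) *\<^sub>R D' (snd p)) p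
          - ?W Y\<^sub>2 (\<lambda>p. \<beta> (Y\<^sub>2 p)) (\<lambda>p. (b (Y\<^sub>2 p) * Y\<^sub>2 p) *\<^sub>R D' (snd p)) p" for p
          unfolding weak_integrand_def z_def w_def G_def inner_diff_left by (simp add: algebra_simps)
        then show "(LINT p|lborel. ?W z w G p) = 0"
          using s1 s2 by simp
      qed
    qed
  qed
  then have "AE p in lborel. p \<in> Q \<longrightarrow> y\<^sub>1 p = y\<^sub>2 p"
    using Y1(5) Y2(5) by eventually_elim (auto simp: z_def Q_def)
  moreover have "Q \<inter> space lebesgue \<in> sets lebesgue"
  proof -
    have "open Q" unfolding Q_def by (intro open_Times) auto
    then show ?thesis by simp
  qed
  ultimately show ?thesis
    by (simp add: AE_restrict_space_iff AE_completion_iff)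
qed

end
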